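(* If $n\ge 5$ then $S_n$ and $A_n$ have presentations with $3$ generators, $7$ relations and bit-length $O(\log n)$. Moreover, these presentations use a bounded number of exponents, each of which is at most $n$ (the implied constant and the bound on the number of exponents being absolute, independent of $n$).
   Context: A presentation $\langle X\mid R\rangle$ has $|X|$ generators and $|R|$ relations. Its bit-length is the total number of bits required to write the presentation: all exponents are encoded as binary strings, the sum of whose lengths enters into the bit-length, as does the space required to enumerate the list of generators and relations. The bit-length $bl(w)$ of a word $w$ (words may be written using nested powers) is required to satisfy $bl(x)=1$ for $x\in X$; $bl(w^m)\le bl(w)+\log|m|$ for $m\in\mathbb{Z}\setminus\{0,1,-1\}$; and $bl(ww')\le bl(w)+bl(w')$ for all words $w,w'$. Logarithms are to the base $2$. The number of exponents means the total number of exponents used in writing the presentation. *)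

theory Defs
  imports Complex_Main "HOL-Algebra.Sym_Groups"
begin

section \<open>Free groups\<close>

text \<open>A letter \<open>(x, False)\<close> stands for the generator \<open>x\<close>, and \<open>(x, True)\<close> for its formal inverse.
  Elements of the free group are the freely reduced lists of letters.\<close>

type_synonym 'x letter = "'x \<times> bool"

definition linv :: "'x letter \<Rightarrow> 'x letter" where
  "linv a = (fst a, \<not> snd a)"

fun freely_reduced :: "'x letter list \<Rightarrow> bool" where
  "freely_reduced [] = True"
| "freely_reduced [a] = True"
| "freely_reduced (a # b # w) = (b \<noteq> linv a \<and> freely_reduced (b # w))"

definition rcons :: "'x letter \<Rightarrow> 'x letter list \<Rightarrow> 'x letter list" where
  "rcons a w = (case w of [] \<Rightarrow> [a] | b # v \<Rightarrow> if b = linv a then v else a # w)"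

definition free_group :: "'x set \<Rightarrow> 'x letter list monoid" where
  "free_group X =
    \<lparr> carrier = {w. freely_reduced w \<and> fst ` set w \<subseteq> X},
      mult = (\<lambda>v w. foldr rcons v w),
      one = [] \<rparr>"

lemma linv_linv [simp]: "linv (linv a) = a"
  by (simp add: linv_def)

lemma linv_neq [simp]: "linv a \<noteq> a" "a \<noteq> linv a"
  by (cases a; simp add: linv_def)+

lemma fst_linv [simp]: "fst (linv a) = fst a"
  by (simp add: linv_def)

lemma freely_reduced_tl: "freely_reduced (a # w) \<Longrightarrow> freely_reduced w"
  by (cases w) auto

lemma freely_reduced_rcons: "freely_reduced w \<Longrightarrow> freely_reduced (rcons a w)"
  by (cases w) (auto simp: rcons_def dest: freely_reduced_tl)

lemma freely_reduced_foldr_rcons: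
  "freely_reduced w \<Longrightarrow> freely_reduced (foldr rcons v w)"
  by (induction v) (auto intro: freely_reduced_rcons)

lemma set_rcons: "set (rcons a w) \<subseteq> insert a (set w)"
  by (auto simp: rcons_def split: list.splits if_splits)

lemma set_foldr_rcons: "set (foldr rcons v w) \<subseteq> set v \<union> set w"
proof (induction v)
  case (Cons a v)
  then show ?case using set_rcons[of a "foldr rcons v w"] by auto
qed simp

lemma rcons_cancel: "freely_reduced w \<Longrightarrow> rcons a (rcons (linv a) w) = w"
proof (cases w)
  case (Cons b v)
  assume "freely_reduced w"
  then show ?thesis using Cons by (cases v) (auto simp: rcons_def)
qed (simp add: rcons_def)

lemma foldr_rcons_rcons:
  assumes "freely_reduced w"
  shows "foldr rcons (rcons a v) w = rcons a (foldr rcons v w)"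
proof (cases v)
  case (Cons b u)
  show ?thesis
  proof (cases "b = linv a")
    case True
    then show ?thesis
      using Cons rcons_cancel[OF freely_reduced_foldr_rcons[OF assms], of a u]
      by (simp add: rcons_def)
  next
    case False
    then show ?thesis using Cons by (simp add: rcons_def)
  qed
qed (simp add: rcons_def)

lemma foldr_rcons_assoc:
  "freely_reduced w \<Longrightarrow>
    foldr rcons (foldr rcons u v) w = foldr rcons u (foldr rcons v w)"
  by (induction u) (simp_all add: foldr_rcons_rcons)

lemma foldr_rcons_Nil: "freely_reduced w \<Longrightarrow> foldr rcons w [] = w"
proof (induction w)
  case (Cons a w)
  then have "foldr rcons w [] = w" by (blast dest: freely_reduced_tl)
  moreover have "rcons a w = a # w"
    using Cons.prems by (cases w) (auto simp: rcons_def)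
  ultimately show ?case by simp
qed simp

lemma foldr_rcons_left_inverse:
  "freely_reduced w \<Longrightarrow> foldr rcons (map linv (rev w)) w = []"
proof (induction w)
  case (Cons a w)
  have "rcons (linv a) (a # w) = w" by (simp add: rcons_def)
  then show ?case using Cons freely_reduced_tl[OF Cons.prems] by simp
qed simp

lemma group_free_group: "group (free_group X)"
proof (rule groupI)
  fix x y
  assume "x \<in> carrier (free_group X)" "y \<in> carrier (free_group X)"
  then show "x \<otimes>\<^bsub>free_group X\<^esub> y \<in> carrier (free_group X)"
    using image_mono[OF set_foldr_rcons[of x y], of fst]
    unfolding image_Un
    by (simp add: free_group_def freely_reduced_foldr_rcons) (meson Un_least subset_trans)
next
  fix x
  assume x: "x \<in> carrier (free_group X)"
  define y where "y = foldr rcons (map linv (rev x)) []"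
  have "set y \<subseteq> linv ` set x"
    using set_foldr_rcons[of "map linv (rev x)" "[]"] by (auto simp: y_def)
  then have "fst ` set y \<subseteq> fst ` linv ` set x"
    by (rule image_mono)
  then have "fst ` set y \<subseteq> fst ` set x"
    by (simp add: image_image)
  then have "y \<in> carrier (free_group X)"
    using x by (auto simp: free_group_def y_def freely_reduced_foldr_rcons)
  moreover have "y \<otimes>\<^bsub>free_group X\<^esub> x = \<one>\<^bsub>free_group X\<^esub>"
    using x by (simp add: free_group_def y_def foldr_rcons_assoc foldr_rcons_left_inverse)
  ultimately show "\<exists>y\<in>carrier (free_group X). y \<otimes>\<^bsub>free_group X\<^esub> x = \<one>\<^bsub>free_group X\<^esub>"
    by blast
qed (auto simp: free_group_def foldr_rcons_assoc)


section \<open>Words with nested powers, and presentations\<close>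

text \<open>The syntax tree of a word as it is written down. Inverses are written as \<open>Pow w (-1)\<close>.\<close>

datatype 'x pword =
    Gen 'x
  | Mul "'x pword" "'x pword"
  | Pow "'x pword" int

primrec word_val :: "'x set \<Rightarrow> 'x pword \<Rightarrow> 'x letter list" where
  "word_val X (Gen x) = [(x, False)]"
| "word_val X (Mul v w) = word_val X v \<otimes>\<^bsub>free_group X\<^esub> word_val X w"
| "word_val X (Pow w m) = word_val X w [^]\<^bsub>free_group X\<^esub> m"

definition normal_closure :: "('a, 'b) monoid_scheme \<Rightarrow> 'a set \<Rightarrow> 'a set" where
  "normal_closure G S = \<Inter>{N. N \<lhd> G \<and> S \<subseteq> N}"

definition presented_group :: "'x set \<Rightarrow> 'x pword set \<Rightarrow> 'x letter list set monoid" where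
  "presented_group X R = free_group X Mod normal_closure (free_group X) (word_val X ` R)"

text \<open>\<open>\<langle>X | R\<rangle>\<close> is a finite presentation of \<open>G\<close>; each \<open>r \<in> R\<close> stands for the relation \<open>r = 1\<close>.\<close>

definition is_presentation_of ::
  "'x set \<Rightarrow> 'x pword set \<Rightarrow> ('a, 'b) monoid_scheme \<Rightarrow> bool" where
  "is_presentation_of X R G \<longleftrightarrow>
    finite X \<and> finite R \<and> (\<forall>r\<in>R. set_pword r \<subseteq> X) \<and> presented_group X R \<cong> G"


section \<open>Bit-length and exponents\<close>

text \<open>The largest function subject to \<open>bl(x) = 1\<close>, \<open>bl(ww') \<le> bl(w) + bl(w')\<close> and
  \<open>bl(w^m) \<le> bl(w) + log |m|\<close> for \<open>m \<notin> {0, 1, -1}\<close>; the exponents \<open>0, 1, -1\<close>, for which nothing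
  is prescribed, add nothing.\<close>

primrec bl :: "'x pword \<Rightarrow> real" where
  "bl (Gen x) = 1"
| "bl (Mul v w) = bl v + bl w"
| "bl (Pow w m) = bl w + log 2 (real_of_int (max 1 \<bar>m\<bar>))"

text \<open>Besides the relators themselves, one unit is charged for listing each generator and each
  relation.\<close>

definition bit_length :: "'x set \<Rightarrow> 'x pword set \<Rightarrow> real" where
  "bit_length X R = real (card X) + (\<Sum>r\<in>R. 1 + bl r)"

text \<open>The exponents occurring in a written word, with repetitions; \<open>0\<close>, \<open>1\<close> and \<open>-1\<close> are included.\<close>

primrec exponents :: "'x pword \<Rightarrow> int list" where
  "exponents (Gen x) = []"
| "exponents (Mul v w) = exponents v @ exponents w"
| "exponents (Pow w m) = m # exponents w"

definition num_exponents :: "'x pword set \<Rightarrow> nat" where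
  "num_exponents R = (\<Sum>r\<in>R. length (exponents r))"

text \<open>\<open>G\<close> has a presentation with \<open>3\<close> generators, \<open>7\<close> relations and bit-length at most \<open>C log n\<close>,
  using at most \<open>k\<close> exponents, each of absolute value at most \<open>n\<close>.\<close>

definition has_short_presentation ::
  "real \<Rightarrow> nat \<Rightarrow> nat \<Rightarrow> ('a, 'b) monoid_scheme \<Rightarrow> bool" where
  "has_short_presentation C k n G \<longleftrightarrow>
    (\<exists>(X :: nat set) (R :: nat pword set).
      is_presentation_of X R G \<and> card X = 3 \<and> card R = 7 \<and>
      bit_length X R \<le> C * log 2 (real n) \<and>
      num_exponents R \<le> k \<and>
      (\<forall>r\<in>R. \<forall>m\<in>set (exponents r). \<bar>m\<bar> \<le> int n))"

end

(*
  For an odd prime p with primitive root r, five relations of bounded length up to exponents force the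
  elements x_i = z^(a^i) to satisfy Carmichael's relations for the 3-cycles (alpha beta i): conjugation
  by b multiplies indices by r, and conjugation by a translates them, so that a single relation
  (x_0 x_1)^2 = 1 spreads to all pairs. This is a copy of A_(p+2).
  For degree n between p + 2 and 2p, choose k < p with n = p + k or n = p + k + 1 and add a k-cycle h
  commuting with a conjugate of a. Since k and p are coprime, one generator u encodes both as powers.
  One relation makes h commute with enough of the x_i, and a power relation (t X)^(l+2) = t^l, where t is
  a long cycle built from h and a, makes the conjugates of a 3-cycle X under t a full Carmichael system.
  The parity of k decides between A_n and S_n: if k is odd, all generators lie in the group generated by
  the Carmichael system, otherwise it has index 2. The two constructions cover A_n and S_n for all n,
  given a prime between n/2 and n - 2 (Bertrand's postulate); S_5 and A_6 are treated separately.
*)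

theory Submission
  imports Defs "HOL-Number_Theory.Residue_Primitive_Roots"
begin

section \<open>Groups as a type class\<close>

text \<open>A permutation model yields a surjection from the presented group, so all that is missing
  is an upper bound for the order of an arbitrary group satisfying the relations. Carmichael's
  system is used because coset enumeration bounds its order by induction on the number of
  generators.

  The budget of seven relations shapes everything else: each relation has to do several jobs. With
  \<open>s\<close> congruent to 1 / (1 - r) modulo \<open>p\<close>, \<open>rel_a_b\<close> and
  \<open>rel_orders\<close> together fix the orders of \<open>a\<close> and \<open>b\<close> and the
  action of \<open>b\<close> on \<open>a\<close>. The relation \<open>rel_b_z\<close> forces
  \<open>z ^ 3 = 1\<close> and also puts \<open>b\<close> into the group generated by the 3-cycles.
  The power relation with exponents \<open>l + 2\<close> and \<open>l\<close> replaces the two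
  relations giving the orders of \<open>t\<close> and \<open>t * X\<close>: it makes
  \<open>t ^ l\<close> centralise \<open>X\<close>, and modulo the Carmichael subgroup it says that
  \<open>t\<close> squares to 1.

  The condition \<open>k < p\<close> serves twice: it makes \<open>k\<close> and \<open>p\<close>
  coprime, and it keeps \<open>l\<close> below twice the number of conjugates whose relations are
  known. For fixed \<open>n\<close> and \<open>p\<close> the two constructions use consecutive
  values of \<open>k\<close>, hence opposite parities, so a single prime serves both groups.\<close>

text \<open>The library's class of groups is additive; the relations below need powers with the usual laws.\<close>

class mult_group = monoid_mult + inverse +
  assumes left_inverse_mult [simp]: "inverse a * a = 1"
begin

lemma left_cancel_mult [simp]: "inverse a * (a * b) = b"
  by (simp flip: mult.assoc)

lemma inverse_eq_if_mult_eq_1: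
  assumes "a * b = 1" shows "b = inverse a"
  using assms left_cancel_mult [of a b] by simp

lemma right_inverse_mult [simp]: "a * inverse a = 1"
  using inverse_eq_if_mult_eq_1 [of "inverse a" a] by (metis left_inverse_mult left_cancel_mult mult_1_right)

lemma inverse_inverse_mult [simp]: "inverse (inverse a) = a"
  by (metis inverse_eq_if_mult_eq_1 left_inverse_mult)

lemma right_cancel_mult [simp]: "a * (inverse a * b) = b"
  by (simp flip: mult.assoc)

lemma inverse_mult_rev [simp]: "inverse (a * b) = inverse b * inverse a"
  by (rule inverse_eq_if_mult_eq_1 [symmetric]) (simp add: mult.assoc)

lemma inverse_one_mult [simp]: "inverse 1 = 1"
  by (metis inverse_eq_if_mult_eq_1 mult_1_left)

lemma mult_left_cancel_iff [simp]: "a * b = a * c \<longleftrightarrow> b = c"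
  by (metis left_cancel_mult)

lemma mult_right_cancel_iff [simp]: "b * a = c * a \<longleftrightarrow> b = c"
  by (metis mult.assoc right_inverse_mult mult_1_right)

lemma inverse_power_mult: "inverse (a ^ k) = inverse a ^ k"
  by (induction k) (simp_all add: power_commutes)

lemma power_eq_if_exponents_cong:
  assumes "a ^ m = 1" "[i = j] (mod m)"
  shows "a ^ i = a ^ j"
proof -
  have "a ^ i = a ^ (i mod m)" for i
    by (metis assms(1) div_mult_mod_eq mult.commute mult_1_left power_add power_mult power_one)
  then show ?thesis using assms(2) by (metis unique_euclidean_semiring_class.cong_def)
qed

lemma mult_eq_iff_eq_mult_inverse: "a * b = c \<longleftrightarrow> a = c * inverse b"
  by (metis mult.assoc left_inverse_mult right_inverse_mult mult_1_right)

definition conj_by :: "'a \<Rightarrow> 'a \<Rightarrow> 'a" where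
  "conj_by x g = inverse g * x * g"

lemma conj_by_mult: "conj_by (x * y) g = conj_by x g * conj_by y g"
  by (simp add: conj_by_def mult.assoc)

lemma conj_by_one [simp]: "conj_by 1 g = 1" "conj_by x 1 = x"
  by (simp_all add: conj_by_def)

lemma conj_by_inverse: "conj_by (inverse x) g = inverse (conj_by x g)"
  by (simp add: conj_by_def mult.assoc)

lemma conj_by_power: "conj_by (x ^ k) g = conj_by x g ^ k"
  by (induction k) (simp_all add: conj_by_mult)

lemma conj_by_conj_by: "conj_by (conj_by x g) h = conj_by x (g * h)"
  by (simp add: conj_by_def mult.assoc)

lemma conj_by_eq_iff [simp]: "conj_by x g = conj_by y g \<longleftrightarrow> x = y"
  by (simp add: conj_by_def)

lemma conj_by_eq_1_iff [simp]: "conj_by x g = 1 \<longleftrightarrow> x = 1"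
  by (metis conj_by_eq_iff conj_by_one(1))

lemma conj_by_eq_self_iff: "conj_by x g = x \<longleftrightarrow> x * g = g * x"
  by (metis conj_by_def mult.assoc left_cancel_mult right_cancel_mult)

lemma mult_conj_by: "g * conj_by x g = x * g"
  by (simp add: conj_by_def mult.assoc)

lemma conj_by_self_power [simp]: "conj_by (g ^ k) g = g ^ k"
  by (simp add: conj_by_eq_self_iff power_commutes)

inductive_set gen :: "'a set \<Rightarrow> 'a set" for S where
  gen_one [simp]: "1 \<in> gen S"
| gen_incl: "s \<in> S \<Longrightarrow> s \<in> gen S"
| gen_mult: "x \<in> gen S \<Longrightarrow> y \<in> gen S \<Longrightarrow> x * y \<in> gen S"
| gen_inverse: "x \<in> gen S \<Longrightarrow> inverse x \<in> gen S"

lemma gen_power: "x \<in> gen S \<Longrightarrow> x ^ k \<in> gen S"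
  by (induction k) (auto intro: gen_mult)

lemma gen_conj_by: "x \<in> gen S \<Longrightarrow> g \<in> gen S \<Longrightarrow> conj_by x g \<in> gen S"
  by (simp add: conj_by_def gen_mult gen_inverse)

lemma gen_inverse_iff [simp]: "inverse x \<in> gen S \<longleftrightarrow> x \<in> gen S"
  by (metis gen_inverse inverse_inverse_mult)

lemma gen_mult_left_iff: "x \<in> gen S \<Longrightarrow> x * y \<in> gen S \<longleftrightarrow> y \<in> gen S"
  by (metis gen_inverse gen_mult left_cancel_mult)

lemma gen_mult_right_iff: "y \<in> gen S \<Longrightarrow> x * y \<in> gen S \<longleftrightarrow> x \<in> gen S"
  by (metis gen_inverse gen_mult mult.assoc right_inverse_mult mult_1_right)

lemma gen_subset:
  assumes "S \<subseteq> gen T" shows "gen S \<subseteq> gen T"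
proof
  fix x assume "x \<in> gen S"
  then show "x \<in> gen T"
    by induction (use assms in \<open>auto intro: gen_mult\<close>)
qed

lemma gen_mono: "S \<subseteq> T \<Longrightarrow> gen S \<subseteq> gen T"
  by (rule gen_subset) (auto intro: gen_incl)

text \<open>Right multiplication by an element is injective, so if it maps the finite set
  \<open>K\<close> into itself it permutes \<open>K\<close>; closure under multiplication by
  inverses then comes for free.\<close>

lemma gen_subset_if_closed_right:
  assumes K: "finite K" "1 \<in> K" and closed: "\<And>k s. k \<in> K \<Longrightarrow> s \<in> S \<Longrightarrow> k * s \<in> K"
  shows "gen S \<subseteq> K"
proof -
  have "\<forall>k\<in>K. k * g \<in> K" if "g \<in> gen S" for g
    using that
  proof induction
    case (gen_mult x y)
    then show ?case by (simp flip: mult.assoc)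
  next
    case (gen_inverse x)
    have "inj_on (\<lambda>k. k * x) K" by (simp add: inj_on_def)
    then have "(\<lambda>k. k * x) ` K = K"
      using gen_inverse.IH K(1) by (intro endo_inj_surj) auto
    then have "\<exists>k'\<in>K. k = k' * x" if "k \<in> K" for k
      using that by blast
    then show ?case
      by (force simp: mult.assoc)
  qed (auto intro: closed)
  then show ?thesis using K(2) by (metis mult_1_left subsetI)
qed

lemma gen_normalised:
  assumes "\<And>s. s \<in> S \<Longrightarrow> conj_by s g \<in> gen S" and "x \<in> gen S"
  shows "conj_by x g \<in> gen S"
  using assms(2)
  by induction (use assms(1) in \<open>auto simp: conj_by_mult conj_by_inverse intro: gen_mult\<close>)

text \<open>Modulo \<open>gen S\<close>, which conjugation by \<open>g\<close> maps into itself, the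
  factor \<open>h\<close> disappears. Applied to a power relation this produces a power of
  \<open>g\<close> inside \<open>gen S\<close>.\<close>

lemma power_mult_normalised:
  assumes g: "\<And>x. x \<in> gen S \<Longrightarrow> conj_by x g \<in> gen S" and h: "h \<in> gen S"
  shows "\<exists>y\<in>gen S. (g * h) ^ k = g ^ k * y"
proof (induction k)
  case (Suc k)
  then obtain y where y: "y \<in> gen S" "(g * h) ^ k = g ^ k * y" by blast
  have "(g * h) ^ Suc k = g ^ Suc k * (conj_by y g * h)"
    using y(2) by (simp add: mult.assoc power_Suc2 del: power_Suc) (simp add: conj_by_def mult.assoc)
  then show ?case using g h y(1) gen_mult by blast
qed simp

end

text \<open>Carmichael's relations for the 3-cycles \<open>(\<alpha> \<beta> i)\<close>, \<open>i \<in> I\<close>. On \<open>r\<close> generators they present the alternating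
  group of degree \<open>r + 2\<close>; only the upper bound for the order is needed.\<close>

definition carmichael :: "'i set \<Rightarrow> ('i \<Rightarrow> 'a::mult_group) \<Rightarrow> bool" where
  "carmichael I x \<longleftrightarrow> (\<forall>i\<in>I. x i ^ 3 = 1) \<and> (\<forall>i\<in>I. \<forall>j\<in>I. i \<noteq> j \<longrightarrow> (x i * x j) ^ 2 = 1)"

lemma cube_eq_1_iff: "(x::'a::mult_group) ^ 3 = 1 \<longleftrightarrow> x * x = inverse x"
  by (metis (no_types) inverse_eq_if_mult_eq_1 right_inverse_mult inverse_inverse_mult power3_eq_cube)

lemma involution_iff: "((x::'a::mult_group) * y) ^ 2 = 1 \<longleftrightarrow> x * y = inverse y * inverse x"
  by (metis inverse_mult_rev inverse_eq_if_mult_eq_1 power2_eq_square right_inverse_mult)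

text \<open>With \<open>y\<close> the last generator and \<open>H\<close> generated by the others, \<open>1\<close>, \<open>y\<close>, \<open>y\<^sup>-\<^sup>1\<close> and the \<open>y\<^sup>-\<^sup>1 x\<^sub>i\<close> represent all
  right cosets of \<open>H\<close>.\<close>

lemma carmichael_gen_card:
  fixes x :: "nat \<Rightarrow> 'a::mult_group"
  assumes "carmichael {..<r} x"
  shows "finite (gen (x ` {..<r})) \<and> 2 * card (gen (x ` {..<r})) \<le> fact (r + 2)"
  using assms
proof (induction r)
  case 0
  have "gen {} \<subseteq> {1 :: 'a}" by (rule gen_subset_if_closed_right) auto
  then have "gen {} = {1 :: 'a}" by auto
  then show ?case by simp
next
  case (Suc r)
  define H where "H = gen (x ` {..<r})"
  define y where "y = x r"
  define coset where "coset g = (\<lambda>h. h * g) ` H" for g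
  define reps where "reps = insert 1 (insert y (insert (inverse y) ((\<lambda>i. inverse y * x i) ` {..<r})))"
  define K where "K = (\<Union>g\<in>reps. coset g)"
  have IH: "finite H" "2 * card H \<le> fact (r + 2)"
    using Suc by (auto simp: H_def carmichael_def)
  have cube: "x i * x i = inverse (x i)" if "i < Suc r" for i
    using Suc.prems that by (auto simp: carmichael_def cube_eq_1_iff)
  have sq': "inverse (x i) * inverse (x i) = x i" if "i < Suc r" for i
    using cube[OF that] by (metis inverse_mult_rev inverse_inverse_mult)
  have sq: "inverse (x i) * (inverse (x i) * w) = x i * w" if "i < Suc r" for i w
    using sq'[OF that] by (simp flip: mult.assoc)
  have inv: "x i * x j = inverse (x j) * inverse (x i)" if "i < Suc r" "j < Suc r" "i \<noteq> j" for i j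
    using Suc.prems that by (auto simp: carmichael_def involution_iff)
  have ycube: "y * y = inverse y" using cube[of r] by (simp add: y_def)
  have inv1: "x i * y = inverse y * inverse (x i)"
      and inv2: "y * x i = inverse (x i) * inverse y" if "i < r" for i
    using that inv[of i r] inv[of r i] by (auto simp: y_def)
  have xinv: "y * inverse (x i) = inverse (x i) * inverse y * x i" if "i < r" for i
  proof -
    have "y * inverse (x i) = y * x i * x i" using cube[of i] that by (simp add: mult.assoc)
    then show ?thesis using inv2[OF that] by simp
  qed
  have HH: "h * h' \<in> H" if "h \<in> H" "h' \<in> H" for h h' using that by (simp add: H_def gen_mult)
  have xH: "x i \<in> H" "inverse (x i) \<in> H" if "i < r" for i
    using that by (auto simp: H_def intro: gen_incl)
  have one: "1 \<in> H" by (simp add: H_def)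
  have cosetI: "g * s \<in> coset g'" if "g * s = h * g'" "h \<in> H" for g s h g'
    using that by (auto simp: coset_def)
  have stepI: "\<exists>g'\<in>reps. g * s \<in> coset g'" if "g * s = h * g'" "h \<in> H" "g' \<in> reps" for g s h g'
    using cosetI[OF that(1,2)] that(3) by blast
  have reps: "1 \<in> reps" "y \<in> reps" "inverse y \<in> reps" "i < r \<Longrightarrow> inverse y * x i \<in> reps" for i
    by (auto simp: reps_def)
  \<comment> \<open>The table has \<open>r + 3\<close> rows, mirroring the action of the alternating
    group of degree \<open>r + 3\<close> on points, with \<open>H\<close> as a point
    stabiliser.\<close>
  have step: "\<exists>g'\<in>reps. g * x j \<in> coset g'" if g: "g \<in> reps" and j: "j < Suc r" for g j
  proof (cases "j = r")
    case True
    then have j: "x j = y" by (simp add: y_def)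
    consider "g = 1" | "g = y" | "g = inverse y" | i where "i < r" "g = inverse y * x i"
      using g unfolding reps_def by blast
    then show ?thesis
    proof cases
      case 1
      then show ?thesis by (intro stepI[OF _ one reps(2)]) (simp add: j)
    next
      case 2
      then show ?thesis by (intro stepI[OF _ one reps(3)]) (simp add: j ycube)
    next
      case 3
      then show ?thesis by (intro stepI[OF _ one reps(1)]) (simp add: j)
    next
      case (4 i)
      have "inverse y * x i * y = y * inverse (x i)"
        using inv1[OF 4(1)] sq[of r, folded y_def] by (simp add: mult.assoc)
      also have "\<dots> = inverse (x i) * (inverse y * x i)"
        using xinv[OF 4(1)] by (simp add: mult.assoc)
      finally show ?thesis unfolding 4(2) j by (rule stepI[OF _ xH(2)[OF 4(1)] reps(4)[OF 4(1)]])
    qed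
  next
    case False
    with j have jr: "j < r" by simp
    consider "g = 1" | "g = y" | "g = inverse y" | i where "i < r" "i \<noteq> j" "g = inverse y * x i"
      | "g = inverse y * x j"
      using g unfolding reps_def by blast
    then show ?thesis
    proof cases
      case 1
      then show ?thesis by (intro stepI[OF _ xH(1)[OF jr] reps(1)]) simp
    next
      case 2
      then show ?thesis by (intro stepI[OF _ xH(2)[OF jr] reps(3)]) (simp add: inv2 jr)
    next
      case 3
      then show ?thesis by (intro stepI[OF _ one reps(4)[OF jr]]) simp
    next
      case (4 i)
      have "inverse y * x i * x j = (x j * y) * inverse (x i)"
        using inv[of i j] inv1[OF jr] 4 jr by (simp add: mult.assoc)
      also have "\<dots> = x j * inverse (x i) * (inverse y * x i)"
        using xinv[OF 4(1)] by (simp add: mult.assoc)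
      finally show ?thesis unfolding 4(3) by (rule stepI[OF _ HH[OF xH(1)[OF jr] xH(2)[OF 4(1)]] reps(4)[OF 4(1)]])
    next
      case 5
      have "inverse y * x j * x j = x j * y"
        using inv1[OF jr] cube[of j] jr by (simp add: mult.assoc)
      then show ?thesis unfolding 5 by (rule stepI[OF _ xH(1)[OF jr] reps(2)])
    qed
  qed
  have genK: "gen (x ` {..<Suc r}) \<subseteq> K"
  proof (rule gen_subset_if_closed_right)
    show "finite K" using IH(1) by (auto simp: K_def reps_def coset_def)
    show "1 \<in> K" using cosetI[OF _ one, of 1 1 1] reps(1) by (auto simp: K_def)
    fix k s assume "k \<in> K" and s: "s \<in> x ` {..<Suc r}"
    then obtain g h where gh: "g \<in> reps" "h \<in> H" "k = h * g" by (auto simp: K_def coset_def)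
    from s obtain j where j: "j < Suc r" "s = x j" by auto
    obtain g' h' where "g' \<in> reps" "h' \<in> H" "g * x j = h' * g'"
      using step[OF gh(1) j(1)] by (auto simp: coset_def)
    then show "k * s \<in> K"
      using cosetI[of k s "h * h'" g'] gh j HH unfolding K_def by (simp add: mult.assoc) blast
  qed
  have finK: "finite K" using IH(1) by (auto simp: K_def reps_def coset_def)
  have cardK: "card K \<le> (r + 3) * card H"
  proof -
    have "card ((\<lambda>i. inverse y * x i) ` {..<r}) \<le> r"
      using card_image_le[of "{..<r}" "\<lambda>i. inverse y * x i"] by simp
    moreover have "card (insert g A) \<le> Suc (card A)" for g :: 'a and A
      by (cases "finite A") (auto simp: card_insert_if)
    ultimately have "card reps \<le> r + 3"
      unfolding reps_def by (simp add: numeral_3_eq_3) (meson Suc_le_mono le_trans)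
    moreover have "card K \<le> (\<Sum>g\<in>reps. card (coset g))"
      unfolding K_def by (rule card_UN_le) (simp add: reps_def)
    moreover have "(\<Sum>g\<in>reps. card (coset g)) \<le> card reps * card H"
      unfolding coset_def by (rule sum_bounded_above[where K = "card H", simplified]) (simp add: card_image_le IH(1))
    ultimately show ?thesis
      by (meson le_trans mult_le_mono1)
  qed
  have fin: "finite (gen (x ` {..<Suc r}))"
    using genK finK by (rule finite_subset)
  have "card (gen (x ` {..<Suc r})) \<le> (r + 3) * card H"
    using card_mono[OF finK genK] cardK by linarith
  then have "2 * card (gen (x ` {..<Suc r})) \<le> (r + 3) * (2 * card H)" by simp
  also have "\<dots> \<le> (r + 3) * fact (r + 2)"
    using IH(2) by (rule mult_le_mono2)
  also have "\<dots> = fact (Suc r + 2)"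
    by (simp add: numeral_3_eq_3)
  finally show ?case using fin by blast
qed

section \<open>A presentation of the alternating group of degree \<open>p + 2\<close>\<close>

lemma involution_swap: "((x::'a::mult_group) * y) ^ 2 = 1 \<longleftrightarrow> (y * x) ^ 2 = 1"
proof -
  have "y * x = conj_by (x * y) x" by (simp add: conj_by_def mult.assoc)
  then show ?thesis by (simp flip: conj_by_power)
qed

lemma conj_by_mult_commute: "conj_by x (g * h) = conj_by (conj_by x h) (conj_by g h)"
  for x :: "'a::mult_group"
  by (simp add: conj_by_def mult.assoc)

lemma exists_mult_cong_1_nat:
  fixes k p :: nat
  assumes "coprime k p"
  shows "\<exists>m. [k * m = 1] (mod p)"
  using cong_solve_coprime_nat[OF assms] by auto

text \<open>For \<open>s = 0\<close> the congruence would read 1 = 0. Positivity is what makes the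
  truncated difference \<open>s - 1\<close> the true one.\<close>

lemma cong_diff_1:
  fixes p r s :: nat
  assumes "[r * s + 1 = s] (mod p)" "2 \<le> p"
  shows "s > 0" "[r * s = s - 1] (mod p)"
proof -
  show "s > 0"
  proof (rule ccontr)
    assume "\<not> s > 0"
    then have "p dvd 1" using assms(1) by (simp add: cong_0_iff)
    then show False using assms(2) by simp
  qed
  then show "[r * s = s - 1] (mod p)"
    using assms(1) by (metis Suc_eq_plus1 Suc_pred' cong_add_rcancel_nat)
qed

lemma residue_primroot_power_cong:
  assumes p: "prime p" and r: "residue_primroot p r" and d: "\<not> p dvd d"
  obtains j where "j < p - 1" "[d = r ^ j] (mod p)"
proof -
  have "d mod p \<in> totatives p"
    using d prime_imp_coprime[OF p d] prime_gt_0_nat[OF p]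
    by (auto simp: totatives_def mod_greater_zero_iff_not_dvd less_imp_le coprime_commute)
  then obtain j where "j < totient p" "d mod p = r ^ j mod p"
    using residue_primroot_is_generator[of p r] r prime_gt_1_nat[OF p] by (auto simp: bij_betw_def)
  then show thesis using that[of j] p by (simp add: cong_def totient_prime)
qed

lemma odd_prime_ge_3: "prime p \<Longrightarrow> odd p \<Longrightarrow> 3 \<le> p" for p :: nat
  using prime_ge_2_nat[of p] by (cases "p = 2") auto

text \<open>The intended model: \<open>a\<close> is the \<open>p\<close>-cycle \<open>i \<mapsto> i + 1\<close>, \<open>z\<close> the 3-cycle \<open>(\<alpha> \<beta> p)\<close>, and \<open>b\<close> multiplies by \<open>r\<close> modulo
  \<open>p\<close> and exchanges \<open>\<alpha>\<close> and \<open>\<beta>\<close>. As \<open>s - 1 = r s\<close> modulo \<open>p\<close>, the relation \<open>rel_a_b\<close> gives \<open>a\<^sup>b = a\<^sup>r\<close> and, together with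
  \<open>rel_orders\<close>, also \<open>a ^ p = 1\<close>.\<close>

locale base_relations =
  fixes a b z :: "'a::mult_group" and p r s :: nat
  assumes p: "prime p" "odd p" and r: "residue_primroot p r" and s: "[r * s + 1 = s] (mod p)"
    and rel_a_b: "conj_by (a ^ s) b = a ^ (s - 1)"
    and rel_orders: "a ^ p = b ^ (p - 1)"
    and rel_z_b: "conj_by z b = z ^ 2"
    and rel_z_a: "(z * conj_by z a) ^ 2 = 1"
    and rel_b_z: "(b * conj_by z a) ^ p = z ^ 3"
begin

lemma p_ge_3: "p \<ge> 3"
  using odd_prime_ge_3[OF p] .

lemma s_pos: "s > 0" and r_s: "[r * s = s - 1] (mod p)"
  using cong_diff_1[OF s] p_ge_3 by simp_all

lemma s_coprime: "coprime s p"
proof (rule ccontr)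
  assume "\<not> coprime s p"
  then have "p dvd s" using p(1) by (metis coprime_commute prime_imp_coprime)
  then have "p dvd r * s + 1" using s by (metis cong_dvd_iff)
  then have "p dvd 1" using \<open>p dvd s\<close> by (metis dvd_add_right_iff dvd_mult)
  then show False using p_ge_3 by simp
qed

text \<open>\<open>b\<close> commutes with its own power \<open>a ^ p\<close>, hence with
  \<open>a ^ (p * s)\<close>, which \<open>rel_a_b\<close> turns into
  \<open>a ^ (p * (s - 1))\<close>; the quotient of the two is \<open>a ^ p\<close>.\<close>

lemma a_order: "a ^ p = 1"
proof -
  have "a ^ (p * s) = conj_by (a ^ (p * s)) b"
    by (simp add: power_mult conj_by_power rel_orders)
  also have "\<dots> = a ^ (p * (s - 1))"
    by (metis conj_by_power mult.commute power_mult rel_a_b)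
  finally have "a ^ (p * (s - 1)) * a ^ p = a ^ (p * (s - 1)) * 1"
    using s_pos by (cases s) (simp_all add: power_add[symmetric] add.commute)
  then show ?thesis by (simp only: mult_left_cancel_iff)
qed

lemma b_order: "b ^ (p - 1) = 1"
  using a_order rel_orders by simp

lemma a_power_cong: "[i = j] (mod p) \<Longrightarrow> a ^ i = a ^ j"
  using power_eq_if_exponents_cong[OF a_order] .

text \<open>As \<open>s\<close> is invertible modulo \<open>p\<close>, every power of
  \<open>a\<close> is a power of \<open>a ^ s\<close>, whose conjugate is given by
  \<open>rel_a_b\<close>; and \<open>s - 1\<close> is \<open>r * s\<close> modulo
  \<open>p\<close>.\<close>

lemma conj_a_b: "conj_by (a ^ k) b = a ^ (r * k)"
proof -
  obtain m where m: "[s * m = 1] (mod p)"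
    using exists_mult_cong_1_nat[OF s_coprime] by blast
  have "a ^ k = (a ^ s) ^ (m * k)"
    using a_power_cong[of k "s * (m * k)"] cong_mult[OF m, of k k] by (simp add: power_mult cong_sym_eq mult.assoc)
  then have "conj_by (a ^ k) b = a ^ ((s - 1) * (m * k))"
    using rel_a_b by (simp add: conj_by_power power_mult)
  also have "\<dots> = a ^ (r * k)"
  proof (rule a_power_cong)
    have "[(s - 1) * (m * k) = r * s * (m * k)] (mod p)"
      using r_s by (intro cong_mult cong_refl) (rule cong_sym)
    also have "r * s * (m * k) = s * m * (r * k)" by simp
    also have "[s * m * (r * k) = 1 * (r * k)] (mod p)"
      using m by (intro cong_mult cong_refl)
    finally show "[(s - 1) * (m * k) = r * k] (mod p)" by simp
  qed
  finally show ?thesis .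
qed

text \<open>\<open>v = z ^ 3 = (b * x) ^ p\<close>, where \<open>x = conj_by z a\<close>, commutes with \<open>b * x\<close>, so that conjugation by
  \<open>inverse x\<close> squares \<open>v\<close>. As \<open>z * x\<close> is an involution and \<open>z\<close> commutes with \<open>v\<close>, squaring twice is
  trivial on \<open>v\<close>; so \<open>v ^ 3 = 1\<close> and \<open>x ^ 9 = 1\<close>, and squaring nine times is trivial too.\<close>

lemma z_cube: "z ^ 3 = 1"
proof -
  define x where "x = conj_by z a"
  define v where "v = z ^ 3"
  have "conj_by v b = v ^ 2"
    by (simp add: v_def conj_by_power rel_z_b mult.commute flip: power_mult)
  moreover have "conj_by v (b * x) = v"
    unfolding v_def x_def rel_b_z[symmetric] by (rule conj_by_self_power)
  ultimately have "conj_by (v ^ 2) x = v"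
    by (simp flip: conj_by_conj_by)
  then have "conj_by v (inverse x) = conj_by (conj_by (v ^ 2) x) (inverse x)"
    by simp
  then have x: "conj_by v (inverse x) = v ^ 2"
    by (simp add: conj_by_conj_by)
  have xk: "conj_by v (inverse x ^ k) = v ^ (2 ^ k)" for k
  proof (induction k)
    case (Suc k)
    have "conj_by v (inverse x ^ Suc k) = conj_by (v ^ (2 ^ k)) (inverse x)"
      by (simp add: Suc power_Suc2 del: power_Suc flip: conj_by_conj_by)
    then show ?case by (simp add: conj_by_power x flip: power_mult)
  qed simp
  have "conj_by v (inverse z) = conj_by (conj_by v z) (inverse z)"
    by (simp add: v_def)
  then have z: "conj_by v (inverse z) = v"
    by (simp add: conj_by_conj_by)
  have zx: "inverse x * inverse z * (inverse x * inverse z) = 1"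
    using arg_cong[OF rel_z_a, of inverse] by (simp add: x_def power2_eq_square)
  have xz: "conj_by v (inverse x * inverse z) = v ^ 2"
    by (simp add: x z conj_by_power flip: conj_by_conj_by)
  have "v = conj_by v (inverse x * inverse z * (inverse x * inverse z))"
    by (simp only: zx conj_by_one)
  also have "\<dots> = (v ^ 2) ^ 2"
    by (simp only: xz conj_by_power flip: conj_by_conj_by[of v "inverse x * inverse z"])
  finally have "v * 1 = v * v ^ 3"
    by (simp add: numeral_eq_Suc mult.assoc)
  then have v3: "v ^ 3 = 1"
    by (simp only: mult_left_cancel_iff)
  then have "z ^ 9 = 1" by (simp add: v_def flip: power_mult)
  then have "x ^ 9 = 1" by (simp add: x_def flip: conj_by_power)
  then have "v = v ^ (2 ^ 9)" using xk[of 9] by (simp flip: inverse_power_mult)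
  also have "\<dots> = v ^ 2" by (rule power_eq_if_exponents_cong[OF v3]) (simp add: cong_def)
  finally have "v * 1 = v * v" by (simp add: power2_eq_square)
  then show ?thesis by (simp only: mult_left_cancel_iff v_def)
qed

definition "x i = conj_by z (a ^ i)"

lemma x_0: "x 0 = z" and x_1: "x 1 = conj_by z a"
  by (simp_all add: x_def)

lemma x_cong: "[i = j] (mod p) \<Longrightarrow> x i = x j"
  unfolding x_def using a_power_cong by metis

lemma x_p: "x p = z"
  using x_cong[of p 0] by (simp add: x_0 cong_def)

lemma x_conj_a: "conj_by (x i) (a ^ j) = x (i + j)"
  by (simp add: x_def conj_by_conj_by power_add)

lemma x_cube: "x i ^ 3 = 1"
  by (simp add: x_def z_cube flip: conj_by_power)

lemma x_square: "x i ^ 2 = inverse (x i)"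
  using x_cube[of i] by (simp add: cube_eq_1_iff power2_eq_square)

lemma x_conj_b: "conj_by (x i) b = inverse (x (r * i))"
proof -
  have "conj_by (x i) b = conj_by (conj_by z b) (a ^ (r * i))"
    unfolding x_def conj_by_conj_by by (metis conj_by_conj_by conj_by_mult_commute conj_a_b)
  then show ?thesis
    by (simp add: rel_z_b conj_by_power x_square flip: x_def)
qed

lemma x_involution:
  assumes "\<not> [i = j] (mod p)"
  shows "(x i * x j) ^ 2 = 1"
proof -
  have step: "(x 0 * x (r * d)) ^ 2 = 1" if "(x 0 * x d) ^ 2 = 1" for d
  proof -
    have "conj_by ((x 0 * x d) ^ 2) b = 1" by (simp add: that)
    \<comment> \<open>Conjugation by \<open>b\<close> also inverts; taking inverses restores the
      \<open>x i\<close>, but in the opposite order.\<close>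
    then have "(inverse (x 0) * inverse (x (r * d))) ^ 2 = 1"
      by (simp add: conj_by_mult conj_by_power x_conj_b)
    then have "inverse ((x (r * d) * x 0) ^ 2) = 1"
      by (simp only: inverse_power_mult inverse_mult_rev)
    then have "inverse (inverse ((x (r * d) * x 0) ^ 2)) = inverse 1" by (simp only:)
    then have "(x (r * d) * x 0) ^ 2 = 1" by (simp only: inverse_inverse_mult inverse_one_mult)
    then show ?thesis by (simp only: involution_swap)
  qed
  have pow: "(x 0 * x (r ^ k)) ^ 2 = 1" for k
    by (induction k) (use step rel_z_a in \<open>auto simp: x_0 x_1[unfolded One_nat_def]\<close>)
  have unit: "(x 0 * x d) ^ 2 = 1" if d: "\<not> p dvd d" for d
  proof -
    obtain k where "[d = r ^ k] (mod p)" using residue_primroot_power_cong[OF p(1) r d] by blast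
    then show ?thesis using pow x_cong by metis
  qed
  have lt: "(x i * x j) ^ 2 = 1" if "i < j" "\<not> [i = j] (mod p)" for i j
  proof -
    have "\<not> p dvd j - i" using that by (metis cong_altdef_nat cong_sym less_imp_le_nat)
    then have "conj_by ((x 0 * x (j - i)) ^ 2) (a ^ i) = 1"
      using unit by simp
    then show ?thesis using that by (simp add: conj_by_power conj_by_mult x_conj_a)
  qed
  show ?thesis
  proof (cases i j rule: linorder_cases)
    case greater
    then show ?thesis using lt[of j i] assms by (metis cong_sym involution_swap)
  qed (use assms lt in auto)
qed

text \<open>Modulo the group generated by the \<open>x i\<close>, the relation
  \<open>rel_b_z\<close> reads \<open>b ^ p = 1\<close>, and \<open>b ^ (p - 1) = 1\<close> leaves
  \<open>b\<close> itself. Then the commutator of \<open>a\<close> and \<open>b\<close> lies in the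
  group too; it is \<open>a ^ (r - 1)\<close>, and \<open>r - 1\<close> is invertible modulo
  \<open>p\<close>.\<close>

lemma x_gen_b: "b \<in> gen (range x)" and x_gen_a: "a \<in> gen (range x)"
proof -
  have xa: "conj_by y (a ^ j) \<in> gen (range x)" if "y \<in> gen (range x)" for y j
    using that by (rule gen_normalised[rotated]) (auto simp: x_conj_a intro: gen_incl)
  have xb: "conj_by y b \<in> gen (range x)" if "y \<in> gen (range x)" for y
    using that by (rule gen_normalised[rotated]) (auto simp: x_conj_b intro: gen_incl[OF rangeI])
  have x1: "conj_by z a \<in> gen (range x)" and z: "z \<in> gen (range x)"
    by (metis gen_incl rangeI x_1 x_0)+
  obtain y where y: "y \<in> gen (range x)" "(b * conj_by z a) ^ p = b ^ p * y"
    using power_mult_normalised[OF xb x1] by blast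
  have "b ^ p = b" using b_order prime_gt_0_nat[OF p(1)] power_Suc2[of b "p - 1"] by simp
  then have "b * y = 1" using y(2) rel_b_z z_cube by simp
  then have "b = inverse y" by (simp add: mult_eq_iff_eq_mult_inverse)
  then show b: "b \<in> gen (range x)" using y(1) by simp
  have "inverse a * conj_by a b \<in> gen (range x)"
  proof -
    have "inverse a * conj_by a b = conj_by (inverse b) a * b" by (simp add: conj_by_def mult.assoc)
    then show ?thesis using b xa[of "inverse b" 1] by (simp add: gen_mult)
  qed
  moreover have "conj_by a b = a * a ^ (r - 1)"
    using conj_a_b[of 1] r p_ge_3 by (cases r) auto
  ultimately have ar: "a ^ (r - 1) \<in> gen (range x)" by simp
  \<comment> \<open>If \<open>r\<close> were 1 modulo \<open>p\<close>, the congruence defining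
    \<open>s\<close> would say \<open>s + 1 = s\<close>.\<close>
  have "coprime (r - 1) p"
  proof (rule ccontr)
    assume "\<not> coprime (r - 1) p"
    then have "p dvd r - 1" using p(1) by (metis coprime_commute prime_imp_coprime)
    moreover have "r > 0" using r p_ge_3 by (cases r) auto
    ultimately have "[r = 1] (mod p)"
      by (metis Suc_leI cong_sym cong_altdef_nat One_nat_def)
    then have "[r * s + 1 = s + 1] (mod p)"
      by (metis cong_add_rcancel_nat cong_scalar_right mult_1)
    then have "[s + 1 = s + 0] (mod p)" using s by (metis add_0_right cong_sym cong_trans)
    then have "[1 = 0] (mod p)" by (simp only: cong_add_lcancel_nat)
    then show False using p_ge_3 by (simp add: cong_0_iff)
  qed
  then obtain m where "[(r - 1) * m = 1] (mod p)"
    using exists_mult_cong_1_nat by blast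
  then have "(a ^ (r - 1)) ^ m = a" using a_power_cong by (metis power_mult power_one_right)
  then show "a \<in> gen (range x)" using gen_power[OF ar] by metis
qed

end

section \<open>Identities between 3-cycles through two common points\<close>

definition carmichael_pair :: "'a::mult_group \<Rightarrow> 'a \<Rightarrow> bool" where
  "carmichael_pair x y \<longleftrightarrow> x ^ 3 = 1 \<and> y ^ 3 = 1 \<and> (x * y) ^ 2 = 1"

lemma carmichael_pair_sym: "carmichael_pair x y \<Longrightarrow> carmichael_pair y x"
  by (simp add: carmichael_pair_def involution_swap)

text \<open>The relations of a pair are those of the (2,3,3) triangle group, which is the
  alternating group of degree 4. They are turned into rewrite rules; the versions with
  \<open>u\<close> act inside right-nested products.\<close>

lemma carmichael_pairD:
  assumes "carmichael_pair x y"
  shows "x * x = inverse x" "inverse x * inverse x = x" "x * y = inverse y * inverse x"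
    "x * (x * u) = inverse x * u" "inverse x * (inverse x * u) = x * u"
    "x * (y * u) = inverse y * (inverse x * u)"
proof -
  show sq: "x * x = inverse x"
    using assms by (simp add: carmichael_pair_def cube_eq_1_iff)
  show sq': "inverse x * inverse x = x"
    using sq[THEN arg_cong[of _ _ inverse]] by simp
  show xy: "x * y = inverse y * inverse x"
    using assms by (simp add: carmichael_pair_def involution_iff)
  show "x * (x * u) = inverse x * u" "inverse x * (inverse x * u) = x * u"
    "x * (y * u) = inverse y * (inverse x * u)"
    using sq sq' xy by (simp_all flip: mult.assoc)
qed

lemma carmichael_pair_sandwich:
  assumes "carmichael_pair x y"
  shows "x * y * x = inverse y" "inverse x * inverse y * inverse x = y"
proof -
  show *: "x * y * x = inverse y" using carmichael_pairD(3)[OF assms] by (simp add: mult.assoc)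
  show "inverse x * inverse y * inverse x = y"
    using *[THEN arg_cong[of _ _ inverse]] by (simp add: mult.assoc)
qed

lemma carmichael_pair_conj:
  assumes "carmichael_pair x y"
  shows "inverse x * y * x = x * inverse y"
  using carmichael_pairD[OF carmichael_pair_sym[OF assms]] carmichael_pairD[OF assms]
  by (simp add: mult.assoc)

lemma carmichael_pair_braid:
  assumes "carmichael_pair x y"
  shows "x * inverse y * x = inverse y * x * inverse y"
proof -
  have "x * inverse y * x = (x * y) * (y * x)"
    using carmichael_pairD(1)[OF carmichael_pair_sym[OF assms]] by (simp add: mult.assoc flip: mult.assoc[of y y])
  also have "\<dots> = inverse y * (inverse x * inverse x) * inverse y"
    using carmichael_pairD(3)[OF assms] carmichael_pairD(3)[OF carmichael_pair_sym[OF assms]] by (simp add: mult.assoc)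
  finally show ?thesis using carmichael_pairD(2)[OF assms] by simp
qed

text \<open>For \<open>x\<close> = (\<alpha> \<beta> i) and \<open>y\<close> = (\<alpha> \<beta> j)
  the quotient is the 3-cycle (\<beta> i j).\<close>

lemma carmichael_pair_quotient_cube:
  assumes "carmichael_pair x y"
  shows "(x * inverse y) ^ 3 = 1"
proof -
  have "(x * inverse y) ^ 3 = (x * inverse y * x) * inverse y * x * inverse y"
    by (simp add: power3_eq_cube mult.assoc)
  also have "\<dots> = inverse y * (x * (inverse y * inverse y) * x) * inverse y"
    unfolding carmichael_pair_braid[OF assms] by (simp add: mult.assoc)
  also have "\<dots> = 1"
    using carmichael_pair_sandwich(1)[OF assms] carmichael_pairD(2)[OF carmichael_pair_sym[OF assms]]
      carmichael_pairD(5)[OF carmichael_pair_sym[OF assms], of "inverse y"] by simp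
  finally show ?thesis .
qed

text \<open>The quotients are the 3-cycles (\<beta> i j) and (\<beta> i m), again with two points in
  common. This is how the distinguished pair \<alpha>, \<beta> gets exchanged for another
  one.\<close>

lemma carmichael_pair_quotients:
  assumes "carmichael_pair x y" "carmichael_pair x w" "carmichael_pair y w"
  shows "(x * inverse y * (x * inverse w)) ^ 2 = 1"
proof -
  have "x * inverse y * (x * inverse w) * (x * inverse y) = x * inverse y * (x * inverse w * x) * inverse y"
    by (simp add: mult.assoc)
  also have "\<dots> = x * (inverse y * inverse w) * x * (inverse w * inverse y)"
    unfolding carmichael_pair_braid[OF assms(2)] by (simp add: mult.assoc)
  also have "\<dots> = x * w * (y * x * y) * w"
    using carmichael_pairD(3)[OF assms(3)] carmichael_pairD(6)[OF carmichael_pair_sym[OF assms(3)]] by (simp add: mult.assoc)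
  also have "\<dots> = x * (w * inverse x * w)"
    unfolding carmichael_pair_sandwich(1)[OF carmichael_pair_sym[OF assms(1)]] by (simp add: mult.assoc)
  also have "\<dots> = w * inverse x"
    unfolding carmichael_pair_braid[OF carmichael_pair_sym[OF assms(2)]] by (simp add: mult.assoc)
  finally have "x * inverse y * (x * inverse w) * (x * inverse y) = w * inverse x" .
  then show ?thesis
    unfolding involution_iff by (simp add: mult_eq_iff_eq_mult_inverse)
qed

text \<open>\<open>x * y\<close> and \<open>x * w\<close> are involutions, so the left side,
  \<open>x * y * inverse (x * w)\<close>, is also \<open>inverse (x * y) * (x * w)\<close>, where
  \<open>x\<close> cancels.\<close>

lemma carmichael_triple_conj:
  assumes "carmichael_pair x y" "carmichael_pair x w"
  shows "x * (y * inverse w) * inverse x = inverse y * w"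
proof -
  have "x * (y * inverse w) * inverse x = x * y * inverse (x * w)" by (simp add: mult.assoc)
  also have "inverse (x * w) = x * w"
    using carmichael_pairD(3)[OF assms(2)] by simp
  finally show ?thesis
    unfolding carmichael_pairD(3)[OF assms(1)] by (simp add: mult.assoc)
qed

lemma carmichael_triple_conj':
  assumes "carmichael_pair x y" "carmichael_pair x w"
  shows "inverse x * (inverse y * w) * x = y * inverse w"
  unfolding carmichael_triple_conj[OF assms, symmetric] by (simp add: mult.assoc)

text \<open>Conjugating twice by an element of order 3 is conjugating once by its inverse.\<close>

lemma carmichael_triple_cycle:
  assumes "carmichael_pair x y" "carmichael_pair x w"
  shows "inverse x * y * inverse w * x = x * inverse y * w * inverse x"
proof -
  have x: "x * x = inverse x" using carmichael_pairD(1)[OF assms(1)] .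
  have "x * inverse y * w * inverse x = x * (x * (y * inverse w) * inverse x) * inverse x"
    unfolding carmichael_triple_conj[OF assms] by (simp add: mult.assoc)
  also have "\<dots> = (x * x) * (y * inverse w) * inverse (x * x)"
    by (simp add: mult.assoc)
  also have "\<dots> = inverse x * y * inverse w * x" unfolding x by (simp add: mult.assoc)
  finally show ?thesis ..
qed

lemma carmichael_conj_cycle:
  assumes "carmichael_pair x y" "carmichael_pair z x" "carmichael_pair y z"
  shows "inverse z * x * y * inverse x * z = y * inverse x"
proof -
  have "inverse z * (x * y) * inverse x * z = inverse z * inverse y * (inverse x * inverse x) * z"
    unfolding carmichael_pairD(3)[OF assms(1)] by (simp add: mult.assoc)
  also have "\<dots> = y * (z * x * z)"
    using carmichael_pairD(6)[OF assms(3)] carmichael_pairD(2)[OF assms(1)] by (simp add: mult.assoc)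
  finally show ?thesis
    unfolding carmichael_pair_sandwich(1)[OF assms(2)] by (simp add: mult.assoc)
qed

text \<open>Here and in the next two lemmas \<open>y\<close>, \<open>w\<close>, \<open>q\<close>
  will be \<open>x 2\<close>, \<open>x 3\<close>, \<open>x 4\<close>, so that
  \<open>inverse q * w\<close> is the 3-cycle (\<alpha> 4 3), a factor of the long cycle
  \<open>t\<close> of the second construction. The three statements say that it takes (\<beta> 2 3)
  to (\<beta> 2 \<alpha>), (2 3 4) to (2 \<alpha> 3), and (2 3 i) to (2 \<alpha> i), where
  \<open>v\<close> is \<open>x i\<close>.\<close>

lemma carmichael_conj_shift_1:
  assumes "carmichael_pair y w" "carmichael_pair q y" "carmichael_pair q w"
  shows "conj_by (y * inverse w) (inverse q * w) = y"
proof -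
  have "conj_by (y * inverse w) (inverse q * w) = inverse w * (q * (y * inverse w) * inverse q) * w"
    by (simp add: conj_by_def mult.assoc)
  also have "\<dots> = inverse w * inverse y * (w * w)"
    unfolding carmichael_triple_conj[OF assms(2,3)] by (simp add: mult.assoc)
  finally show ?thesis
    using carmichael_pair_sandwich(2)[OF carmichael_pair_sym[OF assms(1)]]
      carmichael_pairD(1)[OF carmichael_pair_sym[OF assms(1)]] by simp
qed

lemma carmichael_conj_shift_2:
  assumes "carmichael_pair y w" "carmichael_pair q y" "carmichael_pair q w"
  shows "conj_by (inverse y * w * inverse q * y) (inverse q * w) = inverse w * y"
proof -
  have "conj_by (inverse y * w * inverse q * y) (inverse q * w)
      = inverse w * (q * y * inverse w * q * inverse (q * y)) * w"
    unfolding carmichael_triple_cycle[OF assms(1) carmichael_pair_sym[OF assms(2)]]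
    by (simp add: conj_by_def mult.assoc)
  also have "\<dots> = inverse w * inverse y * (inverse q * inverse w * (q * q)) * y * w"
    unfolding carmichael_pairD(3)[OF assms(2)] by (simp add: mult.assoc)
  also have "\<dots> = inverse w * inverse y * (w * y * w)"
    using carmichael_pair_sandwich(2)[OF assms(3)] carmichael_pairD(1)[OF assms(2)] by (simp add: mult.assoc)
  also have "\<dots> = inverse w * (inverse y * inverse y)"
    unfolding carmichael_pair_sandwich(1)[OF carmichael_pair_sym[OF assms(1)]] by (simp add: mult.assoc)
  finally show ?thesis using carmichael_pairD(2)[OF assms(1)] by simp
qed

lemma carmichael_conj_shift_3:
  assumes "carmichael_pair y w" "carmichael_pair q y" "carmichael_pair q w"
    and "carmichael_pair y v" "carmichael_pair w v" "carmichael_pair q v"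
  shows "conj_by (inverse y * w * inverse v * y) (inverse q * w) = inverse v * y"
proof -
  have "q * inverse y = q * y * y" "y * inverse q = inverse y * inverse (q * y)"
    using carmichael_pairD(1,2,5)[OF assms(1)] by (simp_all add: mult.assoc)
  then have qy: "q * inverse y = inverse y * inverse q * y" "y * inverse q = inverse y * q * y"
    unfolding carmichael_pairD(3)[OF assms(2)] by (simp_all add: mult.assoc)
  have "q * (inverse y * w * inverse v * y) * inverse q = (q * inverse y) * w * inverse v * (y * inverse q)"
    by (simp add: mult.assoc)
  also have "\<dots> = inverse y * (inverse q * (y * (w * inverse v) * inverse y) * q) * y"
    unfolding qy by (simp add: mult.assoc)
  also have "\<dots> = inverse y * w * inverse v * y"
    unfolding carmichael_triple_conj[OF assms(1,4)] carmichael_triple_conj'[OF assms(3,6)] by (simp add: mult.assoc)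
  finally have *: "q * (inverse y * w * inverse v * y) * inverse q = inverse y * w * inverse v * y" .
  have "conj_by (inverse y * w * inverse v * y) (inverse q * w)
      = inverse w * (q * (inverse y * w * inverse v * y) * inverse q) * w"
    by (simp add: conj_by_def mult.assoc)
  also have "\<dots> = inverse w * inverse y * w * inverse v * y * w"
    unfolding * by (simp add: mult.assoc)
  also have "\<dots> = y * (w * w) * inverse v * y * w"
    using carmichael_pairD(6)[OF assms(1)] by (simp add: mult.assoc)
  also have "\<dots> = y * (v * w) * y * w"
    using carmichael_pairD(3)[OF carmichael_pair_sym[OF assms(5)]] carmichael_pairD(1)[OF assms(5)] by (simp add: mult.assoc)
  also have "\<dots> = y * v * (w * y * w)"
    by (simp add: mult.assoc)
  also have "\<dots> = (y * v * y) * y"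
    unfolding carmichael_pair_sandwich(1)[OF carmichael_pair_sym[OF assms(1)]]
    using carmichael_pairD(1)[OF assms(1)] by (simp add: mult.assoc)
  finally show ?thesis
    unfolding carmichael_pair_sandwich(1)[OF assms(4)] .
qed

section \<open>Extension to larger degree: two overlapping cycles\<close>

lemma gen_normalised_power:
  assumes "\<And>y. y \<in> gen S \<Longrightarrow> conj_by y t \<in> gen S" and "y \<in> gen S"
  shows "conj_by y (t ^ k) \<in> gen S"
  using assms(2)
  by (induction k arbitrary: y) (auto simp: assms(1) power_Suc simp flip: conj_by_conj_by)

text \<open>By \<open>rel\<close>, \<open>t ^ l\<close> commutes with \<open>t * X\<close>, hence with \<open>X\<close>, so the conjugates of \<open>X\<close> under powers of \<open>t\<close> are cyclically
  permuted with period \<open>l\<close>, and the relations between \<open>X\<close> and the first half of them imply the others.\<close>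

locale conj_cycle =
  fixes X t :: "'a::mult_group" and l m :: nat
  assumes X_cube: "X ^ 3 = 1"
    and X_involution: "\<And>d. 0 < d \<Longrightarrow> d < m \<Longrightarrow> (X * conj_by X (t ^ d)) ^ 2 = 1"
    and rel: "(t * X) ^ (l + 2) = t ^ l"
    and lm: "0 < l" "l < 2 * m"
begin

definition "V j = conj_by X (t ^ j)"

lemma V_0: "V 0 = X"
  by (simp add: V_def)

lemma V_conj: "conj_by (V i) (t ^ j) = V (i + j)"
  by (simp add: V_def conj_by_conj_by power_add)

lemma X_conj: "conj_by X (t ^ l) = X"
proof -
  have "conj_by (t ^ l) (t * X) = t ^ l"
    unfolding rel[symmetric] by (rule conj_by_self_power)
  then have "conj_by (t ^ l) X = t ^ l"
    by (simp flip: conj_by_conj_by)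
  then show ?thesis unfolding conj_by_eq_self_iff by simp
qed

lemma V_add: "V (i + l) = V i"
  using X_conj by (metis V_def add.commute conj_by_conj_by power_add)

lemma V_mod: "V (i mod l) = V i"
proof -
  have "V (i + l * k) = V i" for i k
    by (induction k) (use V_add in \<open>simp_all add: add.assoc[symmetric] add.commute[of l]\<close>)
  then show ?thesis by (metis mod_mult_div_eq)
qed

lemma V_gen: "V i \<in> gen (V ` {..<l})"
  by (metis V_mod gen_incl imageI lessThan_iff lm(1) mod_less_divisor)

lemma gen_V: "gen (V ` {..<l}) = gen (range V)"
  by (intro equalityI gen_subset) (auto intro: gen_incl V_gen)

lemma V_cube: "V i ^ 3 = 1"
  by (simp add: V_def X_cube flip: conj_by_power)

lemma V_involution:
  assumes "i < j" "j < l" shows "(V i * V j) ^ 2 = 1"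
proof -
  define d where "d = j - i"
  have d: "0 < d" "d < l" "j = d + i" using assms by (auto simp: d_def)
  have "(X * V d) ^ 2 = 1"
  proof (cases "d < m")
    case True
    then show ?thesis using X_involution d(1) by (simp add: V_def)
  next
    case False
    \<comment> \<open>As \<open>l < 2 * m\<close>, the complementary distance \<open>l - d\<close>
      is below \<open>m\<close>. Translating by \<open>d\<close> and reducing modulo the period
      \<open>l\<close> turns the pair 0, \<open>l - d\<close> into the pair \<open>d\<close>,
      0.\<close>
    then have "(V 0 * V (l - d)) ^ 2 = 1"
      using X_involution[of "l - d"] d lm by (simp add: V_def)
    then have "conj_by ((V 0 * V (l - d)) ^ 2) (t ^ d) = 1" by simp
    then have "(V d * V 0) ^ 2 = 1"
      using d V_add[of 0] by (simp add: conj_by_power conj_by_mult V_conj)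
    then show ?thesis by (simp add: V_0 involution_swap)
  qed
  then have "conj_by ((V 0 * V d) ^ 2) (t ^ i) = 1" by (simp add: V_0)
  then show ?thesis
    using d by (simp add: conj_by_power conj_by_mult V_conj)
qed

lemma V_carmichael: "carmichael {..<l} V"
  unfolding carmichael_def
proof (intro conjI ballI impI)
  fix i j assume "i \<in> {..<l}" "j \<in> {..<l}" "i \<noteq> j"
  then show "(V i * V j) ^ 2 = 1"
    using V_involution[of i j] V_involution[of j i] involution_swap[of "V i" "V j"]
    by (cases i j rule: linorder_cases) auto
qed (rule V_cube)

lemma gen_conj_t: "y \<in> gen (range V) \<Longrightarrow> conj_by y t \<in> gen (range V)"
  using V_conj[of _ 1] by (elim gen_normalised[rotated]) (auto intro: gen_incl)

text \<open>No order of \<open>t\<close> is available, but the conjugates have period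
  \<open>l\<close>, so one step back is \<open>l - 1\<close> steps forward.\<close>

lemma gen_conj_inverse_t:
  assumes "y \<in> gen (range V)" shows "conj_by y (inverse t) \<in> gen (range V)"
  using _ assms
proof (rule gen_normalised)
  fix s assume "s \<in> range V"
  then obtain j where j: "s = V j" by blast
  have "V j = conj_by (V (j + (l - 1))) (t ^ 1)"
    using V_add[of j] lm by (simp only: V_conj) simp
  then have "conj_by s (inverse t) = V (j + (l - 1))"
    by (simp add: j conj_by_conj_by)
  then show "conj_by s (inverse t) \<in> gen (range V)" by (simp add: gen_incl)
qed

text \<open>\<open>X\<close> is trivial modulo the generated group, so \<open>rel\<close> reduces to
  \<open>t ^ (l + 2) = t ^ l\<close> there.\<close>

lemma t_square: "t ^ 2 \<in> gen (range V)"
proof -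
  have X: "X \<in> gen (range V)" using V_0 by (metis gen_incl rangeI)
  obtain y where y: "y \<in> gen (range V)" "(t * X) ^ l = t ^ l * y"
    using power_mult_normalised[OF gen_conj_t X] by blast
  have "t ^ l * (y * (t * X) ^ 2) = t ^ l * 1"
    using rel by (simp only: power_add y(2) mult.assoc mult_1_right)
  then have "y * (t * X) ^ 2 = 1" by (simp only: mult_left_cancel_iff)
  moreover have "(t * X) ^ 2 = t ^ 2 * (V 1 * X)"
    by (simp add: V_def power2_eq_square conj_by_def mult.assoc)
  ultimately have "y * (t ^ 2 * (V 1 * X)) \<in> gen (range V)" by simp
  moreover have "V 1 * X \<in> gen (range V)" using gen_mult[OF gen_incl[of "V 1" "range V"] X] by simp
  ultimately show ?thesis using y(1) by (simp add: gen_mult_left_iff gen_mult_right_iff)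
qed

lemma t_in_if_odd_power:
  assumes "t ^ k \<in> gen (range V)" "odd k"
  shows "t \<in> gen (range V)"
proof -
  obtain j where "k = Suc (2 * j)" using assms(2) oddE by fastforce
  then show ?thesis
    using assms(1) gen_power[OF t_square, of j] by (simp add: power_mult gen_mult_right_iff)
qed

end

text \<open>In both constructions \<open>t\<close> is only known to act as a shift on an explicit
  chain of 3-cycles whose mutual relations hold already. The locale carries these relations over to
  conjugates under powers of \<open>t\<close>, as \<open>conj_cycle\<close> demands.\<close>

locale conj_window =
  fixes W :: "nat \<Rightarrow> 'a::mult_group" and t :: 'a and m :: nat
  assumes W_conj_t: "\<And>j. Suc j < m \<Longrightarrow> conj_by (W j) t = W (Suc j)"
    and W_involution: "\<And>i j. i < j \<Longrightarrow> j < m \<Longrightarrow> (W i * W j) ^ 2 = 1"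
begin

lemma W_conj_t_power: "i + j < m \<Longrightarrow> conj_by (W i) (t ^ j) = W (i + j)"
  by (induction j) (auto simp: W_conj_t power_Suc2 simp del: power_Suc simp flip: conj_by_conj_by)

text \<open>The relation between \<open>W 0\<close> and \<open>W d\<close> lies inside the window;
  conjugating it by \<open>t ^ q\<close> gives the claim even when \<open>q + d\<close> runs out of
  the window.\<close>

lemma W_conj_involution:
  assumes q: "q < m" and d: "0 < d" "d < m"
  shows "(W q * conj_by (W q) (t ^ d)) ^ 2 = 1"
proof -
  have q': "conj_by (W 0) (t ^ q) = W q" using W_conj_t_power[of 0 q] q by simp
  have "conj_by (W d) (t ^ q) = conj_by (conj_by (W 0) (t ^ d)) (t ^ q)"
    using W_conj_t_power[of 0 d] d by simp
  also have "\<dots> = conj_by (W q) (t ^ d)"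
    unfolding q'[symmetric] by (simp add: conj_by_conj_by add.commute flip: power_add)
  finally have "conj_by (W d) (t ^ q) = conj_by (W q) (t ^ d)" .
  moreover have "conj_by ((W 0 * W d) ^ 2) (t ^ q) = 1"
    using W_involution d by simp
  ultimately show ?thesis by (simp add: conj_by_power conj_by_mult q')
qed

lemma W_in_gen:
  assumes "\<And>y. y \<in> gen S \<Longrightarrow> conj_by y t \<in> gen S" "\<And>y. y \<in> gen S \<Longrightarrow> conj_by y (inverse t) \<in> gen S"
    and "W q \<in> gen S" "q < m" "j < m"
  shows "W j \<in> gen S"
proof -
  have "W i \<in> gen S" if "i \<le> q" for i
    using that
  proof (induction i rule: inc_induct)
    case (step i)
    then have "conj_by (conj_by (W i) t) (inverse t) \<in> gen S"
      using assms(2,4) by (simp add: W_conj_t)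
    then show ?case by (simp add: conj_by_conj_by)
  qed (rule assms(3))
  then have "W 0 \<in> gen S" by simp
  then show ?thesis
    using gen_normalised_power[OF assms(1), of "W 0" j] W_conj_t_power[of 0 j] assms(5) by simp
qed

end

text \<open>Since \<open>t ^ 2\<close> lies in \<open>gen S\<close> and \<open>t\<close> can be
  moved to the left across \<open>gen S\<close>, the union of \<open>gen S\<close> and its translate
  by \<open>t\<close> is closed under right multiplication.\<close>

lemma gen_insert_index_2:
  assumes fin: "finite (gen S)" and t: "\<And>y. y \<in> gen S \<Longrightarrow> conj_by y t \<in> gen S" "t ^ 2 \<in> gen S"
  shows "finite (gen (insert t S)) \<and> card (gen (insert t S)) \<le> 2 * card (gen S)"
proof -
  define K where "K = gen S \<union> (\<lambda>y. t * y) ` gen S"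
  have "gen (insert t S) \<subseteq> K"
  proof (rule gen_subset_if_closed_right)
    show "finite K" "1 \<in> K" using fin by (auto simp: K_def)
    fix k s assume k: "k \<in> K" and s: "s \<in> insert t S"
    have t1: "y * t = t * conj_by y t" for y by (simp add: mult_conj_by)
    have t2: "t * (y * t) = t ^ 2 * conj_by y t" for y
      by (simp add: conj_by_def power2_eq_square mult.assoc)
    have S: "y * s \<in> gen S" if "y \<in> gen S" "s \<in> S" for y s
      using that by (simp add: gen_incl gen_mult)
    show "k * s \<in> K"
    proof (cases "k \<in> gen S")
      case True
      then show ?thesis using s t(1)[OF True] S[OF True] by (auto simp: K_def t1)
    next
      case False
      then obtain y where y: "y \<in> gen S" "k = t * y" using k by (auto simp: K_def)
      then show ?thesis using s t S[OF y(1)] gen_mult[OF t(2) t(1)[OF y(1)]]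
        by (auto simp: K_def t2 mult.assoc)
    qed
  qed
  moreover have "finite K" "card K \<le> 2 * card (gen S)"
    using fin card_Un_le[of "gen S" "(\<lambda>y. t * y) ` gen S"] card_image_le[OF fin, of "\<lambda>y. t * y"]
    by (auto simp: K_def)
  ultimately show ?thesis by (meson card_mono finite_subset le_trans)
qed

lemma in_gen_if_coprime_powers:
  fixes u :: "'a::mult_group"
  assumes "coprime k p" "0 < k" "p > 1" "u ^ k \<in> gen S" "u ^ p \<in> gen S"
  shows "u \<in> gen S"
proof -
  obtain i where i: "[k * i = 1] (mod p)" using exists_mult_cong_1_nat[OF assms(1)] by blast
  have "k * i \<noteq> 0"
  proof
    assume "k * i = 0"
    then have "[0 = 1] (mod p)" using i by (simp only:)
    then show False using assms(3) by (simp add: cong_def)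
  qed
  then have "p dvd k * i - 1" using i by (metis Suc_leI cong_altdef_nat cong_sym neq0_conv One_nat_def)
  then obtain j where "k * i = Suc (p * j)" using \<open>k * i \<noteq> 0\<close> by (metis One_nat_def Suc_pred dvdE neq0_conv)
  then have "u * (u ^ p) ^ j = (u ^ k) ^ i" by (simp flip: power_mult)
  then show ?thesis using assms(4,5) by (metis gen_mult_right_iff gen_power)
qed

lemma (in base_relations) x_pair: "\<not> [i = j] (mod p) \<Longrightarrow> carmichael_pair (x i) (x j)"
  by (simp add: carmichael_pair_def x_cube x_involution)

lemma (in base_relations) x_pair_le: "i < j \<Longrightarrow> j < i + p \<Longrightarrow> carmichael_pair (x i) (x j)"
  using x_pair[of j i, THEN carmichael_pair_sym] cong_altdef_nat[of i j p] nat_dvd_not_less[of "j - i" p] by auto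

lemma (in base_relations) gen_x: "gen (range x) \<subseteq> gen (x ` {i..<i + p})"
proof (rule gen_subset, safe)
  fix j
  \<comment> \<open>This is the representative of \<open>j\<close> among \<open>i\<close>, ...,
    \<open>i + p - 1\<close>; the summand \<open>i * (p - 1)\<close> stands for \<open>- i\<close>
    modulo \<open>p\<close>.\<close>
  define j' where "j' = i + (j + i * (p - 1)) mod p"
  have "j' mod p = (j + p * i) mod p"
    unfolding j'_def mod_add_right_eq using p_ge_3 by (cases p) (simp_all add: algebra_simps)
  then have "[j = j'] (mod p)" "j' \<in> {i..<i + p}"
    using p_ge_3 by (auto simp: cong_def j'_def)
  then show "x j \<in> gen (x ` {i..<i + p})" using x_cong gen_incl by (metis imageI)
qed

text \<open>Model: \<open>\<alpha> = p + k\<close>, \<open>\<beta> = p + k + 1\<close>; \<open>h = u ^ p\<close> is the cycle \<open>(p, \<dots>, p + k - 1)\<close>, which commutes with \<open>a\<^sup>z\<close>, and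
  \<open>u\<close> is a common root of both; \<open>t = h a\<close> is the cycle \<open>(1, \<dots>, p + k - 1)\<close>.\<close>

locale relations_1 = base_relations a b z p r s
  for a b z :: "'a::mult_group" and p r s :: nat +
  fixes u :: 'a and k :: nat
  assumes a_eq: "a = z * u ^ k * inverse z"
    and k: "0 < k" "k < p"
    and rel_h: "u ^ p * conj_by z a = conj_by z a * u ^ p"
    and rel_t: "(u ^ p * a * z) ^ (p + k + 1) = (u ^ p * a) ^ (p + k - 1)"
begin

definition "h = u ^ p"
definition "t = h * a"

lemma conj_a_z: "conj_by a z = u ^ k"
  by (simp add: a_eq conj_by_def mult.assoc)

text \<open>Both \<open>x 1\<close> and \<open>u ^ k\<close> commute with \<open>h\<close>, the
  latter because \<open>h\<close> is a power of \<open>u\<close>. Conjugation by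
  \<open>u ^ k\<close>, that is by the conjugate of \<open>a\<close> under \<open>z\<close>, takes
  \<open>x i\<close> to \<open>x (i + 1) * inverse (x 1)\<close>, which passes the property on from
  \<open>i\<close> to \<open>i + 1\<close>.\<close>

lemma x_conj_h: "1 \<le> i \<Longrightarrow> i < p \<Longrightarrow> conj_by (x i) h = x i"
proof (induction i rule: dec_induct)
  case base
  then show ?case unfolding conj_by_eq_self_iff using rel_h by (simp only: x_1 h_def)
next
  case (step i)
  have pairs: "carmichael_pair (x 1) (x (i + 1))" "carmichael_pair (x 0) (x 1)" "carmichael_pair (x 0) (x (i + 1))"
    using step by (intro x_pair_le; simp)+
  have h: "conj_by (x 1) h = x 1" unfolding conj_by_eq_self_iff using rel_h by (simp only: x_1 h_def)
  have "conj_by (x i) (inverse z * a * z) = conj_by (conj_by (z * x i * inverse z) a) z"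
    by (simp add: conj_by_def mult.assoc)
  also have "conj_by (z * x i * inverse z) a = x 1 * x (i + 1) * inverse (x 1)"
    using x_conj_a[of i 1] x_conj_a[of 0 1] by (simp add: conj_by_mult conj_by_inverse x_0)
  also have "conj_by \<dots> z = x (i + 1) * inverse (x 1)"
    using carmichael_conj_cycle[OF pairs(1,2) carmichael_pair_sym[OF pairs(3)]] by (simp add: conj_by_def x_0 mult.assoc)
  also have "inverse z * a * z = u ^ k" using conj_a_z by (simp add: conj_by_def)
  finally have xi: "conj_by (x i) (u ^ k) = x (i + 1) * inverse (x 1)" .
  have "conj_by (u ^ k) h = u ^ k"
    by (simp add: conj_by_eq_self_iff h_def add.commute flip: power_add)
  then have "conj_by (conj_by (x i) (u ^ k)) h = conj_by (x i) (u ^ k)"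
    using step by (subst conj_by_mult_commute[of "x i" "u ^ k" h, unfolded conj_by_conj_by[symmetric]]) simp
  then have "conj_by (x (i + 1)) h * inverse (x 1) = x (i + 1) * inverse (x 1)"
    by (simp only: xi conj_by_mult conj_by_inverse h)
  then show ?case by simp
qed

lemma x_conj_t:
  assumes "1 \<le> i" "i < p" shows "conj_by (x i) t = x (i + 1)"
  using x_conj_h[OF assms] x_conj_a[of i 1] by (simp add: t_def flip: conj_by_conj_by)

sublocale window: conj_window "\<lambda>j. x (1 + j)" t p
  using x_conj_t x_pair_le by unfold_locales (auto simp: carmichael_pair_def)

text \<open>\<open>z\<close> is \<open>x p\<close>, the last entry of the window.\<close>

sublocale cycle: conj_cycle z t "p + k - 1" p
proof
  show "z ^ 3 = 1" by (rule z_cube)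
  show "0 < p + k - 1" "p + k - 1 < 2 * p" using k by auto
  show "(t * z) ^ (p + k - 1 + 2) = t ^ (p + k - 1)"
    using rel_t k by (simp add: t_def h_def)
  fix d assume "0 < d" "d < p"
  then show "(z * conj_by z (t ^ d)) ^ 2 = 1"
    using window.W_conj_involution[of "p - 1" d] p_ge_3 x_p by simp
qed

abbreviation "N \<equiv> gen (range cycle.V)"

lemma x_in_N:
  assumes "1 \<le> i" "i \<le> p" shows "x i \<in> N"
proof -
  have "x (1 + (p - 1)) \<in> N"
    using cycle.V_0 x_p p_ge_3 by (metis add_diff_inverse_nat gen_incl less_one not_numeral_le_zero rangeI)
  then have "x (1 + (i - 1)) \<in> N"
    using window.W_in_gen[OF cycle.gen_conj_t cycle.gen_conj_inverse_t, of "p - 1" "i - 1"] assms by simp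
  then show ?thesis using assms by simp
qed

lemma N_facts: "a \<in> N" "b \<in> N" "z \<in> N" "u ^ k \<in> N"
proof -
  have "gen (range x) \<subseteq> N"
    using gen_x[of 1] by (rule order_trans) (rule gen_subset, auto intro: x_in_N)
  then show a: "a \<in> N" and "b \<in> N" using x_gen_a x_gen_b by auto
  show z: "z \<in> N" using x_in_N[of p] x_p p_ge_3 by simp
  then show "u ^ k \<in> N" using gen_conj_by[OF a z] by (simp add: conj_a_z)
qed

lemma coprime_k_p: "coprime k p"
  using k p(1) by (metis coprime_commute nat_dvd_not_less prime_imp_coprime)

text \<open>Dividing \<open>t\<close> by \<open>a\<close> returns \<open>h = u ^ p\<close>; as
  \<open>u ^ k\<close> is in \<open>N\<close>, coprimality of the exponents returns
  \<open>u\<close>.\<close>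

lemma gens_in:
  assumes "N \<subseteq> gen S" "t \<in> gen S"
  shows "{u, b, z} \<subseteq> gen S"
proof -
  have "h \<in> gen S" using assms N_facts(1) gen_mult_right_iff[of a S h] by (auto simp: t_def)
  then have "u \<in> gen S"
    using in_gen_if_coprime_powers[OF coprime_k_p k(1), of u S] N_facts(4) assms(1) p_ge_3 by (auto simp: h_def)
  then show ?thesis using N_facts assms(1) by auto
qed

lemma order_bound: "finite (gen {u, b, z})" "card (gen {u, b, z}) \<le> fact (p + k + 1)"
proof -
  have fin: "finite N" "2 * card N \<le> fact (p + k + 1)"
    using carmichael_gen_card[OF cycle.V_carmichael] k unfolding cycle.gen_V
    by (simp_all add: Suc_diff_Suc del: fact_Suc)
  have gens: "gen {u, b, z} \<subseteq> gen (insert t (range cycle.V))"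
    by (intro gen_subset gens_in gen_mono gen_incl) auto
  have *: "finite (gen (insert t (range cycle.V)))" "card (gen (insert t (range cycle.V))) \<le> 2 * card N"
    using gen_insert_index_2[OF fin(1) cycle.gen_conj_t cycle.t_square] by auto
  show "finite (gen {u, b, z})" using gens *(1) finite_subset by blast
  show "card (gen {u, b, z}) \<le> fact (p + k + 1)" using card_mono[OF *(1) gens] *(2) fin(2) by linarith
qed

text \<open>\<open>t\<close> agrees with \<open>h\<close> modulo \<open>N\<close>, and
  \<open>h ^ k\<close> is a conjugate of \<open>a ^ p\<close>, hence trivial. So an odd power of
  \<open>t\<close> lies in \<open>N\<close>, as does its square.\<close>

lemma carmichael_generators:
  assumes "odd k" shows "\<exists>V. carmichael {..<p + k - 1} V \<and> {u, b, z} \<subseteq> gen (V ` {..<p + k - 1})"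
proof (intro exI conjI)
  show "carmichael {..<p + k - 1} cycle.V" by (rule cycle.V_carmichael)
  have "h ^ k = conj_by (a ^ p) z"
    by (simp add: conj_by_power conj_a_z h_def mult.commute flip: power_mult)
  then have hk: "h ^ k = 1" using a_order by simp
  have "conj_by y h \<in> N" if "y \<in> N" for y
  proof -
    have "conj_by y h = conj_by (conj_by y t) (inverse a)" by (simp add: t_def conj_by_conj_by mult.assoc)
    then show ?thesis using cycle.gen_conj_t[OF that] N_facts(1) by (simp add: gen_conj_by)
  qed
  then obtain y where "y \<in> N" "t ^ k = h ^ k * y"
    using power_mult_normalised[of "range cycle.V" h a k] N_facts(1) by (auto simp: t_def)
  then have "t \<in> N" using cycle.t_in_if_odd_power[of k] assms hk by simp
  then show "{u, b, z} \<subseteq> gen (cycle.V ` {..<p + k - 1})"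
    unfolding cycle.gen_V by (intro gens_in) auto
qed

end

section \<open>Extension to larger degree: two disjoint cycles\<close>

text \<open>Model: \<open>\<alpha> = p + 1\<close>, \<open>\<beta> = p + 2\<close>; \<open>h = u ^ p\<close> is the cycle \<open>(p + 1, \<dots>, p + k)\<close>, and \<open>u\<close> is a common root of \<open>a\<close> and \<open>h\<close>.
  The long word \<open>t\<close> is the cycle \<open>(4, \<dots>, p + k)\<close>, the word \<open>X\<close> is \<open>(1 2 \<alpha>)\<close> and \<open>C i\<close> is \<open>(1 2 i)\<close>, so that the roles of
  \<open>\<alpha>, \<beta>\<close> are taken over by \<open>1, 2\<close>.\<close>

locale relations_2 = base_relations a b z p r s
  for a b z :: "'a::mult_group" and p r s :: nat +
  fixes u :: 'a and k :: nat
  assumes a_eq: "a = u ^ k"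
    and k: "2 \<le> k" "k < p" "5 \<le> p"
    and rel_h: "conj_by (inverse z * conj_by z a) (u ^ p) = z * inverse (conj_by z a)"
    and rel_t: "(u ^ p * a * inverse (conj_by z (a ^ 4)) * conj_by z (a ^ 3) * inverse (conj_by z (a ^ 2)) * conj_by z a
        * (inverse (conj_by z a) * conj_by z (a ^ 2))) ^ (p + k - 1)
      = (u ^ p * a * inverse (conj_by z (a ^ 4)) * conj_by z (a ^ 3) * inverse (conj_by z (a ^ 2)) * conj_by z a) ^ (p + k - 3)"
begin

definition "h = u ^ p"
definition "t = h * a * (inverse (x 4) * x 3) * (inverse (x 2) * x 1)"
definition "C i = inverse (x 1) * x 2 * inverse (x i) * x 1"
definition "X = inverse (x 1) * x 2"
definition "E = x 1 * inverse (x 2)"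
text \<open>The 3-cycles (1 2 i) for i = 4, ..., p, \<alpha>, \<beta>, in the order in which
  \<open>t\<close> permutes them. Since \<open>x (p + 1)\<close> is \<open>x 1\<close>,
  \<open>C (Suc p)\<close> is \<open>X\<close>, that is (1 2 \<alpha>). At the next index
  \<open>C\<close> would collapse to 1, so \<open>E\<close>, the 3-cycle (1 2 \<beta>), takes
  over.\<close>

definition "W j = (if j = p - 2 then E else C (4 + j))"

lemma pairs:
  "carmichael_pair (x 1) (x 2)" "carmichael_pair (x 2) (x 3)" "carmichael_pair (x 4) (x 2)" "carmichael_pair (x 4) (x 3)"
  using k x_pair_le[of 1 2] x_pair_le[of 2 3] x_pair_le[of 2 4, THEN carmichael_pair_sym] x_pair_le[of 3 4, THEN carmichael_pair_sym]
  by simp_all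

text \<open>In the model, \<open>h\<close> takes \<alpha> to \<beta> and hence (\<alpha> i j) to
  (\<beta> i j). The relation \<open>rel_h\<close> is the case of indices 0 and 1; translating by
  \<open>a\<close>, which commutes with \<open>h\<close>, gives all neighbours, and a telescoping
  product gives all pairs.\<close>

lemma x_conj_h: "conj_by (inverse (x i) * x j) h = x i * inverse (x j)"
proof -
  have ah: "a ^ i * h = h * a ^ i" for i
    by (simp add: a_eq h_def add.commute flip: power_mult power_add)
  have step: "conj_by (inverse (x i) * x (Suc i)) h = x i * inverse (x (Suc i))" for i
  proof -
    have "conj_by (inverse (x i) * x (Suc i)) h = conj_by (inverse (x 0) * x 1) (a ^ i * h)"
      by (simp add: conj_by_mult conj_by_inverse x_conj_a flip: conj_by_conj_by)
    also have "\<dots> = conj_by (x 0 * inverse (x 1)) (a ^ i)"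
      unfolding ah using rel_h by (simp add: h_def x_0 x_1[unfolded One_nat_def] flip: conj_by_conj_by)
    finally show ?thesis by (simp add: conj_by_mult conj_by_inverse x_conj_a)
  qed
  have add: "conj_by (inverse (x i) * x (i + d)) h = x i * inverse (x (i + d))" for d
  proof (induction d)
    case (Suc d)
    have "conj_by (inverse (x i) * x (i + Suc d)) h
        = conj_by (inverse (x i) * x (i + d)) h * conj_by (inverse (x (i + d)) * x (Suc (i + d))) h"
      by (simp add: mult.assoc flip: conj_by_mult)
    then show ?case unfolding Suc step by (simp add: mult.assoc)
  qed simp
  \<comment> \<open>Adding a multiple of \<open>p\<close> makes the second index at least
    \<open>i\<close> without changing \<open>x j\<close>.\<close>
  have "j + p * i = i + (j + p * i - i)" using p_ge_3 by (cases p) auto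
  moreover have "x (j + p * i) = x j" by (rule x_cong) (simp add: cong_def)
  ultimately show ?thesis using add[of "j + p * i - i"] by simp
qed

text \<open>\<open>C i\<close> is a product of two of the quotients handled by
  \<open>x_conj_h\<close>; the result is another expression for the same 3-cycle, by
  \<open>carmichael_triple_cycle\<close>.\<close>

lemma C_conj_h:
  assumes "\<not> [i = 1] (mod p)" shows "conj_by (C i) h = C i"
proof -
  have "conj_by (C i) h = conj_by (inverse (x 1) * x 2) h * conj_by (inverse (x i) * x 1) h"
    by (simp add: C_def mult.assoc flip: conj_by_mult)
  then have "conj_by (C i) h = x 1 * inverse (x 2) * x i * inverse (x 1)"
    unfolding x_conj_h by (simp add: mult.assoc)
  then show ?thesis
    using carmichael_triple_cycle[OF pairs(1) x_pair[of 1 i]] assms by (simp add: C_def cong_sym_eq)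
qed

lemma C_conj_a: "conj_by (C i) a = inverse (x 2) * x 3 * inverse (x (Suc i)) * x 2"
  using x_conj_a[of _ 1] by (simp add: C_def conj_by_mult conj_by_inverse eval_nat_numeral)

lemma conj_by_t: "conj_by y t = conj_by (conj_by (conj_by (conj_by y h) a) (inverse (x 4) * x 3)) (inverse (x 2) * x 1)"
  by (simp add: t_def conj_by_conj_by mult.assoc)

text \<open>Follow the factors of \<open>t\<close>: \<open>h\<close> fixes (1 2 i), \<open>a\<close>
  moves it to (2 3 i+1), then (\<alpha> 4 3) replaces 3 by \<alpha>, and (\<alpha> 2 1) takes 2 to 1
  and \<alpha> to 2. The range of \<open>i\<close> keeps \<open>i + 1\<close> different from 2, 3
  and 4 modulo \<open>p\<close>.\<close>

lemma C_conj_t: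
  assumes "4 \<le> i" "i \<le> p" shows "conj_by (C i) t = C (Suc i)"
proof -
  have "carmichael_pair (x 2) (x (Suc i))" "carmichael_pair (x 3) (x (Suc i))" "carmichael_pair (x 4) (x (Suc i))"
    using assms k by (auto intro!: x_pair_le)
  note shift = carmichael_conj_shift_3[OF pairs(2,3,4) this]
  have "\<not> [i = 1] (mod p)"
    using assms k by (cases "i = p") (auto simp: cong_def)
  then have "conj_by (C i) h = C i" by (rule C_conj_h)
  then show ?thesis
    unfolding conj_by_t by (simp only: C_conj_a shift) (simp add: conj_by_def C_def mult.assoc)
qed

text \<open>The cycle \<open>t\<close> avoids the points 1, 2 and 3. The steps are (1 2 3), (2 3 4),
  (2 \<alpha> 3) and back.\<close>

lemma C_3_conj_t: "conj_by (C 3) t = C 3"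
proof -
  have "\<not> [3 = 1] (mod p)" using k by (simp add: cong_def)
  then have "conj_by (C 3) h = C 3" by (rule C_conj_h)
  moreover have "conj_by (C 3) a = inverse (x 2) * x 3 * inverse (x 4) * x 2"
    using C_conj_a[of 3] by simp
  ultimately show ?thesis
    unfolding conj_by_t using carmichael_conj_shift_2[OF pairs(2,3,4)] by (simp add: conj_by_def C_def mult.assoc)
qed

lemma C_last: "C (Suc p) = X"
proof -
  have "x (1 + p) = x 1" by (rule x_cong) (simp only: cong_def mod_add_self2)
  then show ?thesis by (simp add: C_def X_def mult.assoc)
qed

lemma X_conj_t: "conj_by X t = E"
proof -
  have "conj_by (x 1 * inverse (x 2)) a = x 2 * inverse (x 3)"
    using x_conj_a[of _ 1] by (simp add: conj_by_mult conj_by_inverse eval_nat_numeral)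
  then show ?thesis
    unfolding conj_by_t X_def x_conj_h using carmichael_conj_shift_1[OF pairs(2,3,4)]
      carmichael_pair_conj[OF pairs(1)] by (simp add: conj_by_def E_def mult.assoc)
qed

lemma C_eq_conj: "C i = conj_by (x 2 * inverse (x i)) (x 1)"
  and E_eq_conj: "E = conj_by (x 2) (x 1)"
  using carmichael_pair_conj[OF pairs(1)] by (simp_all add: C_def E_def conj_by_def mult.assoc)

text \<open>Up to conjugation by \<open>x 1\<close>, these are the quotients (\<beta> 2 i) and
  (\<beta> 2 j).\<close>

lemma C_pair:
  assumes "3 \<le> i" "i < j" "j \<le> Suc p" shows "carmichael_pair (C i) (C j)"
proof -
  have "carmichael_pair (x 2) (x i)" "carmichael_pair (x 2) (x j)" "carmichael_pair (x i) (x j)"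
    using assms k by (auto intro!: x_pair_le)
  then have "carmichael_pair (x 2 * inverse (x i)) (x 2 * inverse (x j))"
    unfolding carmichael_pair_def[of "_ * inverse _"]
    using carmichael_pair_quotient_cube carmichael_pair_quotients by blast
  then show ?thesis by (simp add: carmichael_pair_def C_eq_conj flip: conj_by_mult conj_by_power)
qed

lemma C_E_pair:
  assumes "3 \<le> i" "i \<le> Suc p" shows "carmichael_pair (C i) E"
proof -
  have pair: "carmichael_pair (x 2) (x i)" using assms k by (auto intro!: x_pair_le)
  then have "x 2 * (x 2 * inverse (x i)) = inverse (x i * x 2)"
    by (simp add: carmichael_pairD)
  then have "(x 2 * inverse (x i) * x 2) ^ 2 = 1"
    using carmichael_pair_sym[OF pair] inverse_power_mult[of "x i * x 2" 2]
    by (subst involution_swap) (simp add: carmichael_pair_def)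
  then have "carmichael_pair (x 2 * inverse (x i)) (x 2)"
    using carmichael_pair_quotient_cube[OF pair] x_cube by (simp add: carmichael_pair_def)
  then show ?thesis by (simp add: carmichael_pair_def C_eq_conj E_eq_conj flip: conj_by_mult conj_by_power)
qed

lemma W_last: "W (p - 3) = X"
proof -
  have "4 + (p - 3) = Suc p" "p - 3 \<noteq> p - 2" using k by simp_all
  then show ?thesis using C_last by (simp add: W_def)
qed

lemma W_conj_t: "Suc j < p - 1 \<Longrightarrow> conj_by (W j) t = W (Suc j)"
proof (cases "j = p - 3")
  case True
  then have "Suc j = p - 2" using k by simp
  then have "W (Suc j) = E" by (simp add: W_def)
  then show ?thesis using X_conj_t W_last True by simp
next
  case False
  assume "Suc j < p - 1"
  then show ?thesis using False C_conj_t[of "4 + j"] by (auto simp: W_def)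
qed

sublocale window: conj_window W t "p - 1"
proof
  fix i j assume "i < j" "j < p - 1"
  then show "(W i * W j) ^ 2 = 1"
    using C_pair[of "4 + i" "4 + j"] C_E_pair[of "4 + i"] by (auto simp: carmichael_pair_def W_def)
qed (rule W_conj_t)

lemma C_eq_W: "4 \<le> i \<Longrightarrow> i \<le> Suc p \<Longrightarrow> C i = W (i - 4)"
  by (auto simp: W_def)

sublocale cycle: conj_cycle X t "p + k - 3" "p - 1"
proof
  show "X ^ 3 = 1" using C_E_pair[of "Suc p"] k by (simp add: carmichael_pair_def C_last)
  show "0 < p + k - 3" "p + k - 3 < 2 * (p - 1)" using k by auto
  have "p + k - 3 + 2 = p + k - 1" using k by simp
  then show "(t * X) ^ (p + k - 3 + 2) = t ^ (p + k - 3)"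
    using rel_t by (simp add: t_def h_def x_def X_def mult.assoc)
  fix d assume "0 < d" "d < p - 1"
  then show "(X * conj_by X (t ^ d)) ^ 2 = 1"
    using window.W_conj_involution[of "p - 3" d] k by (simp add: W_last)
qed

text \<open>The orbit of \<open>X\<close> under \<open>t\<close> misses (1 2 3), because
  \<open>t\<close> fixes 3; it is added as the last Carmichael generator.\<close>

definition "V i = (if i < p + k - 3 then cycle.V i else C 3)"

abbreviation "N \<equiv> gen (V ` {..<p + k - 2})"

lemma V_image: "V ` {..<p + k - 2} = insert (C 3) (cycle.V ` {..<p + k - 3})"
proof -
  have "{..<p + k - 2} = insert (p + k - 3) {..<p + k - 3}" using k by auto
  then show ?thesis by (auto simp: V_def)
qed

lemma cycle_N: "gen (range cycle.V) \<subseteq> N"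
  unfolding V_image cycle.gen_V[symmetric] by (intro gen_mono) auto

lemma C_3_N: "C 3 \<in> N"
  unfolding V_image by (simp add: gen_incl)

lemma V_carmichael: "carmichael {..<p + k - 2} V"
proof -
  have C3: "C 3 ^ 3 = 1" "(X * C 3) ^ 2 = 1"
    using C_pair[of 3 "Suc p"] k involution_swap[of X "C 3"] by (auto simp: carmichael_pair_def C_last)
  have "conj_by (C 3) (t ^ i) = C 3" for i
    by (induction i) (simp_all add: C_3_conj_t flip: conj_by_conj_by)
  then have "(cycle.V i * C 3) ^ 2 = conj_by ((X * C 3) ^ 2) (t ^ i)" for i
    by (simp add: cycle.V_def conj_by_power conj_by_mult)
  then have VC: "(cycle.V i * C 3) ^ 2 = 1" for i using C3 by simp
  then have CV: "(C 3 * cycle.V i) ^ 2 = 1" for i by (subst involution_swap)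
  show ?thesis
    using cycle.V_carmichael C3 VC CV by (auto simp: carmichael_def V_def)
qed

lemma N_conj_t: "y \<in> N \<Longrightarrow> conj_by y t \<in> N"
proof (erule gen_normalised[rotated])
  fix s assume "s \<in> V ` {..<p + k - 2}"
  then consider "s = C 3" | i where "s = cycle.V i"
    unfolding V_image by blast
  then show "conj_by s t \<in> N"
  proof cases
    case 1
    then show ?thesis using C_3_N by (simp add: C_3_conj_t)
  next
    case 2
    then have "s \<in> gen (range cycle.V)" by (simp add: gen_incl)
    then show ?thesis using cycle.gen_conj_t cycle_N by blast
  qed
qed

lemma W_in_N:
  assumes "j < p - 1" shows "W j \<in> N"
proof -
  have "W (p - 3) \<in> gen (range cycle.V)"
    unfolding W_last using cycle.V_0 by (metis gen_incl rangeI)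
  then have "W j \<in> gen (range cycle.V)"
    using window.W_in_gen[OF cycle.gen_conj_t cycle.gen_conj_inverse_t, of "p - 3" j] assms k by simp
  then show ?thesis using cycle_N by blast
qed

lemma C_in_N: "3 \<le> i \<Longrightarrow> i \<le> Suc p \<Longrightarrow> C i \<in> N"
  using C_3_N W_in_N[of "i - 4"] k by (cases "i = 3") (auto simp: C_eq_W)

text \<open>\<open>x 2\<close> is a quotient of \<open>X\<close> and \<open>E\<close>, both in the
  window; \<open>X\<close> then yields \<open>x 1\<close>, and each \<open>C i\<close> yields
  \<open>x i\<close>.\<close>

lemma x_in_N: "x i \<in> N"
proof -
  have X: "X \<in> N" using C_in_N[of "Suc p"] k by (simp add: C_last)
  have E: "E \<in> N" using W_in_N[of "p - 2"] k by (simp add: W_def)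
  have "X * inverse E = x 2"
    using carmichael_pairD[OF carmichael_pair_sym[OF pairs(1)]] carmichael_pair_sandwich(2)[OF pairs(1)]
    by (simp add: X_def E_def mult.assoc)
  then have x2: "x 2 \<in> N" using X E by (metis gen_mult gen_inverse)
  then have x1: "x 1 \<in> N" using X by (simp add: X_def gen_mult_right_iff)
  have "x j \<in> N" if "j \<in> {1..<1 + p}" for j
  proof (cases "j < 3")
    case True
    then show ?thesis using that x1 x2 by (cases "j = 1"; cases "j = 2"; simp)
  next
    case False
    then show ?thesis using C_in_N[of j] that x1 x2 unfolding C_def by (simp add: gen_mult_left_iff gen_mult_right_iff)
  qed
  then have "gen (x ` {1..<1 + p}) \<subseteq> N" by (intro gen_subset) auto
  then show ?thesis using gen_x[of 1] by (blast intro: gen_incl)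
qed

lemma N_facts: "a \<in> N" "b \<in> N" "z \<in> N"
proof -
  have "gen (range x) \<subseteq> N" by (rule gen_subset) (use x_in_N in auto)
  then show "a \<in> N" "b \<in> N" using x_gen_a x_gen_b by auto
  show "z \<in> N" using x_in_N[of 0] by (simp add: x_0)
qed

lemma coprime_k_p: "coprime k p"
  using k p(1) by (metis coprime_commute nat_dvd_not_less prime_imp_coprime zero_less_numeral order_less_le_trans)

definition "c = a * (inverse (x 4) * x 3) * (inverse (x 2) * x 1)"

lemma t_eq: "t = h * c" and c_in_N: "c \<in> N"
  using x_in_N N_facts by (auto simp: t_def c_def mult.assoc intro!: gen_mult gen_inverse)

lemma gens_in:
  assumes "N \<subseteq> gen S" "t \<in> gen S"
  shows "{u, b, z} \<subseteq> gen S"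
proof -
  have "h \<in> gen S" using assms c_in_N gen_mult_right_iff[of c S h] by (auto simp: t_eq)
  then have "u \<in> gen S"
    using in_gen_if_coprime_powers[OF coprime_k_p, of u S] N_facts(1) assms(1) k a_eq by (auto simp: h_def)
  then show ?thesis using N_facts assms(1) by auto
qed

lemma order_bound: "finite (gen {u, b, z})" "card (gen {u, b, z}) \<le> fact (p + k)"
proof -
  have "p + k - 2 + 2 = p + k" using k by simp
  then have fin: "finite N" "2 * card N \<le> fact (p + k)"
    using carmichael_gen_card[OF V_carmichael] by auto
  have gens: "gen {u, b, z} \<subseteq> gen (insert t (V ` {..<p + k - 2}))"
    by (intro gen_subset gens_in gen_mono gen_incl) auto
  have *: "finite (gen (insert t (V ` {..<p + k - 2})))" "card (gen (insert t (V ` {..<p + k - 2}))) \<le> 2 * card N"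
    using gen_insert_index_2[OF fin(1) N_conj_t] cycle.t_square cycle_N by auto
  show "finite (gen {u, b, z})" using gens *(1) finite_subset by blast
  show "card (gen {u, b, z}) \<le> fact (p + k)" using card_mono[OF *(1) gens] *(2) fin(2) by linarith
qed

lemma carmichael_generators:
  assumes "odd k" shows "\<exists>V. carmichael {..<p + k - 2} V \<and> {u, b, z} \<subseteq> gen (V ` {..<p + k - 2})"
proof (intro exI conjI)
  show "carmichael {..<p + k - 2} V" by (rule V_carmichael)
  have hk: "h ^ k = 1"
    using a_order by (simp add: h_def a_eq mult.commute flip: power_mult)
  have "conj_by y h \<in> N" if "y \<in> N" for y
  proof -
    have "conj_by y h = conj_by (conj_by y t) (inverse c)" by (simp add: t_eq conj_by_conj_by mult.assoc)
    then show ?thesis using N_conj_t[OF that] c_in_N by (simp add: gen_conj_by)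
  qed
  then obtain y where y: "y \<in> N" "t ^ k = h ^ k * y"
    using power_mult_normalised[of "V ` {..<p + k - 2}" h c k] c_in_N by (auto simp: t_eq)
  obtain j where "k = Suc (2 * j)" using assms oddE by fastforce
  then have "t ^ k = t * (t ^ 2) ^ j" by (simp add: power_mult)
  moreover have "t ^ k \<in> N" using y hk by simp
  moreover have "(t ^ 2) ^ j \<in> N" using cycle.t_square cycle_N gen_power by blast
  ultimately have "t \<in> N" using gen_mult_right_iff by metis
  then show "{u, b, z} \<subseteq> N"
    by (rule gens_in[OF subset_refl])
qed

end

section \<open>From generators of abstract groups to presentations\<close>

text \<open>Bijections act on the right, so that the product \<open>f * g\<close> means first \<open>f\<close>, then \<open>g\<close>.\<close>

typedef 'a bij = "{f :: 'a \<Rightarrow> 'a. bij f}" morphisms app Bij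
  by (rule exI[of _ id]) simp

setup_lifting type_definition_bij

instantiation bij :: (type) mult_group
begin

lift_definition one_bij :: "'a bij" is id by simp
lift_definition times_bij :: "'a bij \<Rightarrow> 'a bij \<Rightarrow> 'a bij" is "\<lambda>f g. g \<circ> f" by (rule bij_comp)
lift_definition inverse_bij :: "'a bij \<Rightarrow> 'a bij" is "\<lambda>f. inv' f" by (rule bij_imp_bij_inv)
definition divide_bij :: "'a bij \<Rightarrow> 'a bij \<Rightarrow> 'a bij" where "divide_bij f g = f * inverse g"

instance
  by (standard; transfer; auto simp: fun_eq_iff bij_def surj_f_inv_f)

end

lemma app_one [simp]: "app 1 = id"
  by (rule one_bij.rep_eq)

lemma app_mult: "app (f * g) = app g \<circ> app f"
  by (rule times_bij.rep_eq)

lemma app_inverse: "app (inverse f) = inv' (app f)"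
  by (rule inverse_bij.rep_eq)

lemma bij_app [simp]: "bij (app f)"
  using app by auto

lemma bij_eqI: "(\<And>i. app f i = app g i) \<Longrightarrow> f = g"
  by (simp add: app_inject[symmetric] fun_eq_iff)

text \<open>Cayley's embedding, extended by the identity outside the carrier because a
  \<open>bij\<close> acts on a whole type.\<close>

definition right_mult :: "('a, 'b) monoid_scheme \<Rightarrow> 'a \<Rightarrow> 'a bij" where
  "right_mult G x = Bij (\<lambda>y. if y \<in> carrier G then y \<otimes>\<^bsub>G\<^esub> x else y)"

context group begin

lemma app_right_mult:
  assumes "x \<in> carrier G"
  shows "app (right_mult G x) = (\<lambda>y. if y \<in> carrier G then y \<otimes> x else y)"
proof -
  have "bij (\<lambda>y. if y \<in> carrier G then y \<otimes> x else y)"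
    using assms
    by (intro o_bij[of "\<lambda>y. if y \<in> carrier G then y \<otimes> inv x else y"]) (auto simp: fun_eq_iff m_assoc)
  then show ?thesis by (simp add: right_mult_def Bij_inverse)
qed

lemma right_mult_mult:
  "x \<in> carrier G \<Longrightarrow> y \<in> carrier G \<Longrightarrow> right_mult G (x \<otimes> y) = right_mult G x * right_mult G y"
  by (rule bij_eqI) (simp add: app_right_mult app_mult m_assoc)

lemma right_mult_one: "right_mult G \<one> = 1"
  by (rule bij_eqI) (simp add: app_right_mult)

lemma right_mult_eq_1_iff:
  assumes "x \<in> carrier G" shows "right_mult G x = 1 \<longleftrightarrow> x = \<one>"
proof
  assume "right_mult G x = 1"
  then have "app (right_mult G x) \<one> = \<one>" by simp
  then show "x = \<one>" using assms by (simp add: app_right_mult)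
qed (simp add: right_mult_one)

end

section \<open>Evaluation of words and the universal property of the free group\<close>

primrec ev :: "('x \<Rightarrow> 'g::mult_group) \<Rightarrow> 'x pword \<Rightarrow> 'g" where
  "ev f (Gen x) = f x"
| "ev f (Mul v w) = ev f v * ev f w"
| "ev f (Pow w m) = ev f w powi m"

definition letter_val :: "('x \<Rightarrow> 'g::mult_group) \<Rightarrow> 'x letter \<Rightarrow> 'g" where
  "letter_val f a = (if snd a then inverse (f (fst a)) else f (fst a))"

definition lift :: "('x \<Rightarrow> 'g::mult_group) \<Rightarrow> 'x letter list \<Rightarrow> 'g" where
  "lift f w = foldr (\<lambda>a g. letter_val f a * g) w 1"

lemma lift_simps [simp]: "lift f [] = 1" "lift f (a # w) = letter_val f a * lift f w"
  by (simp_all add: lift_def)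

lemma letter_val_linv: "letter_val f (linv a) = inverse (letter_val f a)"
  by (simp add: letter_val_def linv_def)

lemma lift_rcons: "lift f (rcons a w) = letter_val f a * lift f w"
  by (cases w) (auto simp: rcons_def letter_val_linv)

lemma lift_foldr_rcons: "lift f (foldr rcons v w) = lift f v * lift f w"
  by (induction v) (simp_all add: lift_rcons mult.assoc)

lemma lift_mult: "lift f (v \<otimes>\<^bsub>free_group X\<^esub> w) = lift f v * lift f w"
  by (simp add: free_group_def lift_foldr_rcons)

lemma lift_one: "lift f \<one>\<^bsub>free_group X\<^esub> = 1"
  by (simp add: free_group_def)

lemma lift_inv:
  assumes "w \<in> carrier (free_group X)" shows "lift f (inv\<^bsub>free_group X\<^esub> w) = inverse (lift f w)"
proof -
  interpret group "free_group X" by (rule group_free_group)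
  have "lift f w * lift f (inv\<^bsub>free_group X\<^esub> w) = 1"
    using r_inv[OF assms] lift_mult[of f X w] lift_one[of f X] by metis
  then show ?thesis by (rule inverse_eq_if_mult_eq_1)
qed

lemma lift_nat_pow: "lift f (w [^]\<^bsub>free_group X\<^esub> (k::nat)) = lift f w ^ k"
  by (induction k) (simp_all add: lift_mult lift_one power_commutes nat_pow_def)

lemma lift_int_pow:
  assumes "w \<in> carrier (free_group X)" shows "lift f (w [^]\<^bsub>free_group X\<^esub> (m::int)) = lift f w powi m"
proof -
  interpret group "free_group X" by (rule group_free_group)
  show ?thesis
  proof (cases "m < 0")
    case True
    then have "lift f (w [^]\<^bsub>free_group X\<^esub> m) = inverse (lift f (w [^]\<^bsub>free_group X\<^esub> nat (- m)))"
      using assms by (simp only: int_pow_def2 lift_inv nat_pow_closed if_True)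
    then show ?thesis using True by (simp only: lift_nat_pow inverse_power_mult power_int_def not_le[symmetric] if_False)
  next
    case False
    then have "0 \<le> m" by simp
    with False show ?thesis by (simp only: int_pow_def2 power_int_def lift_nat_pow if_True if_False)
  qed
qed

lemma word_val_closed:
  "set_pword w \<subseteq> X \<Longrightarrow> word_val X w \<in> carrier (free_group X)"
proof (induction w)
  case (Gen x)
  then show ?case by (simp add: free_group_def)
qed (use group_free_group[of X] in \<open>auto intro: group.int_pow_closed monoid.m_closed simp: group_def\<close>)

lemma lift_word_val:
  "set_pword w \<subseteq> X \<Longrightarrow> lift f (word_val X w) = ev f w"
  by (induction w) (simp_all add: lift_mult lift_int_pow word_val_closed letter_val_def)

lemma Cons_eq_mult:
  "a # w \<in> carrier (free_group X) \<Longrightarrow> a # w = [a] \<otimes>\<^bsub>free_group X\<^esub> w"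
  by (cases w) (auto simp: free_group_def rcons_def)

lemma singleton_closed: "fst a \<in> X \<Longrightarrow> [a] \<in> carrier (free_group X)"
  by (simp add: free_group_def)

lemma tl_closed: "a # w \<in> carrier (free_group X) \<Longrightarrow> w \<in> carrier (free_group X) \<and> fst a \<in> X"
  by (auto simp: free_group_def dest: freely_reduced_tl)

lemma lift_range: "lift f ` carrier (free_group X) = gen (f ` X)"
proof (intro equalityI subsetI)
  fix g assume "g \<in> lift f ` carrier (free_group X)"
  then obtain w where w: "w \<in> carrier (free_group X)" "g = lift f w" by blast
  have "lift f w \<in> gen (f ` X)"
    using w(1)
  proof (induction w)
    case (Cons a w)
    then have "lift f w \<in> gen (f ` X)" "f (fst a) \<in> gen (f ` X)"
      using tl_closed[OF Cons.prems] by (simp_all add: gen_incl)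
    then show ?case by (simp add: letter_val_def gen_mult)
  qed simp
  then show "g \<in> gen (f ` X)" using w by simp
next
  interpret group "free_group X" by (rule group_free_group)
  fix g assume "g \<in> gen (f ` X)"
  then show "g \<in> lift f ` carrier (free_group X)"
  proof induction
    case gen_one
    then show ?case by (intro image_eqI[of _ _ "\<one>\<^bsub>free_group X\<^esub>"]) (simp_all add: lift_one)
  next
    case (gen_incl s)
    then obtain x where "x \<in> X" "s = f x" by blast
    then have "s = lift f [(x, False)]" "[(x, False)] \<in> carrier (free_group X)"
      by (auto simp: letter_val_def singleton_closed)
    then show ?case by blast
  next
    case (gen_mult x y)
    then obtain v w where "v \<in> carrier (free_group X)" "w \<in> carrier (free_group X)" "x = lift f v" "y = lift f w"
      by blast
    then show ?case by (intro image_eqI[of _ _ "v \<otimes>\<^bsub>free_group X\<^esub> w"]) (simp_all add: lift_mult)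
  next
    case (gen_inverse x)
    then obtain v where "v \<in> carrier (free_group X)" "x = lift f v" by blast
    then show ?case by (intro image_eqI[of _ _ "inv\<^bsub>free_group X\<^esub> v"]) (simp_all add: lift_inv)
  qed
qed

lemma normal_closure_normal:
  assumes "group G" "S \<subseteq> carrier G" shows "normal_closure G S \<lhd> G"
proof -
  interpret group G by fact
  have sub: "normal_closure G S \<subseteq> carrier G"
    using assms(2) normal_self by (auto simp: normal_closure_def)
  have "subgroup (normal_closure G S) G"
    by (rule subgroupI)
      (use sub in \<open>auto simp: normal_closure_def intro: normal_imp_subgroup[THEN subgroup.one_closed]
        normal_imp_subgroup[THEN subgroup.m_inv_closed] normal_imp_subgroup[THEN subgroup.m_closed]\<close>)
  then show ?thesis
    unfolding normal_inv_iff by (auto simp: normal_closure_def normal_inv_iff)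
qed

lemma subset_normal_closure: "S \<subseteq> normal_closure G S"
  by (auto simp: normal_closure_def)

text \<open>The kernel of the lift is a normal subgroup containing all relators, hence their normal
  closure.\<close>

lemma lift_normal_closure:
  assumes R: "\<And>r. r \<in> R \<Longrightarrow> set_pword r \<subseteq> X" "\<And>r. r \<in> R \<Longrightarrow> ev f r = 1"
    and w: "w \<in> normal_closure (free_group X) (word_val X ` R)"
  shows "lift f w = 1"
proof -
  interpret group "free_group X" by (rule group_free_group)
  define N where "N = {w \<in> carrier (free_group X). lift f w = 1}"
  have "subgroup N (free_group X)"
    by (rule subgroupI) (auto simp: N_def lift_one lift_inv lift_mult intro!: exI[of _ "\<one>\<^bsub>free_group X\<^esub>"])
  then have "N \<lhd> free_group X"
    unfolding normal_inv_iff by (auto simp: N_def lift_inv lift_mult)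
  moreover have "word_val X ` R \<subseteq> N"
    using R by (auto simp: N_def word_val_closed lift_word_val)
  ultimately show ?thesis using w by (auto simp: normal_closure_def N_def)
qed

text \<open>The presented group acts on itself by right multiplication; this makes it a group of bijections, to which
  \<open>bound\<close> applies.\<close>

theorem presentation_criterion:
  fixes X :: "'x set" and R :: "'x pword set" and f0 :: "'x \<Rightarrow> 'p bij"
  assumes fin: "finite X" "finite R" and R: "\<And>r. r \<in> R \<Longrightarrow> set_pword r \<subseteq> X"
    and H: "group H" "mult H = (\<circ>)" "finite (carrier H)"
    and f0: "\<And>r. r \<in> R \<Longrightarrow> ev f0 r = 1" "app ` gen (f0 ` X) = carrier H"
    and bound: "\<And>f :: 'x \<Rightarrow> 'x letter list set bij. (\<And>r. r \<in> R \<Longrightarrow> ev f r = 1) \<Longrightarrow>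
      finite (gen (f ` X)) \<and> card (gen (f ` X)) \<le> card (carrier H)"
  shows "is_presentation_of X R H"
proof -
  define F where "F = free_group X"
  define N where "N = normal_closure F (word_val X ` R)"
  define Q where "Q = F Mod N"
  define f where "f x = right_mult Q (N #>\<^bsub>F\<^esub> [(x, False)])" for x
  interpret F: group F unfolding F_def by (rule group_free_group)
  interpret N: normal N F
    unfolding N_def by (rule normal_closure_normal) (auto simp: F_def word_val_closed[OF R] group_free_group)
  interpret Q: group Q unfolding Q_def by (rule N.factorgroup_is_group)
  have Q: "N #>\<^bsub>F\<^esub> w \<in> carrier Q" if "w \<in> carrier F" for w
    using that by (auto simp: Q_def FactGroup_def RCOSETS_def)
  have Q_mult: "N #>\<^bsub>F\<^esub> (v \<otimes>\<^bsub>F\<^esub> w) = (N #>\<^bsub>F\<^esub> v) \<otimes>\<^bsub>Q\<^esub> (N #>\<^bsub>F\<^esub> w)"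
    if "v \<in> carrier F" "w \<in> carrier F" for v w
    using that by (simp add: Q_def FactGroup_def N.rcos_sum)
  have Q_one: "\<one>\<^bsub>Q\<^esub> = N" by (simp add: Q_def FactGroup_def)
  have letter: "letter_val f a = right_mult Q (N #>\<^bsub>F\<^esub> [a])" if "fst a \<in> X" for a
  proof (cases "snd a")
    case False
    then show ?thesis by (cases a) (simp add: letter_val_def f_def)
  next
    case True
    then obtain x where a: "a = (x, True)" by (cases a) auto
    have cl: "[(x, b)] \<in> carrier F" for b using that by (auto simp: a F_def intro: singleton_closed)
    have "[(x, False)] \<otimes>\<^bsub>F\<^esub> [(x, True)] = \<one>\<^bsub>F\<^esub>" by (simp add: F_def free_group_def rcons_def linv_def)
    then have "right_mult Q (N #>\<^bsub>F\<^esub> [(x, False)]) * right_mult Q (N #>\<^bsub>F\<^esub> [(x, True)]) = 1"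
      using cl N.subset by (simp add: Q Q.right_mult_one[unfolded Q_one] F.coset_mult_one flip: Q.right_mult_mult Q_mult)
    then show ?thesis by (drule_tac inverse_eq_if_mult_eq_1) (simp add: a letter_val_def f_def)
  qed
  have lift_f: "lift f w = right_mult Q (N #>\<^bsub>F\<^esub> w)" if "w \<in> carrier F" for w
    using that
  proof (induction w)
    case Nil
    have "\<one>\<^bsub>F\<^esub> = []" by (simp add: F_def free_group_def)
    then have "N #>\<^bsub>F\<^esub> [] = N" using F.coset_mult_one[OF N.subset] by simp
    then show ?case using Q.right_mult_one by (simp add: Q_one)
  next
    case (Cons a w)
    then have a: "w \<in> carrier F" "fst a \<in> X" "[a] \<in> carrier F" "a # w = [a] \<otimes>\<^bsub>F\<^esub> w"
      unfolding F_def using tl_closed Cons_eq_mult singleton_closed by blast+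
    have "lift f (a # w) = right_mult Q ((N #>\<^bsub>F\<^esub> [a]) \<otimes>\<^bsub>Q\<^esub> (N #>\<^bsub>F\<^esub> w))"
      using a(1-3) Cons.IH by (simp add: letter Q Q.right_mult_mult)
    then show ?case unfolding a(4) using a(1,3) by (simp only: Q_mult)
  qed
  have lift_f_1: "lift f w = 1 \<longleftrightarrow> w \<in> N" if "w \<in> carrier F" for w
    unfolding lift_f[OF that] Q.right_mult_eq_1_iff[OF Q[OF that]] Q_one
    using that F.coset_join1 F.coset_join2 N.subgroup_axioms N.subset by blast
  have f: "ev f r = 1" if "r \<in> R" for r
  proof -
    have "word_val X r \<in> N" using that subset_normal_closure[of "word_val X ` R" F] unfolding N_def by blast
    then show ?thesis
      using lift_f_1[of "word_val X r"] word_val_closed[OF R[OF that]] lift_word_val[OF R[OF that], of f] by (simp add: F_def)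
  qed
  \<comment> \<open>The product in \<open>H\<close> is composition, opposite to the product of
    bijections; the inverse makes the map a homomorphism again.\<close>
  define \<theta> where "\<theta> w = app (inverse (lift f0 w))" for w
  have range_f0: "lift f0 ` carrier F = gen (f0 ` X)" unfolding F_def by (rule lift_range)
  have "inverse ` gen (f0 ` X) = gen (f0 ` X)"
    by (force intro: image_eqI[of _ inverse "inverse _"])
  then have surj: "\<theta> ` carrier F = carrier H"
    using range_f0 f0(2) by (metis (no_types, lifting) \<theta>_def image_cong image_image)
  have hom: "group_hom F H \<theta>"
  proof (intro group_hom.intro group_hom_axioms.intro homI F.is_group H(1))
    show "\<theta> w \<in> carrier H" if "w \<in> carrier F" for w using that surj by blast
    show "\<theta> (v \<otimes>\<^bsub>F\<^esub> w) = \<theta> v \<otimes>\<^bsub>H\<^esub> \<theta> w" for v w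
      unfolding \<theta>_def F_def lift_mult H(2) by (simp add: app_mult)
  qed
  interpret \<theta>: group_hom F H \<theta> by (rule hom)
  have \<theta>_eq: "\<theta> v = \<theta> w \<longleftrightarrow> lift f0 v = lift f0 w" for v w
    unfolding \<theta>_def app_inject by (metis inverse_inverse_mult)
  \<comment> \<open>The kernel of \<open>lift f\<close> is exactly \<open>N\<close> and that of
    \<open>lift f0\<close> contains \<open>N\<close>, so \<open>lift f0\<close> factors through
    \<open>lift f\<close>.\<close>
  have wd: "lift f0 v = lift f0 w" if "v \<in> carrier F" "w \<in> carrier F" "lift f v = lift f w" for v w
  proof -
    have "lift f (v \<otimes>\<^bsub>F\<^esub> inv\<^bsub>F\<^esub> w) = 1"
      using that by (simp add: F_def lift_mult lift_inv)
    then have "v \<otimes>\<^bsub>F\<^esub> inv\<^bsub>F\<^esub> w \<in> N" using that lift_f_1 by simp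
    then have "lift f0 (v \<otimes>\<^bsub>F\<^esub> inv\<^bsub>F\<^esub> w) = 1"
      unfolding N_def F_def using lift_normal_closure[OF R f0(1)] by blast
    then show ?thesis
      using that by (simp add: F_def lift_mult lift_inv mult_eq_iff_eq_mult_inverse)
  qed
  define T where "T = lift f ` carrier F"
  define g where "g \<tau> = \<theta> (SOME w. w \<in> carrier F \<and> lift f w = \<tau>)" for \<tau>
  have g: "g (lift f w) = \<theta> w" if "w \<in> carrier F" for w
  proof -
    have "(SOME v. v \<in> carrier F \<and> lift f v = lift f w) \<in> carrier F \<and>
      lift f (SOME v. v \<in> carrier F \<and> lift f v = lift f w) = lift f w"
      by (rule someI[of _ w]) (use that in simp)
    then show ?thesis unfolding g_def \<theta>_eq using wd that by blast
  qed
  have T: "finite T" "card T \<le> card (carrier H)"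
    using bound[OF f] unfolding T_def F_def lift_range by blast+
  have gT: "g ` T = carrier H"
    unfolding surj[symmetric] T_def image_image by (rule image_cong) (simp_all add: g)
  \<comment> \<open>\<open>T\<close> is a copy of the presented group and has at most as many
    elements as \<open>H\<close>, so the surjection \<open>g\<close> is injective. This is the only
    use of the bound.\<close>
  have inj: "inj_on g T"
    using T gT card_image_le[OF T(1), of g] by (intro eq_card_imp_inj_on) auto
  have "kernel F H \<theta> = N"
  proof (intro equalityI subsetI)
    fix w assume "w \<in> kernel F H \<theta>"
    then have w: "w \<in> carrier F" "\<theta> w = \<theta> \<one>\<^bsub>F\<^esub>" by (auto simp: kernel_def)
    then have "g (lift f w) = g (lift f \<one>\<^bsub>F\<^esub>)" using g by simp
    then have "lift f w = lift f \<one>\<^bsub>F\<^esub>"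
      using inj w(1) unfolding T_def by (auto dest: inj_onD)
    then show "w \<in> N" using lift_f_1[OF w(1)] by (simp add: F_def lift_one)
  next
    fix w assume w: "w \<in> N"
    then have "lift f0 w = lift f0 \<one>\<^bsub>F\<^esub>"
      using lift_normal_closure[OF R f0(1)] unfolding N_def F_def lift_one by blast
    then have "\<theta> w = \<theta> \<one>\<^bsub>F\<^esub>" by (simp only: \<theta>_eq)
    then show "w \<in> kernel F H \<theta>" using w N.subset by (auto simp: kernel_def)
  qed
  then have "presented_group X R \<cong> H"
    using \<theta>.FactGroup_iso[OF surj] by (simp add: presented_group_def N_def F_def)
  then show ?thesis using fin R by (simp add: is_presentation_of_def)
qed

section \<open>Permutations satisfying the relations\<close>

lemma app_Bij: "bij f \<Longrightarrow> app (Bij f) = f"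
  by (simp add: Bij_inverse)

lemma app_eq_iff [simp]: "app f i = app f j \<longleftrightarrow> i = j"
  using bij_app[of f] by (auto simp: bij_def inj_def)

text \<open>Extended periodically, \<open>c\<close> becomes a sequence along which \<open>f\<close>
  is the shift by one. Injectivity of \<open>c\<close> does not enter, which spares checking it for
  each concrete cycle.\<close>

lemma power_eq_1_if_cycle:
  assumes step: "\<And>j. Suc j < L \<Longrightarrow> app f (c j) = c (Suc j)" and last: "app f (c (L - 1)) = c 0"
    and other: "\<And>i. i \<notin> c ` {..<L} \<Longrightarrow> app f i = i"
  shows "f ^ L = 1"
proof (cases "L = 0")
  case False
  define d where "d j = c (j mod L)" for j
  have d: "app f (d j) = d (Suc j)" for j
  proof (cases "Suc (j mod L) = L")
    case True
    then have "j mod L = L - 1" "Suc j mod L = 0" by (auto simp: mod_Suc)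
    then show ?thesis using last by (simp add: d_def)
  next
    case neq: False
    then have "Suc (j mod L) < L" using mod_less_divisor[of L j] False by linarith
    then show ?thesis using step neq by (simp add: d_def mod_Suc)
  qed
  have dk: "app (f ^ k) (d j) = d (j + k)" for k j
    by (induction k arbitrary: j) (simp_all add: app_mult d)
  have fk: "app (f ^ k) i = i" if "app f i = i" for i k
    by (induction k) (simp_all add: app_mult that)
  show ?thesis
  proof (rule bij_eqI)
    fix i
    show "app (f ^ L) i = app 1 i"
    proof (cases "i \<in> c ` {..<L}")
      case True
      then obtain j where "j < L" "i = d j" by (auto simp: d_def)
      then show ?thesis using dk[of L j] by (simp add: d_def)
    qed (use fk other in simp)
  qed
qed simp

text \<open>The cycle (m m+1 ... m+l-1); the identity if \<open>l\<close> is at most 1.\<close>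

definition cyc :: "nat \<Rightarrow> nat \<Rightarrow> nat bij" where
  "cyc m l = Bij (\<lambda>i. if m \<le> i \<and> Suc i < m + l then Suc i else if m \<le> i \<and> Suc i = m + l then m else i)"

lemma app_cyc:
  "app (cyc m l) i = (if m \<le> i \<and> Suc i < m + l then Suc i else if m \<le> i \<and> Suc i = m + l then m else i)"
proof -
  have "bij (\<lambda>i. if m \<le> i \<and> Suc i < m + l then Suc i else if m \<le> i \<and> Suc i = m + l then m else i)"
    by (rule o_bij[of "\<lambda>i. if m < i \<and> i < m + l then i - 1 else if i = m \<and> 0 < l then m + l - 1 else i"])
      (auto simp: fun_eq_iff)
  then show ?thesis by (simp add: cyc_def app_Bij)
qed

lemma app_cyc_fix: "i < m \<or> m + l \<le> i \<Longrightarrow> app (cyc m l) i = i"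
  by (auto simp: app_cyc)

lemma cyc_power: "cyc m l ^ l = 1"
proof (rule power_eq_1_if_cycle[of _ _ "\<lambda>j. m + j"])
  fix i assume i: "i \<notin> (\<lambda>j. m + j) ` {..<l}"
  have "i \<in> (\<lambda>j. m + j) ` {..<l}" if "m \<le> i" "i < m + l"
    using that by (intro image_eqI[of _ _ "i - m"]) auto
  then show "app (cyc m l) i = i" using i app_cyc_fix[of i m l] by fastforce
qed (auto simp: app_cyc)

lemma app_cyc_power: "j + k < l \<Longrightarrow> app (cyc m l ^ k) (m + j) = m + j + k"
proof (induction k arbitrary: j)
  case (Suc k)
  then show ?case using Suc.IH[of "Suc j"] by (simp add: app_mult app_cyc)
qed simp

lemma cyc_Suc:
  "l > 0 \<Longrightarrow> app (cyc m (Suc l)) = transpose (m + l) m \<circ> app (cyc m l)"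
  by (auto simp: fun_eq_iff app_cyc transpose_def)

lemma permutation_evenperm_cyc: "permutation (app (cyc m l)) \<and> (l > 0 \<longrightarrow> (evenperm (app (cyc m l)) \<longleftrightarrow> odd l))"
proof (induction l)
  case 0
  have "cyc m 0 = 1" by (rule bij_eqI) (auto simp: app_cyc)
  then show ?case by simp
next
  case (Suc l)
  show ?case
  proof (cases "l = 0")
    case True
    then have "cyc m (Suc l) = 1" by (intro bij_eqI) (auto simp: app_cyc)
    then show ?thesis using True by simp
  next
    case False
    then show ?thesis
      using Suc permutation_compose[OF permutation_swap_id[of "m + l" m], of "app (cyc m l)"]
        evenperm_comp[OF permutation_swap_id[of "m + l" m], of "app (cyc m l)"]
      unfolding cyc_Suc[OF False[unfolded neq0_conv], of m] by (simp only: evenperm_swap) auto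
  qed
qed

text \<open>The 3-cycle (x y w), meaningful for distinct entries only.\<close>

definition tc :: "nat \<Rightarrow> nat \<Rightarrow> nat \<Rightarrow> nat bij" where
  "tc x y w = Bij (\<lambda>i. if i = x then y else if i = y then w else if i = w then x else i)"

lemma app_tc:
  assumes "distinct [x, y, w]"
  shows "app (tc x y w) i = (if i = x then y else if i = y then w else if i = w then x else i)"
proof -
  have "bij (\<lambda>i. if i = x then y else if i = y then w else if i = w then x else i)"
    by (rule o_bij[of "\<lambda>i. if i = y then x else if i = w then y else if i = x then w else i"])
      (use assms in \<open>auto simp: fun_eq_iff\<close>)
  then show ?thesis by (simp add: tc_def app_Bij)
qed

lemma tc_rotate: "distinct [x, y, w] \<Longrightarrow> tc x y w = tc y w x"
  by (rule bij_eqI) (auto simp: app_tc)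

lemma tc_cube: "distinct [x, y, w] \<Longrightarrow> tc x y w ^ 3 = 1"
  by (rule bij_eqI) (auto simp: app_tc app_mult power3_eq_cube)

lemma inverse_tc: "distinct [x, y, w] \<Longrightarrow> inverse (tc x y w) = tc y x w"
  by (rule sym, rule inverse_eq_if_mult_eq_1, rule bij_eqI) (auto simp: app_tc app_mult)

lemma conj_by_tc: "distinct [x, y, w] \<Longrightarrow> conj_by (tc x y w) g = tc (app g x) (app g y) (app g w)"
proof -
  assume d: "distinct [x, y, w]"
  have "tc x y w * g = g * tc (app g x) (app g y) (app g w)"
    using d by (intro bij_eqI) (auto simp: app_mult app_tc)
  then show ?thesis by (simp add: conj_by_def mult.assoc)
qed

lemma tc_mult_left: "distinct [x, y, i, j] \<Longrightarrow> inverse (tc x y i) * tc x y j = tc x i j"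
  by (rule bij_eqI) (auto simp: inverse_tc app_mult app_tc)

lemma tc_mult_right: "distinct [x, y, i, j] \<Longrightarrow> tc x y i * inverse (tc x y j) = tc y i j"
  by (rule bij_eqI) (auto simp: inverse_tc app_mult app_tc)

lemma cycle_of_list_tc: "distinct [i, j, k] \<Longrightarrow> cycle_of_list [i, j, k] = app (tc i j k)"
  by (auto simp: fun_eq_iff app_tc transpose_def)

lemma inverse_tc_in_gen:
  assumes "tc x y w \<in> gen S" "distinct [x, y, w]" shows "tc y x w \<in> gen S"
  using gen_inverse[OF assms(1)] inverse_tc[OF assms(2)] by metis

lemma tc_first_in_gen:
  assumes xy: "\<And>w. w \<in> A - {x, y} \<Longrightarrow> tc x y w \<in> gen S" and "x \<noteq> y"
    and ij: "i \<in> A" "j \<in> A" "distinct [x, i, j]"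
  shows "tc x i j \<in> gen S"
proof -
  consider "i = y" | "j = y" "i \<noteq> y" | "i \<noteq> y" "j \<noteq> y" by blast
  then show ?thesis
  proof cases
    case 1
    then show ?thesis using xy[of j] ij by simp
  next
    case 2
    then have "tc y x i = tc x i y" using ij by (intro tc_rotate) auto
    then show ?thesis using inverse_tc_in_gen[OF xy[of i]] ij 2 assms(2) by simp
  next
    case 3
    then have "inverse (tc x y i) * tc x y j = tc x i j" using ij assms(2) by (intro tc_mult_left) auto
    then show ?thesis using gen_mult[OF gen_inverse[OF xy[of i]] xy[of j]] ij 3 by simp
  qed
qed

text \<open>If \<open>x\<close> or \<open>y\<close> occurs, rotation brings it to the front and
  \<open>tc_first_in_gen\<close> applies; otherwise conjugation by (x y i) takes (y j k) to (i j
  k).\<close>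

lemma tc_in_gen:
  assumes xy: "\<And>w. w \<in> A - {x, y} \<Longrightarrow> tc x y w \<in> gen S" and "x \<in> A" "y \<in> A" "x \<noteq> y"
    and ijk: "distinct [i, j, k]" "{i, j, k} \<subseteq> A"
  shows "tc i j k \<in> gen S"
proof -
  have yx: "tc y x w \<in> gen S" if "w \<in> A - {y, x}" for w
    using inverse_tc_in_gen[OF xy, of w] that assms(4) by auto
  have start: "tc x i j \<in> gen S" if "i \<in> A" "j \<in> A" "distinct [x, i, j]" for i j
    using tc_first_in_gen[of A x y S i j] xy that assms(4) by blast
  have start_y: "tc y i j \<in> gen S" if "i \<in> A" "j \<in> A" "distinct [y, i, j]" for i j
    using tc_first_in_gen[of A y x S i j] yx that assms(4) by blast
  show ?thesis
  proof (cases "x \<in> {i, j, k} \<or> y \<in> {i, j, k}")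
    case True
    have first: "tc i j k \<in> gen S" if "distinct [i, j, k]" "{i, j, k} \<subseteq> A" "i \<in> {x, y}" for i j k
      using that start[of j k] start_y[of j k] by auto
    from True consider "i \<in> {x, y}" | "j \<in> {x, y}" | "k \<in> {x, y}" by blast
    then show ?thesis
    proof cases
      case 1
      then show ?thesis using first[OF ijk] by simp
    next
      case 2
      then show ?thesis unfolding tc_rotate[OF ijk(1)] by (intro first) (use ijk in auto)
    next
      case 3
      have "tc k i j = tc i j k" by (rule tc_rotate) (use ijk in auto)
      moreover have "tc k i j \<in> gen S" by (intro first) (use ijk 3 in auto)
      ultimately show ?thesis by simp
    qed
  next
    case False
    then have xy': "x \<noteq> i" "x \<noteq> j" "x \<noteq> k" "y \<noteq> i" "y \<noteq> j" "y \<noteq> k" by simp_all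
    have d: "distinct [y, j, k]" "distinct [x, y, i]"
      using ijk(1) xy' assms(4) by simp_all
    have "app (tc x y i) y = i" "app (tc x y i) j = j" "app (tc x y i) k = k"
      unfolding app_tc[OF d(2)] using xy' ijk(1) assms(4) by auto
    then have "conj_by (tc y j k) (tc x y i) = tc i j k"
      by (simp only: conj_by_tc[OF d(1)])
    moreover have "conj_by (tc y j k) (tc x y i) \<in> gen S"
      by (intro gen_conj_by start_y xy) (use False ijk in auto)
    ultimately show ?thesis by simp
  qed
qed

lemma alt_group_subset_gen:
  assumes tc: "\<And>w. w \<in> {1..n} - {x, y} \<Longrightarrow> tc x y w \<in> gen S" and "x \<in> {1..n}" "y \<in> {1..n}" "x \<noteq> y"
  shows "carrier (alt_group n) \<subseteq> app ` gen S"
proof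
  fix f assume "f \<in> carrier (alt_group n)"
  then have f: "f \<in> generate (alt_group n) (three_cycles n)"
    by (simp add: alt_group_carrier_as_three_cycles)
  have three: "f \<in> app ` gen S" if f: "f \<in> three_cycles n" for f
  proof -
    obtain cs where cs: "cycle cs" "length cs = 3" "set cs \<subseteq> {1..n}" "f = cycle_of_list cs"
      using f by auto
    then obtain i j k where "cs = [i, j, k]" by (auto simp: numeral_3_eq_3 length_Suc_conv)
    then show ?thesis
      using cs cycle_of_list_tc[of i j k] tc_in_gen[OF tc assms(2-4), of i j k] by auto
  qed
  from f show "f \<in> app ` gen S"
  proof induction
    case one
    show ?case unfolding alt_group_one app_one[symmetric] by (intro imageI gen_one)
  next
    case (incl f)
    then show ?case by (rule three)
  next
    case (inv f)
    then have "f \<in> carrier (alt_group n)" using three_cycles_incl by blast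
    moreover obtain g where g: "g \<in> gen S" "f = app g" using three[OF inv] by blast
    ultimately have "inv\<^bsub>alt_group n\<^esub> f = app (inverse g)"
      unfolding app_inverse by (simp only: alt_group_inv_equality)
    then show ?case using g(1) gen_inverse by blast
  next
    case (eng f g)
    then obtain f' g' where "f' \<in> gen S" "g' \<in> gen S" "f = app f'" "g = app g'" by blast
    \<comment> \<open>Composition reverses the product of bijections, hence the exchanged
      factors.\<close>
    then show ?case unfolding alt_group_mult using gen_mult[of g' S f'] app_mult[of g' f'] by (metis imageI)
  qed
qed

lemma gen_permutes:
  assumes "\<And>g. g \<in> S \<Longrightarrow> app g permutes A" and "f \<in> gen S" shows "app f permutes A"
  using assms(2)
proof induction
  case gen_one
  show ?case unfolding app_one by (rule permutes_id)
next
  case (gen_mult x y)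
  show ?case unfolding app_mult using gen_mult.IH by (rule permutes_compose)
next
  case (gen_inverse x)
  show ?case unfolding app_inverse using gen_inverse.IH by (rule permutes_inv)
qed (rule assms(1))

lemma permutation_evenperm_app_mult:
  assumes "permutation (app f)" "permutation (app g)"
  shows "permutation (app (f * g)) \<and> (evenperm (app (f * g)) \<longleftrightarrow> (evenperm (app f) \<longleftrightarrow> evenperm (app g)))"
  unfolding app_mult using permutation_compose[OF assms(2,1)] evenperm_comp[OF assms(2,1)] by blast

lemma gen_evenperm:
  assumes "\<And>g. g \<in> S \<Longrightarrow> permutation (app g) \<and> evenperm (app g)" and "f \<in> gen S"
  shows "permutation (app f) \<and> evenperm (app f)"
  using assms(2)
proof induction
  case gen_one
  show ?case unfolding app_one by (intro conjI permutation_id) simp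
next
  case (gen_mult x y)
  then show ?case using permutation_evenperm_app_mult by blast
next
  case (gen_inverse x)
  then show ?case unfolding app_inverse using permutation_inverse evenperm_inv by blast
qed (rule assms(1))

lemma evenperm_if_odd_power:
  assumes f: "permutation (app f)" and k: "f ^ k = 1" "odd k"
  shows "evenperm (app f)"
proof (rule ccontr)
  assume odd: "\<not> evenperm (app f)"
  have "permutation (app (f ^ j)) \<and> (evenperm (app (f ^ j)) \<longleftrightarrow> even j)" for j
  proof (induction j)
    case 0
    show ?case unfolding power_0 app_one by (intro conjI permutation_id) simp
  next
    case (Suc j)
    then show ?case using permutation_evenperm_app_mult[OF f, of "f ^ j"] odd by simp
  qed
  from this[of k] show False using k by simp
qed

lemma gen_eq_alt_group:
  assumes "\<And>w. w \<in> {1..n} - {x, y} \<Longrightarrow> tc x y w \<in> gen S" "x \<in> {1..n}" "y \<in> {1..n}" "x \<noteq> y"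
    and S: "\<And>g. g \<in> S \<Longrightarrow> app g permutes {1..n}" "\<And>g. g \<in> S \<Longrightarrow> evenperm (app g)"
  shows "app ` gen S = carrier (alt_group n)"
proof
  show "app ` gen S \<subseteq> carrier (alt_group n)"
  proof (clarsimp simp: alt_group_carrier)
    fix f assume "f \<in> gen S"
    moreover have "permutation (app g) \<and> evenperm (app g)" if "g \<in> S" for g
      using S that by (auto simp: permutation_permutes)
    ultimately show "app f permutes {Suc 0..n} \<and> evenperm (app f)"
      using gen_permutes[OF S(1)] gen_evenperm by (metis One_nat_def)
  qed
  show "carrier (alt_group n) \<subseteq> app ` gen S"
    using assms(1-4) by (rule alt_group_subset_gen)
qed

lemma gen_eq_sym_group:
  assumes "\<And>w. w \<in> {1..n} - {x, y} \<Longrightarrow> tc x y w \<in> gen S" "x \<in> {1..n}" "y \<in> {1..n}" "x \<noteq> y"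
    and S: "\<And>g. g \<in> S \<Longrightarrow> app g permutes {1..n}" and h: "h \<in> gen S" "\<not> evenperm (app h)"
  shows "app ` gen S = carrier (sym_group n)"
proof
  show "app ` gen S \<subseteq> carrier (sym_group n)"
    using gen_permutes[OF S] by (auto simp: sym_group_carrier)
  have alt: "carrier (alt_group n) \<subseteq> app ` gen S"
    using assms(1-4) by (rule alt_group_subset_gen)
  have hp: "app h permutes {1..n}" using gen_permutes[OF S h(1)] .
  then have h': "permutation (app h)" by (auto simp: permutation_permutes)
  show "carrier (sym_group n) \<subseteq> app ` gen S"
  proof
    fix f assume "f \<in> carrier (sym_group n)"
    then have f: "f permutes {1..n}" by (simp add: sym_group_carrier)
    then have f': "permutation f" by (auto simp: permutation_permutes)
    show "f \<in> app ` gen S"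
    proof (cases "evenperm f")
      case True
      then show ?thesis using f alt by (auto simp: alt_group_carrier)
    next
      case False
      have "app h \<circ> f \<in> carrier (alt_group n)"
        using f hp h(2) False f' h' by (auto simp: alt_group_carrier permutes_compose evenperm_comp)
      then obtain g where g: "g \<in> gen S" "app g = app h \<circ> f" using alt by force
      have "app (g * inverse h) = inv' (app h) \<circ> (app h \<circ> f)"
        by (simp add: app_mult app_inverse g)
      also have "\<dots> = f" using bij_app[of h] by (simp add: o_assoc bij_def)
      finally show ?thesis using g h(1) by (metis gen_inverse gen_mult imageI)
    qed
  qed
qed

text \<open>Chinese remainders: the root is \<open>a ^ i * h ^ j\<close> with \<open>i\<close>
  inverse to \<open>k\<close> modulo \<open>p\<close> and \<open>j\<close> inverse to
  \<open>p\<close> modulo \<open>k\<close>.\<close>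

lemma common_root:
  fixes a h :: "'g::mult_group"
  assumes "a ^ p = 1" "h ^ k = 1" "a * h = h * a" "coprime k p"
  obtains u where "u \<in> gen {a, h}" "u ^ k = a" "u ^ p = h"
proof -
  obtain i where i: "[k * i = 1] (mod p)" using exists_mult_cong_1_nat[OF assms(4)] by blast
  obtain j where j: "[p * j = 1] (mod k)" using exists_mult_cong_1_nat[of p k] assms(4) by (auto simp: coprime_commute)
  have comm: "(a ^ i * h ^ j) ^ n = a ^ (i * n) * h ^ (j * n)" for n
  proof (induction n)
    case (Suc n)
    have "a ^ i * h ^ j * (a ^ (i * n) * h ^ (j * n)) = a ^ i * (h ^ j * a ^ (i * n)) * h ^ (j * n)"
      by (simp add: mult.assoc)
    also have "h ^ j * a ^ (i * n) = a ^ (i * n) * h ^ j"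
      using assms(3) by (metis power_commuting_commutes)
    finally show ?case using Suc by (simp add: mult.assoc power_add)
  qed simp
  have "a ^ (i * k) = a" "h ^ (j * p) = h"
    using power_eq_if_exponents_cong[OF assms(1) i] power_eq_if_exponents_cong[OF assms(2) j] by (simp_all add: mult.commute)
  moreover have "a ^ (i * p) = 1" "h ^ (j * k) = 1"
    using assms(1,2) by (simp_all add: mult.commute[of _ p] mult.commute[of _ k] power_mult)
  ultimately have "(a ^ i * h ^ j) ^ k = a" "(a ^ i * h ^ j) ^ p = h" by (simp_all add: comm)
  moreover have "a ^ i * h ^ j \<in> gen {a, h}" by (intro gen_mult gen_power gen_incl) simp_all
  ultimately show thesis by (rule that[rotated])
qed

lemma tc_mult_square:
  assumes "distinct [x, y, v, w]" shows "(tc x y v * tc x y w) ^ 2 = 1"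
proof -
  have tc: "app (tc x y v) i = (if i = x then y else if i = y then v else if i = v then x else i)"
    "app (tc x y w) i = (if i = x then y else if i = y then w else if i = w then x else i)" for i
    by (rule app_tc; use assms in simp)+
  have "app (tc x y v * tc x y w) i = (if i = x then w else if i = y then v else if i = v then y else if i = w then x else i)" for i
    using assms by (simp add: app_mult tc)
  then show ?thesis using assms by (intro bij_eqI) (simp add: power2_eq_square app_mult[of "_ * _"])
qed

section \<open>The permutations a, b, z and their relations\<close>

locale base_perms =
  fixes p r s \<alpha> \<beta> :: nat
  assumes p: "prime p" "odd p" and r: "residue_primroot p r" and s: "[r * s + 1 = s] (mod p)"
    and \<alpha>\<beta>: "p < \<alpha>" "p < \<beta>" "\<alpha> \<noteq> \<beta>"
begin

lemma p_ge_3: "p \<ge> 3"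
  using odd_prime_ge_3[OF p] .

text \<open>The residue classes modulo \<open>p\<close> are represented by \<open>1, \<dots>, p\<close>.\<close>

definition "lab i = (if i mod p = 0 then p else i mod p)"

lemma lab_bounds: "1 \<le> lab i" "lab i \<le> p"
  using p_ge_3 mod_less_divisor[of p i] by (auto simp: lab_def less_imp_le)

lemma lab_id: "1 \<le> i \<Longrightarrow> i \<le> p \<Longrightarrow> lab i = i"
  by (cases "i = p") (auto simp: lab_def)

lemma lab_cong: "[i = j] (mod p) \<Longrightarrow> lab i = lab j"
  by (simp add: lab_def cong_def)

lemma cong_lab: "[lab i = i] (mod p)"
  by (simp add: lab_def cong_def)

lemma lab_eq_iff: "lab i = lab j \<longleftrightarrow> [i = j] (mod p)"
  by (metis cong_lab cong_sym cong_trans lab_cong)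

lemma lab_cases:
  obtains k where "1 \<le> i" "i \<le> p" "i = lab k" | "i = \<alpha>" | "i = \<beta>" | "i \<notin> {1..p}" "i \<noteq> \<alpha>" "i \<noteq> \<beta>"
proof -
  have "i = lab i" if "i \<in> {1..p}" using that by (simp add: lab_id)
  then show thesis using that by (cases "i \<in> {1..p}") auto
qed

definition "a = cyc 1 p"
definition "z = tc \<alpha> \<beta> p"
definition "b = Bij (\<lambda>i. if 1 \<le> i \<and> i \<le> p then lab (r * i) else if i = \<alpha> then \<beta> else if i = \<beta> then \<alpha> else i)"

lemma coprime_r: "coprime r p"
  using r by (simp add: residue_primroot_def coprime_commute)

lemma app_b: "app b i = (if 1 \<le> i \<and> i \<le> p then lab (r * i) else if i = \<alpha> then \<beta> else if i = \<beta> then \<alpha> else i)"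
proof -
  obtain r' where r': "[r * r' = 1] (mod p)" using exists_mult_cong_1_nat[OF coprime_r] by blast
  have inv: "lab (r' * lab (r * i)) = i" "lab (r * lab (r' * i)) = i" if "1 \<le> i" "i \<le> p" for i
  proof -
    have "[r' * lab (r * i) = r' * (r * i)] (mod p)" "[r * lab (r' * i) = r * (r' * i)] (mod p)"
      by (intro cong_mult cong_refl cong_lab)+
    moreover have "[r' * (r * i) = 1 * i] (mod p)" "[r * (r' * i) = 1 * i] (mod p)"
      using cong_mult[OF r' cong_refl, of i] by (simp_all add: mult_ac)
    ultimately have "lab (r' * lab (r * i)) = lab i" "lab (r * lab (r' * i)) = lab i"
      unfolding lab_eq_iff by (auto intro: cong_trans)
    then show "lab (r' * lab (r * i)) = i" "lab (r * lab (r' * i)) = i"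
      using that by (simp_all add: lab_id)
  qed
  have lab: "lab j \<noteq> \<alpha>" "lab j \<noteq> \<beta>" for j using lab_bounds(2)[of j] \<alpha>\<beta> by auto
  have "bij (\<lambda>i. if 1 \<le> i \<and> i \<le> p then lab (r * i) else if i = \<alpha> then \<beta> else if i = \<beta> then \<alpha> else i)"
    by (rule o_bij[of "\<lambda>i. if 1 \<le> i \<and> i \<le> p then lab (r' * i) else if i = \<alpha> then \<beta> else if i = \<beta> then \<alpha> else i"])
      (use \<alpha>\<beta> inv lab lab_bounds in \<open>auto simp: fun_eq_iff\<close>)
  then show ?thesis by (simp add: b_def app_Bij)
qed

lemma app_b_lab: "app b (lab i) = lab (r * i)"
proof -
  have "lab (r * lab i) = lab (r * i)"
    unfolding lab_eq_iff by (intro cong_mult cong_refl cong_lab)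
  then show ?thesis using lab_bounds[of i] by (simp add: app_b)
qed

lemma app_b_other: "app b \<alpha> = \<beta>" "app b \<beta> = \<alpha>" "i \<notin> {1..p} \<Longrightarrow> i \<noteq> \<alpha> \<Longrightarrow> i \<noteq> \<beta> \<Longrightarrow> app b i = i"
  using \<alpha>\<beta> by (auto simp: app_b)

lemma app_a_lab: "app a (lab i) = lab (i + 1)"
proof (cases "lab i = p")
  case True
  then have "[i = p] (mod p)" using cong_lab[of i] by (simp add: cong_sym)
  then have "[i + 1 = p + 1] (mod p)" by (rule cong_add) simp
  then have "lab (i + 1) = lab (p + 1)" by (rule lab_cong)
  also have "\<dots> = 1" using p_ge_3 by (simp add: lab_def mod_Suc)
  finally show ?thesis using True p_ge_3 by (simp add: a_def app_cyc)
next
  case False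
  then have "app a (lab i) = lab i + 1" using lab_bounds[of i] by (simp add: a_def app_cyc)
  also have "\<dots> = lab (lab i + 1)" using lab_bounds[of i] False by (simp add: lab_id)
  also have "\<dots> = lab (i + 1)" unfolding lab_eq_iff by (intro cong_add cong_lab cong_refl)
  finally show ?thesis .
qed

lemma app_a_power_lab: "app (a ^ n) (lab i) = lab (i + n)"
  by (induction n arbitrary: i) (simp_all add: app_mult app_a_lab)

lemma app_a_power_other: "i \<notin> {1..p} \<Longrightarrow> app (a ^ n) i = i"
  by (induction n) (auto simp: app_mult a_def app_cyc)

lemma app_b_power_lab: "app (b ^ n) (lab i) = lab (r ^ n * i)"
  by (induction n arbitrary: i) (simp_all add: app_mult app_b_lab mult_ac)

lemma app_b_square_other: "i \<notin> {1..p} \<Longrightarrow> app (b ^ 2) i = i"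
  using \<alpha>\<beta> by (auto simp: power2_eq_square app_mult app_b)

lemma distinct_\<alpha>\<beta>: "i \<le> p \<Longrightarrow> distinct [\<alpha>, \<beta>, i]"
  using \<alpha>\<beta> by auto

lemma conj_z_a: "conj_by z (a ^ i) = tc \<alpha> \<beta> (lab i)"
proof -
  have "app (a ^ i) \<alpha> = \<alpha>" "app (a ^ i) \<beta> = \<beta>" using \<alpha>\<beta> by (simp_all add: app_a_power_other)
  moreover have "app (a ^ i) p = lab i"
    using app_a_power_lab[of i p] lab_id[of p] p_ge_3 lab_cong[of "p + i" i] by (simp add: cong_def)
  ultimately show ?thesis unfolding z_def conj_by_tc[OF distinct_\<alpha>\<beta>[OF order_refl]] by simp
qed

lemma conj_z_a_1: "conj_by z a = tc \<alpha> \<beta> 1"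
  using conj_z_a[of 1] lab_id[of 1] p_ge_3 by simp

text \<open>The product is the \<open>p\<close>-cycle (1 r r^2 ... r^(p-2) \<alpha>), with powers
  reduced modulo \<open>p\<close>; it fixes \<open>p\<close> and \<beta>.\<close>

lemma app_b_x_power: "(b * tc \<alpha> \<beta> 1) ^ p = 1"
proof (rule power_eq_1_if_cycle)
  define c where "c j = (if j = p - 1 then \<alpha> else lab (r ^ j))" for j
  have "1 \<le> p" using p_ge_3 by simp
  note tc = app_tc[OF distinct_\<alpha>\<beta>[OF this]]
  have r1: "[r ^ j = 1] (mod p) \<longleftrightarrow> p - 1 dvd j" for j
    using r p(1) ord_divides[of r j p] by (simp add: residue_primroot_def totient_prime)
  have lab1: "lab (r ^ j) = 1 \<longleftrightarrow> p - 1 dvd j" for j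
    using lab_eq_iff[of "r ^ j" 1] lab_id[of 1] r1[of j] p_ge_3 by simp
  have lab: "lab i \<noteq> \<alpha>" "lab i \<noteq> \<beta>" for i using lab_bounds(2)[of i] \<alpha>\<beta> by auto
  show "app (b * tc \<alpha> \<beta> 1) (c j) = c (Suc j)" if "Suc j < p" for j
  proof (cases "j = p - 2")
    case True
    then have "Suc j = p - 1" using p_ge_3 by simp
    moreover have "app b (c j) = 1" using \<open>Suc j = p - 1\<close> lab1[of "Suc j"] by (simp add: c_def app_b_lab flip: power_Suc)
    ultimately show ?thesis using p_ge_3 \<alpha>\<beta> by (simp add: app_mult tc c_def del: One_nat_def)
  next
    case False
    then have "\<not> p - 1 dvd Suc j" using that by (auto dest: dvd_imp_le)
    then have "lab (r ^ Suc j) \<noteq> 1" using lab1[of "Suc j"] by simp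
    moreover have "app b (c j) = lab (r ^ Suc j)"
      using that by (auto simp: c_def app_b_lab)
    moreover have "Suc j \<noteq> p - 1" using False by linarith
    then have "c (Suc j) = lab (r ^ Suc j)" by (simp add: c_def)
    ultimately show ?thesis using lab[of "r ^ Suc j"] by (simp only: app_mult comp_apply tc if_False)
  qed
  show "app (b * tc \<alpha> \<beta> 1) (c (p - 1)) = c 0"
    using p_ge_3 p_ge_3 \<alpha>\<beta> lab1[of 0] by (simp add: app_mult tc c_def app_b_other del: One_nat_def)
  fix i assume i: "i \<notin> c ` {..<p}"
  show "app (b * tc \<alpha> \<beta> 1) i = i"
  proof (cases rule: lab_cases[of i])
    case (1 k)
    have "p dvd k"
    proof (rule ccontr)
      assume k: "\<not> p dvd k"
      then obtain j where j: "j < p - 1" "[k = r ^ j] (mod p)" using residue_primroot_power_cong[OF p(1) r] by blast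
      then have "i = c j" "j < p" using 1 lab_cong[OF j(2)] by (auto simp: c_def)
      then show False using i by blast
    qed
    then have ip: "i = p" using 1 by (simp add: lab_def)
    moreover have "app b p = p" using app_b_lab[of 0] by (simp add: lab_def)
    ultimately show ?thesis using p_ge_3 \<alpha>\<beta> by (simp add: app_mult tc del: One_nat_def)
  next
    case 2
    then have "i = c (p - 1)" by (simp add: c_def)
    then show ?thesis using i p_ge_3 by auto
  next
    case 3
    then show ?thesis using \<alpha>\<beta> p_ge_3 by (simp add: app_mult tc app_b_other del: One_nat_def)
  next
    case 4
    then show ?thesis using p_ge_3 by (auto simp: app_mult tc app_b_other simp del: One_nat_def)
  qed
qed

sublocale rels: base_relations a b z p r s
proof
  show "prime p" "odd p" "residue_primroot p r" "[r * s + 1 = s] (mod p)" by (fact p r s)+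
  have rs: "[r * s = s - 1] (mod p)" using cong_diff_1(2)[OF s] p_ge_3 by simp
  have "a ^ s * b = b * a ^ (s - 1)"
  proof (rule bij_eqI)
    fix i
    show "app (a ^ s * b) i = app (b * a ^ (s - 1)) i"
    proof (cases rule: lab_cases[of i])
      case (1 k)
      have "[r * (k + s) = r * k + (s - 1)] (mod p)"
        using cong_add[OF cong_refl rs, of "r * k"] by (simp add: algebra_simps)
      then show ?thesis unfolding 1(3) app_mult comp_apply app_a_power_lab app_b_lab by (rule lab_cong)
    qed (use \<alpha>\<beta> in \<open>simp_all add: app_mult app_a_power_other app_b_other\<close>)
  qed
  then show "conj_by (a ^ s) b = a ^ (s - 1)"
    by (simp add: conj_by_def mult.assoc)
  have "b ^ (p - 1) = 1"
  proof (rule bij_eqI)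
    fix i
    show "app (b ^ (p - 1)) i = app 1 i"
    proof (cases "i \<in> {1..p}")
      case True
      have "\<not> p dvd r" using coprime_r p(1) by (meson coprime_common_divisor dvd_refl not_prime_unit)
      then have "[r ^ (p - 1) * i = 1 * i] (mod p)"
        using fermat_theorem[OF p(1)] by (intro cong_mult cong_refl) auto
      then show ?thesis using app_b_power_lab[of "p - 1" i] True lab_cong[of "r ^ (p - 1) * i" i] by (simp add: lab_id)
    next
      case False
      \<comment> \<open>Outside 1, ..., \<open>p\<close> the permutation \<open>b\<close> only
        exchanges \<alpha> and \<beta>, so an even exponent undoes it.\<close>
      have "even (p - 1)" using p(2) by simp
      then obtain m where "p - 1 = 2 * m" by blast
      moreover have "app ((b ^ 2) ^ m) i = i"
        by (induction m) (simp_all add: app_mult app_b_square_other[OF False])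
      ultimately show ?thesis by (simp add: power_mult)
    qed
  qed
  then show "a ^ p = b ^ (p - 1)" using cyc_power[of 1 p] by (simp add: a_def)
  note tc_p = app_tc[OF distinct_\<alpha>\<beta>[OF order_refl]]
  have "z * b = b * z ^ 2"
  proof (rule bij_eqI)
    fix i
    have "app b p = p" using app_b_lab[of 0] by (simp add: lab_def)
    moreover have "app b i \<notin> {\<alpha>, \<beta>, p}" if "i \<notin> {\<alpha>, \<beta>, p}"
      using that app_eq_iff[of b i \<alpha>] app_eq_iff[of b i \<beta>] app_eq_iff[of b i p] \<open>app b p = p\<close> app_b_other by auto
    ultimately show "app (z * b) i = app (b * z ^ 2) i"
      using \<alpha>\<beta> by (auto simp: z_def app_mult power2_eq_square tc_p app_b_other)
  qed
  then show "conj_by z b = z ^ 2"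
    by (simp add: conj_by_def mult.assoc)
  show "(z * conj_by z a) ^ 2 = 1"
    unfolding conj_z_a_1 unfolding z_def using \<alpha>\<beta> p_ge_3 by (intro tc_mult_square) simp
  show "(b * conj_by z a) ^ p = z ^ 3"
    unfolding conj_z_a_1 app_b_x_power unfolding z_def using tc_cube[OF distinct_\<alpha>\<beta>[of p]] by simp
qed

lemma b_permutes:
  assumes "{1..p} \<union> {\<alpha>, \<beta>} \<subseteq> A" shows "app b permutes A"
proof -
  have "app b i = i" if "i \<notin> A" for i using assms that by (intro app_b_other(3)) auto
  then show ?thesis using bij_app[of b] unfolding permutes_def bij_iff by blast
qed

end

lemma commute_if_disjoint:
  assumes "\<And>i. app f i = i \<or> app g i = i" shows "f * g = g * f"
proof (rule bij_eqI)
  fix i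
  show "app (f * g) i = app (g * f) i"
  proof (cases "app g i = i")
    case True
    then show ?thesis using assms[of "app f i"] by (auto simp: app_mult)
  next
    case False
    then show ?thesis using assms[of i] assms[of "app g i"] by (auto simp: app_mult)
  qed
qed

lemma app_conj_by_app: "app (conj_by f g) (app g i) = app g (app f i)"
proof -
  have "g * conj_by f g = f * g" by (simp add: conj_by_def mult.assoc)
  then show ?thesis by (metis app_mult comp_apply)
qed

lemma tc_permutes:
  assumes "distinct [x, y, w]" "{x, y, w} \<subseteq> A" shows "app (tc x y w) permutes A"
proof -
  have "app (tc x y w) i = i" if "i \<notin> A" for i using assms(2) that by (auto simp: app_tc[OF assms(1)])
  then show ?thesis using bij_app[of "tc x y w"] unfolding permutes_def bij_iff by blast
qed

lemma cyc_permutes: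
  assumes "\<And>i. m \<le> i \<Longrightarrow> i < m + l \<Longrightarrow> i \<in> A" shows "app (cyc m l) permutes A"
proof -
  have "app (cyc m l) i = i" if "i \<notin> A" for i using assms[of i] that by (intro app_cyc_fix) linarith
  then show ?thesis using bij_app[of "cyc m l"] unfolding permutes_def bij_iff by blast
qed

lemma app_cyc_power_fix: "i < m \<or> m + l \<le> i \<Longrightarrow> app (cyc m l ^ e) i = i"
  by (induction e) (simp_all add: app_mult app_cyc_fix)

lemma cyc_transitive:
  assumes "m \<le> i" "i < m + l" "m \<le> j" "j < m + l"
  obtains e where "app (cyc m l ^ e) i = j"
proof (cases "i \<le> j")
  case True
  then show ?thesis using that[of "j - i"] app_cyc_power[of "i - m" "j - i" l m] assms by simp
next
  case False
  then have "app (cyc m l ^ (i - j)) j = i" using app_cyc_power[of "j - m" "i - j" l m] assms by simp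
  moreover have "cyc m l ^ (i - j) * cyc m l ^ (l - (i - j)) = 1"
    using assms by (simp add: cyc_power flip: power_add)
  then have "app (cyc m l ^ (l - (i - j))) (app (cyc m l ^ (i - j)) j) = j"
    by (metis app_mult app_one comp_apply id_apply)
  ultimately show ?thesis using that by simp
qed

context base_perms begin

text \<open>The cycle type of \<open>b\<close> need not be computed: the product of \<open>b\<close>
  with a 3-cycle has odd order \<open>p\<close>, so both the product and the 3-cycle are
  even.\<close>

lemma evenperm_b: "finite A \<Longrightarrow> {1..p} \<union> {\<alpha>, \<beta>} \<subseteq> A \<Longrightarrow> evenperm (app b)"
proof -
  assume A: "finite A" "{1..p} \<union> {\<alpha>, \<beta>} \<subseteq> A"
  then have b: "permutation (app b)" using b_permutes unfolding permutation_permutes by blast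
  have "app (tc \<alpha> \<beta> 1) permutes A" using A \<alpha>\<beta> p_ge_3 by (intro tc_permutes) auto
  then have x: "permutation (app (tc \<alpha> \<beta> 1))" using A unfolding permutation_permutes by blast
  have "1 \<le> p" using p_ge_3 by simp
  then have "evenperm (app (tc \<alpha> \<beta> 1))"
    by (intro evenperm_if_odd_power[OF x, of 3] tc_cube distinct_\<alpha>\<beta>) simp_all
  moreover have "evenperm (app (b * tc \<alpha> \<beta> 1))"
    using permutation_evenperm_app_mult[OF b x] p(2) app_b_x_power by (intro evenperm_if_odd_power[of _ p]) blast+
  ultimately show "evenperm (app b)" using permutation_evenperm_app_mult[OF b x] by blast
qed

lemma generators_even:
  assumes A: "finite A" "{1..p} \<union> {\<alpha>, \<beta>} \<subseteq> A" and u: "app u permutes A" "u ^ m = 1" "odd m"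
    and g: "g \<in> {u, b, z}"
  shows "app g permutes A" "evenperm (app g)"
proof -
  have z: "app z permutes A" unfolding z_def using A(2) \<alpha>\<beta> p_ge_3 by (intro tc_permutes) auto
  have perm: "permutation (app u)" "permutation (app z)" using u(1) z A(1) unfolding permutation_permutes by blast+
  have "evenperm (app z)"
    by (rule evenperm_if_odd_power[OF perm(2), of 3]) (use rels.z_cube in simp_all)
  moreover have "evenperm (app u)" using evenperm_if_odd_power[OF perm(1) u(2,3)] .
  ultimately show "evenperm (app g)" using g evenperm_b[OF A] by blast
  show "app g permutes A" using g u(1) z b_permutes[OF A(2)] by blast
qed

end

section \<open>Permutation models of the two extended systems\<close>

lemma model_1:
  assumes p: "prime p" "odd p" and r: "residue_primroot p r" and s: "[r * s + 1 = s] (mod p)"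
    and k: "0 < k" "k < p" and n: "n = p + k + 1"
  shows "\<exists>a b z u :: nat bij. relations_1 a b z p r s u k \<and>
    (odd k \<longrightarrow> app ` gen {u, b, z} = carrier (alt_group n)) \<and>
    (even k \<longrightarrow> app ` gen {u, b, z} = carrier (sym_group n))"
proof -
  interpret base_perms p r s "p + k" "Suc (p + k)"
    by unfold_locales (use assms in auto)
  define h where "h = cyc p k"
  have p3: "3 \<le> p" "1 \<le> p" using p_ge_3 by simp_all
  note tc = app_tc[OF distinct_\<alpha>\<beta>[OF order_refl]] app_tc[OF distinct_\<alpha>\<beta>[OF p3(2)]] app_tc[OF distinct_\<alpha>\<beta>[OF p3(2)], unfolded One_nat_def]
  \<comment> \<open>\<open>z\<close> takes \<open>p\<close> to \<alpha>, so the conjugate of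
    \<open>a\<close> is the cycle (1 ... p-1 \<alpha>), disjoint from \<open>h\<close>.\<close>
  have "app (conj_by a z) i = i" if "p \<le> i" "i < p + k" for i
  proof (cases "i = p")
    case True
    then have "i = app z (Suc (p + k))" by (simp add: z_def tc)
    then show ?thesis using app_conj_by_app[of a z "Suc (p + k)"] by (simp add: a_def app_cyc_fix)
  next
    case False
    then have "i = app z i" "app a i = i" using that by (simp_all add: z_def a_def tc app_cyc_fix)
    then show ?thesis using app_conj_by_app[of a z i] by simp
  qed
  then have "app (conj_by a z) i = i \<or> app h i = i" for i
    unfolding h_def using app_cyc_fix[of i p k] by (meson not_le)
  then have comm: "conj_by a z * h = h * conj_by a z" by (rule commute_if_disjoint)
  have ap: "conj_by a z ^ p = 1" using rels.a_order by (simp flip: conj_by_power)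
  have hk: "h ^ k = 1" unfolding h_def by (rule cyc_power)
  have "coprime k p" using p(1) k by (metis coprime_commute nat_dvd_not_less prime_imp_coprime)
  then obtain u where u: "u \<in> gen {conj_by a z, h}" "u ^ k = conj_by a z" "u ^ p = h"
    using common_root[OF ap hk comm] by blast
  have "app (cyc p k) i = i \<or> app (tc (p + k) (Suc (p + k)) 1) i = i" for i
    using p3 k by (cases "i < p \<or> p + k \<le> i") (auto simp: app_cyc_fix tc simp del: One_nat_def)
  then have comm_x: "h * conj_by z a = conj_by z a * h"
    unfolding h_def conj_z_a_1 by (rule commute_if_disjoint)
  have t: "h * a = cyc 1 (p + k - 1)"
    using p3 k by (intro bij_eqI) (auto simp: h_def a_def app_mult app_cyc)
  have "(h * a * z) ^ (p + k + 1) = 1"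
    unfolding t z_def
  proof (rule power_eq_1_if_cycle)
    \<comment> \<open>The cycle is (1 ... p-1 \<alpha> \<beta> p ... p+k-1): composing with
      \<open>z\<close> inserts \<alpha>, \<beta> before \<open>p\<close>. The index \<open>j\<close>
      below inverts this enumeration.\<close>
    define c where "c j = (if j < p - 1 then j + 1 else if j = p - 1 then p + k else if j = p then Suc (p + k) else j - 1)" for j
    show "app (cyc 1 (p + k - 1) * tc (p + k) (Suc (p + k)) p) (c j) = c (Suc j)" if "Suc j < p + k + 1" for j
      using that p3 k by (auto simp: c_def app_mult app_cyc tc)
    show "app (cyc 1 (p + k - 1) * tc (p + k) (Suc (p + k)) p) (c (p + k + 1 - 1)) = c 0"
      using p3 k by (auto simp: c_def app_mult app_cyc tc)
    fix i assume i: "i \<notin> c ` {..<p + k + 1}"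
    define j where "j = (if i = p + k then p - 1 else if i = Suc (p + k) then p else if i < p then i - 1 else i + 1)"
    have "i = c j" "j < p + k + 1" if "1 \<le> i" "i \<le> Suc (p + k)"
      using that p3 k by (auto simp: c_def j_def)
    then have "\<not> (1 \<le> i \<and> i \<le> Suc (p + k))" using i by blast
    then show "app (cyc 1 (p + k - 1) * tc (p + k) (Suc (p + k)) p) i = i"
      using p3 k by (auto simp: app_mult app_cyc tc)
  qed
  moreover have "(h * a) ^ (p + k - 1) = 1" unfolding t by (rule cyc_power)
  ultimately have rels: "relations_1 a b z p r s u k"
    using k comm_x u(2,3) by unfold_locales (simp_all add: conj_by_def mult.assoc)
  have gens: "u \<in> gen {u, b, z}" "z \<in> gen {u, b, z}" by (simp_all add: gen_incl)
  have h_in: "h \<in> gen {u, b, z}" unfolding u(3)[symmetric] using gens by (intro gen_power)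
  have "z * u ^ k * inverse z \<in> gen {u, b, z}" by (intro gen_mult gen_power gen_inverse gens)
  then have a_in: "a \<in> gen {u, b, z}" unfolding u(2) by (simp add: conj_by_def mult.assoc)
  have x_in: "tc (p + k) (Suc (p + k)) w \<in> gen {u, b, z}" if "w \<in> {1..n} - {p + k, Suc (p + k)}" for w
  proof -
    have w: "1 \<le> w" "w < p + k" using that n by auto
    \<comment> \<open>Powers of the long cycle move 1 to any point below \<alpha> and fix \<alpha>,
      \<beta>.\<close>
    then obtain e where e: "app (cyc 1 (p + k - 1) ^ e) 1 = w" by (elim cyc_transitive[rotated -1]) (use k in auto)
    have "conj_by (conj_by z a) ((h * a) ^ e) \<in> gen {u, b, z}"
      by (intro gen_conj_by gen_power gen_mult gens h_in a_in)
    also have "conj_by (conj_by z a) ((h * a) ^ e) = tc (p + k) (Suc (p + k)) w"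
      unfolding conj_z_a_1 t conj_by_tc[OF distinct_\<alpha>\<beta>[OF p3(2)]] e using k by (simp add: app_cyc_power_fix)
    finally show ?thesis .
  qed
  have A: "finite {1..n}" "{1..p} \<union> {p + k, Suc (p + k)} \<subseteq> {1..n}" using n p3 by auto
  have z_perm: "app z permutes {1..n}" unfolding z_def using A(2) p3 k by (intro tc_permutes) auto
  have a_perm: "app a permutes {1..n}" unfolding a_def using n by (intro cyc_permutes) auto
  have "app g permutes {1..n}" if "g \<in> {a, h, z}" for g
    using that a_perm z_perm n p3 by (auto simp: h_def intro!: cyc_permutes)
  then have *: "app g permutes {1..n}" if "g \<in> gen {a, h, z}" for g using gen_permutes that by blast
  have "conj_by a z \<in> gen {a, h, z}" by (rule gen_conj_by) (simp_all add: gen_incl)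
  then have "gen {conj_by a z, h} \<subseteq> gen {a, h, z}" by (intro gen_subset) (simp add: gen_incl)
  then have u_perm: "app u permutes {1..n}" using * u(1) by blast
  have u_order: "u ^ (p * k) = 1" using hk by (simp add: power_mult u(3))
  have base: "p + k \<in> {1..n}" "Suc (p + k) \<in> {1..n}" "p + k \<noteq> Suc (p + k)" using n k by auto
  have "app ` gen {u, b, z} = carrier (alt_group n)" if "odd k"
    using that p(2) by (intro gen_eq_alt_group[OF x_in base] generators_even[OF A u_perm u_order]) auto
  moreover have "app ` gen {u, b, z} = carrier (sym_group n)" if "even k"
  proof (rule gen_eq_sym_group[OF x_in base])
    show "app g permutes {1..n}" if "g \<in> {u, b, z}" for g
      using that u_perm z_perm b_permutes[OF A(2)] by blast
    show "h \<in> gen {u, b, z}" by (rule h_in)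
    show "\<not> evenperm (app h)" unfolding h_def using permutation_evenperm_cyc that k by blast
  qed
  ultimately show ?thesis using rels by blast
qed

lemma model_2:
  assumes p: "prime p" "odd p" and r: "residue_primroot p r" and s: "[r * s + 1 = s] (mod p)"
    and k: "2 \<le> k" "k < p" "5 \<le> p" and n: "n = p + k"
  shows "\<exists>a b z u :: nat bij. relations_2 a b z p r s u k \<and>
    (odd k \<longrightarrow> app ` gen {u, b, z} = carrier (alt_group n)) \<and>
    (even k \<longrightarrow> app ` gen {u, b, z} = carrier (sym_group n))"
proof -
  define \<alpha> \<beta> where \<alpha>_\<beta>: "\<alpha> = Suc p" "\<beta> = Suc (Suc p)"
  interpret base_perms p r s \<alpha> \<beta>
    by unfold_locales (use assms \<alpha>_\<beta> in auto)
  define h where "h = cyc (Suc p) k"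
  have "app a i = i \<or> app h i = i" for i
    unfolding h_def a_def using app_cyc_fix[of i 1 p] app_cyc_fix[of i "Suc p" k] by linarith
  then have comm: "a * h = h * a" by (rule commute_if_disjoint)
  have hk: "h ^ k = 1" unfolding h_def by (rule cyc_power)
  have "coprime k p" using p(1) k by (metis coprime_commute nat_dvd_not_less prime_imp_coprime less_le_trans pos2)
  then obtain u where u: "u \<in> gen {a, h}" "u ^ k = a" "u ^ p = h"
    using common_root[OF rels.a_order hk comm] by blast
  have x: "conj_by z (a ^ i) = tc \<alpha> \<beta> i" if "1 \<le> i" "i \<le> p" for i
    using that by (simp only: conj_z_a lab_id)
  have x': "conj_by z a = tc \<alpha> \<beta> 1" "conj_by z (a ^ 2) = tc \<alpha> \<beta> 2" "conj_by z (a ^ 3) = tc \<alpha> \<beta> 3" "conj_by z (a ^ 4) = tc \<alpha> \<beta> 4"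
    using x[of 1] x[of 2] x[of 3] x[of 4] k by simp_all
  have d: "distinct [\<alpha>, \<beta>, i, j]" if "i < j" "j \<le> p" for i j using that \<alpha>_\<beta> by simp
  have "distinct [\<alpha>, \<beta>, p, 1]" using \<alpha>_\<beta> k by simp
  then have "inverse z * tc \<alpha> \<beta> 1 = tc \<alpha> p 1" "z * inverse (tc \<alpha> \<beta> 1) = tc \<beta> p 1"
    unfolding z_def by (rule tc_mult_left tc_mult_right)+
  moreover have "conj_by (tc \<alpha> p 1) h = tc \<beta> p 1"
    using k \<alpha>_\<beta> by (subst conj_by_tc) (simp_all add: h_def app_cyc)
  ultimately have rel_h: "conj_by (inverse z * conj_by z a) h = z * inverse (conj_by z a)"
    unfolding x' by simp
  have "inverse (tc \<alpha> \<beta> 1) * tc \<alpha> \<beta> 2 = tc \<alpha> 1 2"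
    using k by (intro tc_mult_left d) auto
  then have X: "inverse (conj_by z a) * conj_by z (a ^ 2) = tc \<alpha> 1 2" unfolding x' .
  have d4: "distinct [\<alpha>, 4, 3]" "distinct [\<alpha>, 2, 1]" "distinct [\<alpha>, 1, 2]" "distinct [1, 2, \<alpha>]"
    using k \<alpha>_\<beta> by simp_all
  have tc': "app (tc \<alpha> 4 3) i = (if i = \<alpha> then 4 else if i = 4 then 3 else if i = 3 then \<alpha> else i)"
    "app (tc \<alpha> 2 1) i = (if i = \<alpha> then 2 else if i = 2 then 1 else if i = 1 then \<alpha> else i)" for i
    using app_tc[OF d4(1)] app_tc[OF d4(2)] by auto
  have t_eq: "h * a * tc \<alpha> 4 3 * tc \<alpha> 2 1 = cyc 4 (n - 3)"
  proof (rule bij_eqI)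
    fix i
    consider "i = 0" | "i = 1" | "i = 2" | "i = 3" | "i = p" | "4 \<le> i" "i < p" | "\<alpha> \<le> i" "i < n" | "i = n" | "n < i"
      using \<alpha>_\<beta> by linarith
    then show "app (h * a * tc \<alpha> 4 3 * tc \<alpha> 2 1) i = app (cyc 4 (n - 3)) i"
      by cases (use k n in \<open>simp_all add: app_mult h_def a_def app_cyc tc'[unfolded \<alpha>_\<beta> One_nat_def] \<alpha>_\<beta>\<close>)
  qed
  have x43: "inverse (tc \<alpha> \<beta> 4) * tc \<alpha> \<beta> 3 = tc \<alpha> 4 3" "inverse (tc \<alpha> \<beta> 2) * tc \<alpha> \<beta> 1 = tc \<alpha> 2 1"
    using k \<alpha>_\<beta> by (intro tc_mult_left; simp)+
  have t: "h * a * inverse (conj_by z (a ^ 4)) * conj_by z (a ^ 3) * inverse (conj_by z (a ^ 2)) * conj_by z a = cyc 4 (n - 3)"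
    unfolding x' t_eq[symmetric] x43[symmetric] by (simp only: mult.assoc)
  have tcX: "app (tc \<alpha> 1 2) i = (if i = \<alpha> then 1 else if i = 1 then 2 else if i = 2 then \<alpha> else i)" for i
    by (rule app_tc[OF d4(3)])
  have "(cyc 4 (n - 3) * tc \<alpha> 1 2) ^ (p + k - 1) = 1"
  proof (rule power_eq_1_if_cycle)
    \<comment> \<open>The cycle is (4 ... p 1 2 \<alpha> ... n): composing with (\<alpha> 1 2)
      inserts 1, 2 before \<alpha>. Only 3 is left fixed.\<close>
    define c where "c j = (if j < p - 3 then j + 4 else if j = p - 3 then 1 else if j = p - 2 then 2 else j + 2)" for j
    show "app (cyc 4 (n - 3) * tc \<alpha> 1 2) (c j) = c (Suc j)" if "Suc j < p + k - 1" for j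
    proof -
      consider "j < p - 4" | "j = p - 4" | "j = p - 3" | "j = p - 2" | "p - 2 < j" by linarith
      then show ?thesis
        by cases (use that k n in \<open>auto simp: c_def app_mult app_cyc tcX[unfolded \<alpha>_\<beta> One_nat_def] \<alpha>_\<beta>\<close>)
    qed
    show "app (cyc 4 (n - 3) * tc \<alpha> 1 2) (c (p + k - 1 - 1)) = c 0"
    proof -
      have c: "c (p + k - 1 - 1) = n" "c 0 = 4" using k n by (auto simp: c_def)
      show ?thesis
        unfolding c using k n by (simp add: app_mult app_cyc tcX[unfolded \<alpha>_\<beta> One_nat_def] \<alpha>_\<beta>)
    qed
    fix i assume i: "i \<notin> c ` {..<p + k - 1}"
    define j where "j = (if i = 1 then p - 3 else if i = 2 then p - 2 else if i \<le> p then i - 4 else i - 2)"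
    have "i = c j" "j < p + k - 1" if "1 \<le> i" "i \<le> n" "i \<noteq> 3"
      using that k n by (auto simp: c_def j_def)
    then have "\<not> (1 \<le> i \<and> i \<le> n \<and> i \<noteq> 3)" using i by blast
    then show "app (cyc 4 (n - 3) * tc \<alpha> 1 2) i = i"
      using k n by (auto simp: app_mult app_cyc tcX[unfolded \<alpha>_\<beta> One_nat_def] \<alpha>_\<beta>)
  qed
  moreover have "cyc 4 (n - 3) ^ (p + k - 3) = 1" unfolding n by (rule cyc_power)
  ultimately have rels: "relations_2 a b z p r s u k"
    using k rel_h by unfold_locales (simp_all only: u(2,3) t X)
  have gens: "u \<in> gen {u, b, z}" "z \<in> gen {u, b, z}" by (simp_all add: gen_incl)
  have h_in: "h \<in> gen {u, b, z}" unfolding u(3)[symmetric] using gens by (intro gen_power)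
  have a_in: "a \<in> gen {u, b, z}" unfolding u(2)[symmetric] using gens by (intro gen_power)
  have x_in: "conj_by z a \<in> gen {u, b, z}" "conj_by z (a ^ i) \<in> gen {u, b, z}" for i
    by (intro gen_conj_by gen_power a_in gens)+
  have t_in: "cyc 4 (n - 3) \<in> gen {u, b, z}"
    unfolding t[symmetric] by (intro gen_mult gen_inverse h_in a_in x_in)
  have X_in: "tc \<alpha> 1 2 \<in> gen {u, b, z}"
    unfolding X[symmetric] by (intro gen_mult gen_inverse x_in)
  have w_in: "tc 1 2 w \<in> gen {u, b, z}" if w: "w \<in> {1..n} - {1, 2}" for w
  proof (cases "w = 3")
    case True
    have "distinct [1, 2, 3::nat]" by simp
    note tc3 = app_tc[OF this]
    \<comment> \<open>The long cycle fixes 3, so (1 2 3) is not a conjugate of (\<alpha> 1 2) under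
      its powers and is built as (\<alpha> 1 2) (\<alpha> 3 1).\<close>
    have "distinct [\<alpha>, \<beta>, 3, 1]" using k \<alpha>_\<beta> by simp
    then have "inverse (tc \<alpha> \<beta> 3) * tc \<alpha> \<beta> 1 = tc \<alpha> 3 1" by (rule tc_mult_left)
    moreover have "distinct [\<alpha>, 3, 1]" using k \<alpha>_\<beta> by simp
    then have "app (tc \<alpha> 3 1) i = (if i = \<alpha> then 3 else if i = 3 then 1 else if i = 1 then \<alpha> else i)" for i
      by (rule app_tc)
    then have "tc \<alpha> 1 2 * tc \<alpha> 3 1 = tc 1 2 3"
      using k \<alpha>_\<beta>(1) by (intro bij_eqI) (simp add: app_mult tc3[unfolded One_nat_def] tcX[unfolded \<alpha>_\<beta> One_nat_def] \<alpha>_\<beta>)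
    ultimately have "tc \<alpha> 1 2 * (inverse (conj_by z (a ^ 3)) * conj_by z a) = tc 1 2 w"
      unfolding x' True by simp
    moreover have "tc \<alpha> 1 2 * (inverse (conj_by z (a ^ 3)) * conj_by z a) \<in> gen {u, b, z}"
      by (intro gen_mult gen_inverse x_in X_in)
    ultimately show ?thesis by simp
  next
    case False
    then have "4 \<le> w" "w < 4 + (n - 3)" "4 \<le> \<alpha>" "\<alpha> < 4 + (n - 3)" using w n k \<alpha>_\<beta> by auto
    then obtain e where e: "app (cyc 4 (n - 3) ^ e) \<alpha> = w" by (elim cyc_transitive[rotated -1])
    have "conj_by (tc \<alpha> 1 2) (cyc 4 (n - 3) ^ e) \<in> gen {u, b, z}"
      by (intro gen_conj_by gen_power t_in X_in)
    also have "conj_by (tc \<alpha> 1 2) (cyc 4 (n - 3) ^ e) = conj_by (tc 1 2 \<alpha>) (cyc 4 (n - 3) ^ e)"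
      by (subst tc_rotate) (use d4 in simp_all)
    also have "\<dots> = tc 1 2 w"
      unfolding conj_by_tc[OF d4(4)] e by (simp add: app_cyc_power_fix)
    finally show ?thesis .
  qed
  have A: "finite {1..n}" "{1..p} \<union> {\<alpha>, \<beta>} \<subseteq> {1..n}" using n k \<alpha>_\<beta> by auto
  have z_perm: "app z permutes {1..n}" unfolding z_def using A(2) k \<alpha>_\<beta> by (intro tc_permutes) auto
  have "app g permutes {1..n}" if "g \<in> {a, h}" for g
    using that n by (auto simp: a_def h_def intro!: cyc_permutes)
  then have u_perm: "app u permutes {1..n}" using gen_permutes u(1) by blast
  have u_order: "u ^ (p * k) = 1" using hk by (simp add: power_mult u(3))
  have base: "1 \<in> {1..n}" "2 \<in> {1..n}" "1 \<noteq> (2::nat)" using n k by auto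
  have "app ` gen {u, b, z} = carrier (alt_group n)" if "odd k"
    using that p(2) by (intro gen_eq_alt_group[OF w_in base] generators_even[OF A u_perm u_order]) auto
  moreover have "app ` gen {u, b, z} = carrier (sym_group n)" if "even k"
  proof (rule gen_eq_sym_group[OF w_in base])
    show "app g permutes {1..n}" if "g \<in> {u, b, z}" for g
      using that u_perm z_perm b_permutes[OF A(2)] by blast
    show "h \<in> gen {u, b, z}" by (rule h_in)
    show "\<not> evenperm (app h)" unfolding h_def using permutation_evenperm_cyc[of "Suc p" k] that k by simp
  qed
  ultimately show ?thesis using rels by blast
qed

section \<open>Words and bit-length\<close>

definition npow :: "'x pword \<Rightarrow> nat \<Rightarrow> 'x pword" where "npow w m = Pow w (int m)"
definition winv :: "'x pword \<Rightarrow> 'x pword" where "winv w = Pow w (- 1)"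
definition wconj :: "'x pword \<Rightarrow> 'x pword \<Rightarrow> 'x pword" where "wconj w g = Mul (Mul (winv g) w) g"
definition rel :: "'x pword \<Rightarrow> 'x pword \<Rightarrow> 'x pword" where "rel v w = Mul v (winv w)"

lemma ev_npow [simp]: "ev f (npow w m) = ev f w ^ m"
  by (simp add: npow_def power_int_def)

lemma ev_winv [simp]: "ev f (winv w) = inverse (ev f w)"
  by (simp add: winv_def power_int_def)

lemma ev_wconj [simp]: "ev f (wconj w g) = conj_by (ev f w) (ev f g)"
  by (simp add: wconj_def conj_by_def)

lemma ev_rel: "ev f (rel v w) = 1 \<longleftrightarrow> ev f v = ev f w"
proof
  assume "ev f (rel v w) = 1"
  then have "ev f v * inverse (ev f w) * ev f w = 1 * ev f w" by (simp add: rel_def)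
  then show "ev f v = ev f w" by (simp add: mult.assoc)
qed (simp add: rel_def)

text \<open>Counts letters and exponents together, so that one number controls both the bit-length
  and the number of exponents.\<close>

primrec word_size :: "'x pword \<Rightarrow> nat" where
  "word_size (Gen x) = 1"
| "word_size (Mul v w) = word_size v + word_size w"
| "word_size (Pow w m) = word_size w + 1"

lemma word_size_simps [simp]:
  "word_size (npow w m) = word_size w + 1" "word_size (winv w) = word_size w + 1"
  "word_size (wconj w g) = 2 * word_size g + word_size w + 1" "word_size (rel v w) = word_size v + word_size w + 1"
  by (simp_all add: npow_def winv_def wconj_def rel_def)

lemma exponents_simps [simp]:
  "set (exponents (npow w m)) = insert (int m) (set (exponents w))"
  "set (exponents (winv w)) = insert (- 1) (set (exponents w))"
  "set (exponents (wconj w g)) = insert (- 1) (set (exponents w) \<union> set (exponents g))"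
  "set (exponents (rel v w)) = insert (- 1) (set (exponents v) \<union> set (exponents w))"
  by (auto simp: npow_def winv_def wconj_def rel_def)

lemma set_pword_simps [simp]:
  "set_pword (npow w m) = set_pword w" "set_pword (winv w) = set_pword w"
  "set_pword (wconj w g) = set_pword w \<union> set_pword g" "set_pword (rel v w) = set_pword v \<union> set_pword w"
  by (auto simp: npow_def winv_def wconj_def rel_def)

lemma bl_le:
  assumes "2 \<le> n" "\<forall>m\<in>set (exponents w). \<bar>m\<bar> \<le> int n"
  shows "bl w \<le> real (word_size w) * log 2 (real n)"
  using assms(2)
proof (induction w)
  case (Gen x)
  then show ?case using assms(1) by (simp add: le_log_iff)
next
  case (Mul v w)
  then show ?case by (simp add: distrib_right)
next
  case (Pow w m)
  then have "real_of_int (max 1 \<bar>m\<bar>) \<le> real n" using assms(1) by (simp add: max_def) linarith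
  then have "log 2 (real_of_int (max 1 \<bar>m\<bar>)) \<le> log 2 (real n)" by (simp add: log_le_cancel_iff)
  then show ?case using Pow by (simp add: distrib_right)
qed

lemma length_exponents_le: "length (exponents w) \<le> word_size w"
  by (induction w) auto

text \<open>Listing generators and relations costs 3 + 7 units and each relator at most
  \<open>K\<close> logarithms; \<open>log 2 n\<close> is at least 1 and absorbs the constants. The
  value \<open>K = 100\<close> used later is a generous bound and yields 710 and 700.\<close>

lemma has_short_presentationI:
  fixes ws :: "nat pword list"
  assumes "is_presentation_of {0, 1, 2} (set ws) H" "distinct ws" "length ws = 7" "2 \<le> n"
    and exps: "\<And>w. w \<in> set ws \<Longrightarrow> \<forall>m\<in>set (exponents w). \<bar>m\<bar> \<le> int n"
    and size: "\<And>w. w \<in> set ws \<Longrightarrow> word_size w \<le> K"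
  shows "has_short_presentation (real (10 + 7 * K)) (7 * K) n H"
  unfolding has_short_presentation_def
proof (intro exI conjI)
  let ?L = "log 2 (real n)"
  have L: "1 \<le> ?L" using assms(4) by (simp add: le_log_iff)
  show "is_presentation_of {0, 1, 2} (set ws) H" by fact
  show "card {0, 1, 2::nat} = 3" by simp
  show card: "card (set ws) = 7" using assms(2,3) by (simp add: distinct_card)
  have "(\<Sum>w\<in>set ws. 1 + bl w) \<le> (\<Sum>w\<in>set ws. (1 + real K) * ?L)"
  proof (rule sum_mono)
    fix w assume w: "w \<in> set ws"
    have "bl w \<le> real (word_size w) * ?L" using assms(4) exps[OF w] by (rule bl_le)
    also have "\<dots> \<le> real K * ?L" using size[OF w] L by (intro mult_right_mono) auto
    finally show "1 + bl w \<le> (1 + real K) * ?L" using L by (simp add: distrib_right)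
  qed
  also have "\<dots> = 7 * (1 + real K) * ?L" using card by simp
  finally have "bit_length {0, 1, 2::nat} (set ws) \<le> 3 + 7 * (1 + real K) * ?L" by (simp add: bit_length_def)
  also have "\<dots> \<le> real (10 + 7 * K) * ?L" using L by (simp add: algebra_simps)
  finally show "bit_length {0, 1, 2::nat} (set ws) \<le> real (10 + 7 * K) * ?L" .
  have "num_exponents (set ws) \<le> (\<Sum>w\<in>set ws. K)"
    unfolding num_exponents_def by (intro sum_mono order_trans[OF length_exponents_le size])
  then show "num_exponents (set ws) \<le> 7 * K" using card by simp
  show "\<forall>w\<in>set ws. \<forall>m\<in>set (exponents w). \<bar>m\<bar> \<le> int n" using exps by blast
qed

text \<open>\<open>A\<close> stands for \<open>a\<close>, which is no generator: it will be a word
  in \<open>u\<close>, conjugated by \<open>z\<close> in the first construction. This keeps the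
  number of generators at three.\<close>

definition base_words :: "nat \<Rightarrow> nat \<Rightarrow> nat pword \<Rightarrow> nat pword list" where
  "base_words p s A =
    [rel (wconj (npow A s) (Gen 1)) (npow A (s - 1)),
     rel (npow A p) (npow (Gen 1) (p - 1)),
     rel (wconj (Gen 2) (Gen 1)) (npow (Gen 2) 2),
     npow (Mul (Gen 2) (wconj (Gen 2) A)) 2,
     rel (npow (Mul (Gen 1) (wconj (Gen 2) A)) p) (npow (Gen 2) 3)]"

text \<open>The generators \<open>0\<close>, \<open>1\<close>, \<open>2\<close> stand for \<open>u\<close>, \<open>b\<close>, \<open>z\<close>.\<close>

definition words_1 :: "nat \<Rightarrow> nat \<Rightarrow> nat \<Rightarrow> nat pword list" where
  "words_1 p k s =
    (let A = Mul (Mul (Gen 2) (npow (Gen 0) k)) (winv (Gen 2)); H = npow (Gen 0) p; X = wconj (Gen 2) A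
     in base_words p s A @
       [rel (Mul H X) (Mul X H),
        rel (npow (Mul (Mul H A) (Gen 2)) (p + k + 1)) (npow (Mul H A) (p + k - 1))])"

definition words_2 :: "nat \<Rightarrow> nat \<Rightarrow> nat \<Rightarrow> nat pword list" where
  "words_2 p k s =
    (let A = npow (Gen 0) k; H = npow (Gen 0) p; X = (\<lambda>i. wconj (Gen 2) (npow A i)); X1 = wconj (Gen 2) A;
       T = Mul (Mul (Mul (Mul (Mul H A) (winv (X 4))) (X 3)) (winv (X 2))) X1
     in base_words p s A @
       [rel (wconj (Mul (winv (Gen 2)) X1) H) (Mul (Gen 2) (winv X1)),
        rel (npow (Mul T (Mul (winv X1) (X 2))) (p + k - 1)) (npow T (p + k - 3))])"

lemmas word_defs = words_1_def words_2_def base_words_def Let_def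

lemma base_words_iff:
  assumes "prime p" "odd p" "residue_primroot p r" "[r * s + 1 = s] (mod p)"
  shows "(\<forall>w\<in>set (base_words p s A). ev f w = 1) \<longleftrightarrow> base_relations (ev f A) (f 1) (f 2) p r s"
  using assms by (simp add: base_words_def base_relations_def ev_rel)

lemma words_1_iff:
  assumes "prime p" "odd p" "residue_primroot p r" "[r * s + 1 = s] (mod p)" "0 < k" "k < p"
  shows "(\<forall>w\<in>set (words_1 p k s). ev f w = 1) \<longleftrightarrow> relations_1 (f 2 * f 0 ^ k * inverse (f 2)) (f 1) (f 2) p r s (f 0) k"
  unfolding words_1_def Let_def set_append ball_Un base_words_iff[OF assms(1-4)] relations_1_def relations_1_axioms_def
  using assms by (simp add: ev_rel)

lemma words_2_iff:
  assumes "prime p" "odd p" "residue_primroot p r" "[r * s + 1 = s] (mod p)" "2 \<le> k" "k < p" "5 \<le> p"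
  shows "(\<forall>w\<in>set (words_2 p k s). ev f w = 1) \<longleftrightarrow> relations_2 (f 0 ^ k) (f 1) (f 2) p r s (f 0) k"
  unfolding words_2_def Let_def set_append ball_Un base_words_iff[OF assms(1-4)] relations_2_def relations_2_axioms_def
  using assms by (simp add: ev_rel)

lemma presentation_from_model:
  fixes ws :: "nat pword list" and u b z :: "nat bij" and P :: "'g::mult_group \<Rightarrow> 'g \<Rightarrow> 'g \<Rightarrow> bool"
  assumes ws: "\<And>w. w \<in> set ws \<Longrightarrow> set_pword w \<subseteq> {0, 1, 2}"
    and model: "\<And>f. f 0 = u \<Longrightarrow> f 1 = b \<Longrightarrow> f 2 = z \<Longrightarrow> \<forall>w\<in>set ws. ev f w = 1"
    and H: "group H" "mult H = (\<circ>)" "finite (carrier H)" "app ` gen {u, b, z} = carrier H"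
    and bound: "\<And>f :: nat \<Rightarrow> nat letter list set bij. \<forall>w\<in>set ws. ev f w = 1 \<Longrightarrow>
      finite (gen {f 0, f 1, f 2}) \<and> card (gen {f 0, f 1, f 2}) \<le> card (carrier H)"
  shows "is_presentation_of {0, 1, 2} (set ws) H"
proof (rule presentation_criterion)
  let ?f = "\<lambda>i::nat. if i = 0 then u else if i = 1 then b else z"
  show "set_pword w \<subseteq> {0, 1, 2}" if "w \<in> set ws" for w using that by (rule ws)
  show "ev ?f w = 1" if "w \<in> set ws" for w using that model[of ?f] by simp
  show "app ` gen (?f ` {0, 1, 2}) = carrier H" using H(4) by (simp add: insert_commute)
  show "finite (gen (f ` {0, 1, 2})) \<and> card (gen (f ` {0, 1, 2})) \<le> card (carrier H)"
    if "\<And>w. w \<in> set ws \<Longrightarrow> ev f w = 1" for f :: "nat \<Rightarrow> nat letter list set bij"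
    using bound[of f] that by simp
qed (use H in auto)

lemma finite_carrier: "finite (carrier (sym_group n))" "finite (carrier (alt_group n))"
  using finite_permutations[of "{1..n}"] by (auto simp: sym_group_def alt_group_def)

text \<open>For odd \<open>k\<close> the generators lie in a Carmichael group, of order at most half
  of \<open>fact n\<close>; for even \<open>k\<close> the bound \<open>fact n\<close> is already
  that of the symmetric group.\<close>

lemma presentation_if_bounds:
  fixes ws :: "nat pword list" and u b z :: "nat bij"
  assumes ws: "\<And>w. w \<in> set ws \<Longrightarrow> set_pword w \<subseteq> {0, 1, 2}" and n: "2 \<le> n"
    and model: "\<And>f. f 0 = u \<Longrightarrow> f 1 = b \<Longrightarrow> f 2 = z \<Longrightarrow> \<forall>w\<in>set ws. ev f w = 1"
    and gens: "odd k \<Longrightarrow> app ` gen {u, b, z} = carrier (alt_group n)"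
      "even k \<Longrightarrow> app ` gen {u, b, z} = carrier (sym_group n)"
    and bound: "\<And>f :: nat \<Rightarrow> nat letter list set bij. \<forall>w\<in>set ws. ev f w = 1 \<Longrightarrow>
      finite (gen {f 0, f 1, f 2}) \<and> card (gen {f 0, f 1, f 2}) \<le> fact n"
    and carmichael: "\<And>f :: nat \<Rightarrow> nat letter list set bij. \<forall>w\<in>set ws. ev f w = 1 \<Longrightarrow> odd k \<Longrightarrow>
      \<exists>V. carmichael {..<n - 2} V \<and> {f 0, f 1, f 2} \<subseteq> gen (V ` {..<n - 2})"
  shows "odd k \<Longrightarrow> is_presentation_of {0, 1, 2} (set ws) (alt_group n)"
    and "even k \<Longrightarrow> is_presentation_of {0, 1, 2} (set ws) (sym_group n)"
proof -
  show "is_presentation_of {0, 1, 2} (set ws) (alt_group n)" if odd: "odd k"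
  proof (rule presentation_from_model[OF ws model alt_group_is_group alt_group_mult finite_carrier(2) gens(1)[OF odd]])
    fix f :: "nat \<Rightarrow> nat letter list set bij"
    assume "\<forall>w\<in>set ws. ev f w = 1"
    then obtain V where V: "carmichael {..<n - 2} V" "{f 0, f 1, f 2} \<subseteq> gen (V ` {..<n - 2})"
      using carmichael[OF _ odd] by blast
    have "n - 2 + 2 = n" using n by simp
    then have "finite (gen (V ` {..<n - 2})) \<and> 2 * card (gen (V ` {..<n - 2})) \<le> 2 * card (carrier (alt_group n))"
      using carmichael_gen_card[OF V(1)] unfolding alt_group_card_carrier[OF n] by simp
    moreover have "gen {f 0, f 1, f 2} \<subseteq> gen (V ` {..<n - 2})" using V(2) by (rule gen_subset)
    ultimately show "finite (gen {f 0, f 1, f 2}) \<and> card (gen {f 0, f 1, f 2}) \<le> card (carrier (alt_group n))"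
      by (meson card_mono finite_subset le_trans mult_le_cancel1 zero_less_numeral nat_mult_le_cancel1)
  qed
  show "is_presentation_of {0, 1, 2} (set ws) (sym_group n)" if even: "even k"
    by (rule presentation_from_model[OF ws model sym_group_is_group sym_group_mult finite_carrier(1) gens(2)[OF even]])
      (use bound in \<open>simp_all add: sym_group_card_carrier\<close>)
qed

lemma presentation_1:
  assumes "prime p" "odd p" "residue_primroot p r" "[r * s + 1 = s] (mod p)" "0 < k" "k < p" "n = p + k + 1"
  shows "odd k \<Longrightarrow> is_presentation_of {0, 1, 2} (set (words_1 p k s)) (alt_group n)"
    and "even k \<Longrightarrow> is_presentation_of {0, 1, 2} (set (words_1 p k s)) (sym_group n)"
proof -
  obtain a b z u :: "nat bij" where m: "relations_1 a b z p r s u k"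
    "odd k \<Longrightarrow> app ` gen {u, b, z} = carrier (alt_group n)" "even k \<Longrightarrow> app ` gen {u, b, z} = carrier (sym_group n)"
    using model_1[OF assms] by blast
  note iff = words_1_iff[OF assms(1-6)]
  have ws: "set_pword w \<subseteq> {0, 1, 2}" if "w \<in> set (words_1 p k s)" for w
    using that by (auto simp: word_defs)
  have model: "\<forall>w\<in>set (words_1 p k s). ev f w = 1" if "f 0 = u" "f 1 = b" "f 2 = z" for f
    unfolding iff that using m(1) relations_1.a_eq[OF m(1)] by simp
  have n: "2 \<le> n" "n - 2 = p + k - 1" using assms by auto
  have bound: "finite (gen {f 0, f 1, f 2}) \<and> card (gen {f 0, f 1, f 2}) \<le> fact n"
    and carmichael: "odd k \<Longrightarrow> \<exists>V. carmichael {..<n - 2} V \<and> {f 0, f 1, f 2} \<subseteq> gen (V ` {..<n - 2})"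
    if "\<forall>w\<in>set (words_1 p k s). ev f w = 1" for f :: "nat \<Rightarrow> nat letter list set bij"
    using relations_1.order_bound[OF that[unfolded iff]] relations_1.carmichael_generators[OF that[unfolded iff]]
    unfolding n(2) unfolding assms(7) by blast+
  show "odd k \<Longrightarrow> is_presentation_of {0, 1, 2} (set (words_1 p k s)) (alt_group n)"
    "even k \<Longrightarrow> is_presentation_of {0, 1, 2} (set (words_1 p k s)) (sym_group n)"
    using presentation_if_bounds[OF ws n(1) model m(2,3) bound carmichael] by blast+
qed

lemma presentation_2:
  assumes "prime p" "odd p" "residue_primroot p r" "[r * s + 1 = s] (mod p)" "2 \<le> k" "k < p" "5 \<le> p" "n = p + k"
  shows "odd k \<Longrightarrow> is_presentation_of {0, 1, 2} (set (words_2 p k s)) (alt_group n)"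
    and "even k \<Longrightarrow> is_presentation_of {0, 1, 2} (set (words_2 p k s)) (sym_group n)"
proof -
  obtain a b z u :: "nat bij" where m: "relations_2 a b z p r s u k"
    "odd k \<Longrightarrow> app ` gen {u, b, z} = carrier (alt_group n)" "even k \<Longrightarrow> app ` gen {u, b, z} = carrier (sym_group n)"
    using model_2[OF assms] by blast
  note iff = words_2_iff[OF assms(1-7)]
  have ws: "set_pword w \<subseteq> {0, 1, 2}" if "w \<in> set (words_2 p k s)" for w
    using that by (auto simp: word_defs)
  have model: "\<forall>w\<in>set (words_2 p k s). ev f w = 1" if "f 0 = u" "f 1 = b" "f 2 = z" for f
    unfolding iff that using m(1) relations_2.a_eq[OF m(1)] by simp
  have n: "2 \<le> n" "n - 2 = p + k - 2" using assms by auto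
  have bound: "finite (gen {f 0, f 1, f 2}) \<and> card (gen {f 0, f 1, f 2}) \<le> fact n"
    and carmichael: "odd k \<Longrightarrow> \<exists>V. carmichael {..<n - 2} V \<and> {f 0, f 1, f 2} \<subseteq> gen (V ` {..<n - 2})"
    if "\<forall>w\<in>set (words_2 p k s). ev f w = 1" for f :: "nat \<Rightarrow> nat letter list set bij"
    using relations_2.order_bound[OF that[unfolded iff]] relations_2.carmichael_generators[OF that[unfolded iff]]
    unfolding n(2) unfolding assms(8) by blast+
  show "odd k \<Longrightarrow> is_presentation_of {0, 1, 2} (set (words_2 p k s)) (alt_group n)"
    "even k \<Longrightarrow> is_presentation_of {0, 1, 2} (set (words_2 p k s)) (sym_group n)"
    using presentation_if_bounds[OF ws n(1) model m(2,3) bound carmichael] by blast+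
qed

text \<open>Relators are compared as syntax trees, so distinctness is settled by their shapes and
  gives exactly seven relations.\<close>

lemma words_distinct:
  "distinct (words_1 p k s)" "length (words_1 p k s) = 7"
  "distinct (words_2 p k s)" "length (words_2 p k s) = 7"
  by (simp_all add: word_defs npow_def rel_def wconj_def winv_def)

lemma word_size_words:
  "w \<in> set (words_1 p k s) \<Longrightarrow> word_size w \<le> 100" "w \<in> set (words_2 p k s) \<Longrightarrow> word_size w \<le> 100"
  by (auto simp: word_defs)

lemma exponents_words_1:
  "w \<in> set (words_1 p k s) \<Longrightarrow> 3 \<le> p \<Longrightarrow> s \<le> p \<Longrightarrow> \<forall>m\<in>set (exponents w). \<bar>m\<bar> \<le> int (p + k + 1)"
  by (auto simp: word_defs)

lemma exponents_words_2:
  "w \<in> set (words_2 p k s) \<Longrightarrow> 5 \<le> p \<Longrightarrow> s \<le> p \<Longrightarrow> \<forall>m\<in>set (exponents w). \<bar>m\<bar> \<le> int (p + k)"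
  by (auto simp: word_defs)

text \<open>A primitive root has order \<open>p - 1\<close>, at least 2, so 1 - r is invertible
  modulo \<open>p\<close>, and \<open>s\<close> is its inverse. Reduction modulo \<open>p\<close>
  keeps this exponent below the degree; the computation uses integers because 1 - r is negative in
  general.\<close>

lemma exists_r_s:
  assumes p: "prime p" "odd p"
  obtains r s where "residue_primroot p r" "[r * s + 1 = s] (mod p)" "s \<le> p"
proof -
  obtain r where r: "residue_primroot p r" using prime_primitive_root_exists[OF prime_gt_1_nat[OF p(1)] p(1)] by blast
  have p3: "3 \<le> p" using odd_prime_ge_3[OF p] .
  have "\<not> [r = 1] (mod p)"
  proof
    assume "[r = 1] (mod p)"
    then have "[r ^ 1 = 1] (mod p)" by simp
    then have "ord p r dvd 1" by (simp only: ord_divides)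
    then have "p - 1 dvd 1" using r p by (simp add: residue_primroot_def totient_prime)
    then show False using p3 by simp
  qed
  then have "\<not> int p dvd 1 - int r"
    by (metis cong_iff_dvd_diff cong_int_iff cong_sym of_nat_1)
  then have "coprime (1 - int r) (int p)"
    using p(1) by (metis coprime_commute prime_imp_coprime prime_nat_int_transfer)
  then obtain c where c: "[(1 - int r) * c = 1] (mod int p)" using cong_solve_coprime_int by blast
  define s where "s = nat (c mod int p)"
  have s: "int s = c mod int p" "s \<le> p"
    using p3 by (simp_all add: s_def nat_le_iff less_imp_le)
  have "[(1 - int r) * int s = (1 - int r) * c] (mod int p)"
    unfolding s by (intro cong_mult cong_refl) simp
  then have "[(1 - int r) * int s = 1] (mod int p)" using c by (rule cong_trans)
  then have "[(1 - int r) * int s + int r * int s = 1 + int r * int s] (mod int p)"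
    by (intro cong_add cong_refl)
  then have "[int s = int (r * s + 1)] (mod int p)" by (simp add: algebra_simps)
  then have "[r * s + 1 = s] (mod p)" unfolding cong_int_iff by (rule cong_sym)
  then show thesis using that r s(2) by blast
qed

lemma short_presentation_1:
  assumes p: "prime p" "odd p" and k: "0 < k" "k < p" and n: "n = p + k + 1"
  shows "odd k \<Longrightarrow> has_short_presentation 710 700 n (alt_group n)"
    and "even k \<Longrightarrow> has_short_presentation 710 700 n (sym_group n)"
proof -
  obtain r s where rs: "residue_primroot p r" "[r * s + 1 = s] (mod p)" "s \<le> p" using exists_r_s[OF p] .
  have p3: "3 \<le> p" using odd_prime_ge_3[OF p] .
  have *: "has_short_presentation 710 700 n H" if "is_presentation_of {0, 1, 2} (set (words_1 p k s)) H" for H :: "(nat \<Rightarrow> nat) monoid"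
    using has_short_presentationI[OF that words_distinct(1,2), of n 100] exponents_words_1 word_size_words(1) p3 rs(3)
    unfolding n by (simp del: of_nat_add)
  show "odd k \<Longrightarrow> has_short_presentation 710 700 n (alt_group n)"
    "even k \<Longrightarrow> has_short_presentation 710 700 n (sym_group n)"
    by (rule *; rule presentation_1[OF p rs(1,2) k n]; assumption)+
qed

lemma short_presentation_2:
  assumes p: "prime p" "odd p" and k: "2 \<le> k" "k < p" "5 \<le> p" and n: "n = p + k"
  shows "odd k \<Longrightarrow> has_short_presentation 710 700 n (alt_group n)"
    and "even k \<Longrightarrow> has_short_presentation 710 700 n (sym_group n)"
proof -
  obtain r s where rs: "residue_primroot p r" "[r * s + 1 = s] (mod p)" "s \<le> p" using exists_r_s[OF p] .
  have *: "has_short_presentation 710 700 n H" if "is_presentation_of {0, 1, 2} (set (words_2 p k s)) H" for H :: "(nat \<Rightarrow> nat) monoid"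
    using has_short_presentationI[OF that words_distinct(3,4), of n 100] exponents_words_2 word_size_words(2) k rs(3)
    unfolding n by (simp del: of_nat_add)
  show "odd k \<Longrightarrow> has_short_presentation 710 700 n (alt_group n)"
    "even k \<Longrightarrow> has_short_presentation 710 700 n (sym_group n)"
    by (rule *; rule presentation_2[OF p rs(1,2) k n]; assumption)+
qed

section \<open>Degrees five and six\<close>

text \<open>Here \<open>z = (\<alpha> \<beta> 1)\<close>, and \<open>t\<close> is the product of an \<open>l\<close>-cycle with the transposition \<open>(\<alpha> \<beta>)\<close>, so that \<open>t\<close> inverts the
  orientation of the 3-cycles.\<close>

definition signed_conj :: "'a::mult_group \<Rightarrow> 'a \<Rightarrow> nat \<Rightarrow> 'a" where
  "signed_conj z t j = (if even j then conj_by z (t ^ j) else inverse (conj_by z (t ^ j)))"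

lemma signed_conj_Suc: "signed_conj z t (Suc j) = inverse (conj_by (signed_conj z t j) t)"
  by (simp add: signed_conj_def conj_by_inverse conj_by_conj_by power_Suc2 del: power_Suc)

text \<open>A step conjugates by \<open>t\<close> and inverts; inversion reverses the product, and
  the order of the factors of an involution is immaterial.\<close>

lemma signed_conj_involution_Suc:
  assumes "(signed_conj z t i * signed_conj z t j) ^ 2 = 1"
  shows "(signed_conj z t (Suc i) * signed_conj z t (Suc j)) ^ 2 = 1"
proof -
  define a b where "a = conj_by (signed_conj z t i) t" and "b = conj_by (signed_conj z t j) t"
  have "conj_by ((signed_conj z t i * signed_conj z t j) ^ 2) t = 1" using assms by simp
  then have "(a * b) ^ 2 = 1" unfolding conj_by_power conj_by_mult a_def b_def .
  then have "(b * a) ^ 2 = 1" by (simp only: involution_swap)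
  then have "inverse (b * a) ^ 2 = 1" unfolding inverse_power_mult[symmetric] by simp
  then show ?thesis unfolding signed_conj_Suc a_def[symmetric] b_def[symmetric] inverse_mult_rev .
qed

lemma signed_conj_cube: "z ^ 3 = 1 \<Longrightarrow> signed_conj z t j ^ 3 = 1"
proof -
  assume "z ^ 3 = 1"
  then have "conj_by z (t ^ j) ^ 3 = 1" by (simp flip: conj_by_power)
  then have "inverse (conj_by z (t ^ j)) ^ 3 = 1" unfolding inverse_power_mult[symmetric] by simp
  with \<open>conj_by z (t ^ j) ^ 3 = 1\<close> show ?thesis by (simp add: signed_conj_def)
qed

locale signed_cycle =
  fixes z t :: "'a::mult_group" and l :: nat
  assumes z_cube: "z ^ 3 = 1" and period: "signed_conj z t l = z" and l: "0 < l"
begin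

abbreviation "V \<equiv> signed_conj z t"
abbreviation "N \<equiv> gen (V ` {..<l})"

lemma V_0: "V 0 = z"
  by (simp add: signed_conj_def)

lemma V_in: "V j \<in> N"
proof (induction j rule: less_induct)
  case (less j)
  show ?case
  proof (cases "j < l")
    case False
    have "V (i + l) = V i" for i
      by (induction i) (simp_all add: V_0 period signed_conj_Suc)
    from this[of "j - l"] show ?thesis using less[of "j - l"] False l by simp
  qed (simp add: gen_incl)
qed

lemma N_conj_t: "y \<in> N \<Longrightarrow> conj_by y t \<in> N"
proof (erule gen_normalised[rotated])
  fix x assume "x \<in> V ` {..<l}"
  then obtain j where "x = V j" by blast
  then have "inverse (conj_by x t) \<in> N" using V_in[of "Suc j"] by (simp add: signed_conj_Suc)
  then show "conj_by x t \<in> N" by simp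
qed

lemma t_power_in:
  assumes "(t * z) ^ m = 1" shows "t ^ m \<in> N"
proof -
  have "z \<in> N" using V_in[of 0] by (simp add: V_0)
  then obtain y where "y \<in> N" "t ^ m * y = 1"
    using power_mult_normalised[OF N_conj_t] assms by metis
  then show ?thesis using gen_mult_right_iff[of y _ "t ^ m"] by simp
qed

end

text \<open>Model: \<open>t\<close> = (1 2 3)(4 5), \<open>z\<close> = (4 5 1), and
  \<open>t * z\<close> is a 4-cycle. Modulo \<open>N\<close> the last relation gives
  \<open>t ^ 4 = 1\<close>; with \<open>t ^ 6 = 1\<close> this puts \<open>t ^ 2\<close> in
  \<open>N\<close>, so \<open>N\<close> has index at most 2.\<close>

lemma order_bound_5:
  fixes t z :: "'a::mult_group"
  assumes z: "z ^ 3 = 1" and t: "(t ^ 3) ^ 2 = 1" and period: "conj_by z (t ^ 3) * z = 1"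
    and inv: "(z * inverse (conj_by z t)) ^ 2 = 1" and tz: "(t * z) ^ 4 = 1"
  shows "finite (gen {t, z, 1}) \<and> card (gen {t, z, 1}) \<le> fact 5"
proof -
  have "signed_conj z t 3 = z"
    using inverse_eq_if_mult_eq_1[OF period] by (simp add: signed_conj_def)
  then interpret signed_cycle z t 3 by unfold_locales (use z in simp_all)
  have "(V 0 * V 1) ^ 2 = 1" using inv by (simp add: signed_conj_def)
  then have V: "(V 0 * V 1) ^ 2 = 1" "(V 1 * V 2) ^ 2 = 1" "(V 2 * V 0) ^ 2 = 1"
    using signed_conj_involution_Suc[of z t 0 1] signed_conj_involution_Suc[of z t 1 2] period \<open>signed_conj z t 3 = z\<close>
    by (simp_all add: V_0 numeral_2_eq_2 numeral_3_eq_3)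
  then have "carmichael {..<3} V"
    using signed_conj_cube[OF z, of t] involution_swap[of "V 0" "V 1"] involution_swap[of "V 1" "V 2"] involution_swap[of "V 2" "V 0"]
    by (simp add: carmichael_def numeral_3_eq_3 lessThan_Suc numeral_2_eq_2)
  then have N: "finite N \<and> 2 * card N \<le> fact 5" using carmichael_gen_card[of 3 V] by simp
  have "t ^ 4 * t ^ 2 = 1" using t by (simp flip: power_add power_mult)
  then have "t ^ 4 * t ^ 2 \<in> N" by simp
  then have "t ^ 2 \<in> N" using t_power_in[OF tz] by (simp only: gen_mult_left_iff)
  then have b: "finite (gen (insert t (V ` {..<3}))) \<and> card (gen (insert t (V ` {..<3}))) \<le> 2 * card N"
    using gen_insert_index_2[OF conjunct1[OF N] N_conj_t] by blast
  have "N \<subseteq> gen (insert t (V ` {..<3}))" by (intro gen_mono) blast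
  then have "z \<in> gen (insert t (V ` {..<3}))" using V_in[of 0] unfolding V_0 by blast
  then have "gen {t, z, 1} \<subseteq> gen (insert t (V ` {..<3}))" by (intro gen_subset) (simp add: gen_incl)
  then show ?thesis using b N by (meson card_mono finite_subset le_trans)
qed

text \<open>Model: \<open>t\<close> = (1 2 3 4)(5 6), and \<open>t * z\<close> is a 5-cycle. Modulo
  \<open>N\<close> the last relation gives \<open>t ^ 5 = 1\<close>, and since
  \<open>t ^ 4 = 1\<close>, \<open>t\<close> itself is in \<open>N\<close>.\<close>

lemma order_bound_6:
  fixes t z :: "'a::mult_group"
  assumes z: "z ^ 3 = 1" and t: "t ^ 4 = 1" and inv: "(z * inverse (conj_by z t)) ^ 2 = 1"
    and inv2: "(z * conj_by z (t ^ 2)) ^ 2 = 1" and tz: "(t * z) ^ 5 = 1"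
  shows "finite (gen {t, z, 1}) \<and> 2 * card (gen {t, z, 1}) \<le> fact 6"
proof -
  have period: "signed_conj z t 4 = z"
    using t by (simp add: signed_conj_def)
  then interpret signed_cycle z t 4 by unfold_locales (use z in simp_all)
  have "(V 0 * V 1) ^ 2 = 1" "(V 0 * V 2) ^ 2 = 1" using inv inv2 by (simp_all add: signed_conj_def)
  then have V: "(V 0 * V 1) ^ 2 = 1" "(V 1 * V 2) ^ 2 = 1" "(V 2 * V 3) ^ 2 = 1" "(V 3 * V 0) ^ 2 = 1"
     "(V 0 * V 2) ^ 2 = 1" "(V 1 * V 3) ^ 2 = 1"
    using signed_conj_involution_Suc[of z t 0 1] signed_conj_involution_Suc[of z t 1 2] signed_conj_involution_Suc[of z t 2 3]
      signed_conj_involution_Suc[of z t 0 2] period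
    by (simp_all add: V_0 eval_nat_numeral)
  then have "carmichael {..<4} V"
    using signed_conj_cube[OF z, of t] V[THEN iffD1[OF involution_swap]]
    by (simp add: carmichael_def eval_nat_numeral lessThan_Suc)
  then have N: "finite N \<and> 2 * card N \<le> fact 6" using carmichael_gen_card[of 4 V] by simp
  have "t ^ 5 = t" using t by (simp add: eval_nat_numeral)
  then have "t \<in> N" using t_power_in[OF tz] by simp
  then have "gen {t, z, 1} \<subseteq> N" using V_in[of 0] by (intro gen_subset) (simp add: V_0)
  then show ?thesis using N by (meson card_mono finite_subset le_trans mult_le_mono2)
qed

locale signed_cycle_model =
  fixes l :: nat
  assumes l: "3 \<le> l"
begin

definition "t = cyc 1 l * cyc (Suc l) 2"
definition "z = tc (Suc l) (Suc (Suc l)) 1"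

lemma app_t: "app t i = (if 1 \<le> i \<and> i < l then Suc i else if i = l then 1 else if i = Suc l then Suc (Suc l)
    else if i = Suc (Suc l) then Suc l else i)"
  using l by (auto simp: t_def app_mult app_cyc)

lemma distinct_l: "i \<le> l \<Longrightarrow> distinct [Suc l, Suc (Suc l), i]"
  by simp

lemma one_le: "1 \<le> l"
  using l by simp

lemma t_z: "t * z = cyc 1 (Suc l)"
  unfolding z_def using l
  by (intro bij_eqI) (auto simp: app_mult app_t app_cyc app_tc[OF distinct_l[OF one_le], unfolded One_nat_def])

lemma t_z_power: "(t * z) ^ Suc l = 1"
  unfolding t_z by (rule cyc_power)

lemma conj_z_t: "j < l \<Longrightarrow>
    conj_by z (t ^ j) = (if even j then tc (Suc l) (Suc (Suc l)) (Suc j) else tc (Suc (Suc l)) (Suc l) (Suc j))"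
proof (induction j)
  case (Suc j)
  have "conj_by z (t ^ Suc j) = conj_by (conj_by z (t ^ j)) t"
    by (simp add: conj_by_conj_by power_Suc2 del: power_Suc)
  also have "conj_by (tc x y (Suc j)) t = tc (app t x) (app t y) (Suc (Suc j))"
    if "distinct [x, y, Suc j]" for x y
    using that Suc.prems by (simp add: conj_by_tc app_t)
  then have "conj_by (conj_by z (t ^ j)) t =
    (if even (Suc j) then tc (Suc l) (Suc (Suc l)) (Suc (Suc j)) else tc (Suc (Suc l)) (Suc l) (Suc (Suc j)))"
    using Suc by (auto simp: app_t)
  finally show ?case .
qed (simp add: z_def)

lemma z_cube: "z ^ 3 = 1"
  unfolding z_def by (rule tc_cube, rule distinct_l, rule one_le)

lemma conj_z_t_odd: "odd j \<Longrightarrow> j < l \<Longrightarrow> inverse (conj_by z (t ^ j)) = tc (Suc l) (Suc (Suc l)) (Suc j)"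
  by (subst conj_z_t) (simp_all add: inverse_tc)

lemma involutions:
  "(z * inverse (conj_by z t)) ^ 2 = 1" "(z * conj_by z (t ^ 2)) ^ 2 = 1"
proof -
  have 1: "inverse (conj_by z t) = tc (Suc l) (Suc (Suc l)) 2" using conj_z_t_odd[of 1] l by (simp add: numeral_2_eq_2)
  show "(z * inverse (conj_by z t)) ^ 2 = 1" unfolding 1 unfolding z_def using l by (intro tc_mult_square) simp
  have 2: "conj_by z (t ^ 2) = tc (Suc l) (Suc (Suc l)) 3" using conj_z_t[of 2] l by (simp add: numeral_3_eq_3)
  show "(z * conj_by z (t ^ 2)) ^ 2 = 1" unfolding 2 unfolding z_def using l by (intro tc_mult_square) simp
qed

lemma tc_in: "w \<in> {1..l + 2} - {Suc l, Suc (Suc l)} \<Longrightarrow> tc (Suc l) (Suc (Suc l)) w \<in> gen {t, z, 1}"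
proof -
  assume w: "w \<in> {1..l + 2} - {Suc l, Suc (Suc l)}"
  then have j: "w - 1 < l" "w = Suc (w - 1)" by auto
  have "conj_by z (t ^ (w - 1)) \<in> gen {t, z, 1}"
    by (intro gen_conj_by gen_power) (simp_all add: gen_incl)
  then have "inverse (conj_by z (t ^ (w - 1))) \<in> gen {t, z, 1}" by simp
  with \<open>conj_by z (t ^ (w - 1)) \<in> gen {t, z, 1}\<close> show ?thesis
    using j(2) conj_z_t[OF j(1)] conj_z_t_odd[OF _ j(1)] by (cases "even (w - 1)") (simp_all del: gen_inverse_iff)
qed

lemma permutes: "g \<in> {t, z, 1} \<Longrightarrow> app g permutes {1..l + 2}"
proof -
  have "app (cyc 1 l) permutes {1..l + 2}" "app (cyc (Suc l) 2) permutes {1..l + 2}"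
    by (intro cyc_permutes; simp)+
  then have "app t permutes {1..l + 2}" unfolding t_def app_mult by (rule permutes_compose)
  moreover have "app z permutes {1..l + 2}" unfolding z_def using l by (intro tc_permutes) auto
  ultimately show "g \<in> {t, z, 1} \<Longrightarrow> app g permutes {1..l + 2}" using permutes_id[of "{1..l + 2}"] by auto
qed

lemma evenperm_z: "evenperm (app z)"
  using evenperm_if_odd_power[of z 3] z_cube permutes[of z] by (auto simp: permutation_permutes)

lemma evenperm_t: "evenperm (app t) \<longleftrightarrow> even l"
  unfolding t_def using permutation_evenperm_app_mult permutation_evenperm_cyc[of 1 l] permutation_evenperm_cyc[of "Suc l" 2] l
  by auto

lemma base: "Suc l \<in> {1..l + 2}" "Suc (Suc l) \<in> {1..l + 2}" "Suc l \<noteq> Suc (Suc l)"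
  by simp_all

lemma gen_alt: "even l \<Longrightarrow> app ` gen {t, z, 1} = carrier (alt_group (l + 2))"
  using evenperm_z evenperm_t by (intro gen_eq_alt_group[OF tc_in base] permutes) auto

lemma gen_sym: "odd l \<Longrightarrow> app ` gen {t, z, 1} = carrier (sym_group (l + 2))"
  using evenperm_t by (intro gen_eq_sym_group[OF tc_in base, of t] permutes) (auto intro: gen_incl)

end

text \<open>The generators \<open>0\<close>, \<open>1\<close> stand for \<open>t\<close>, \<open>z\<close>; the third generator and the last two relators are padding.\<close>

definition words_5 :: "nat pword list" where
  "words_5 = [npow (Gen 1) 3, npow (npow (Gen 0) 3) 2, Mul (wconj (Gen 1) (npow (Gen 0) 3)) (Gen 1),
    npow (Mul (Gen 1) (winv (wconj (Gen 1) (Gen 0)))) 2, npow (Mul (Gen 0) (Gen 1)) 4, Gen 2, npow (Gen 2) 2]"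

definition words_6 :: "nat pword list" where
  "words_6 = [npow (Gen 1) 3, npow (Gen 0) 4, npow (Mul (Gen 1) (winv (wconj (Gen 1) (Gen 0)))) 2,
    npow (Mul (Gen 1) (wconj (Gen 1) (npow (Gen 0) 2))) 2, npow (Mul (Gen 0) (Gen 1)) 5, Gen 2, npow (Gen 2) 2]"

lemma presentation_5: "is_presentation_of {0, 1, 2} (set words_5) (sym_group 5)"
proof -
  interpret signed_cycle_model 3 by unfold_locales simp
  have app: "app t 1 = 2" "app t 2 = 3" "app t 3 = 1" "app t 4 = 5" "app t 5 = 4" "i \<notin> {1, 2, 3, 4, 5} \<Longrightarrow> app t i = i" for i
    by (auto simp: app_t)
  have t6: "t ^ 6 = t * t * t * (t * t * t)" by (simp add: eval_nat_numeral mult.assoc)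
  have "app (t ^ 6) i = i" for i
  proof -
    consider "i = 1" | "i = 2" | "i = 3" | "i = 4" | "i = 5" | "i \<notin> {1, 2, 3, 4, 5}" by blast
    then show ?thesis by cases (simp_all add: app[unfolded One_nat_def] app_mult t6)
  qed
  then have "t ^ 6 = 1" by (intro bij_eqI) simp
  then have order: "(t ^ 3) ^ 2 = 1" by (simp flip: power_mult)
  have t: "app (t ^ 3) 4 = 5" "app (t ^ 3) 5 = 4" "app (t ^ 3) 1 = 1"
    by (simp_all add: app[unfolded One_nat_def] power3_eq_cube app_mult)
  have z: "z = tc 4 5 1" by (simp add: z_def)
  have "conj_by z (t ^ 3) * z = 1"
    unfolding z using t by (simp add: conj_by_tc) (rule bij_eqI, simp add: app_mult app_tc)
  then have model: "\<forall>w\<in>set words_5. ev f w = 1" if "f 0 = t" "f 1 = z" "f 2 = 1" for f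
    using that[simplified] order z_cube involutions(1) t_z_power by (simp add: words_5_def)
  show ?thesis
  proof (rule presentation_from_model[OF _ model sym_group_is_group sym_group_mult finite_carrier(1)])
    show "app ` gen {t, z, 1} = carrier (sym_group 5)" using gen_sym by simp
    show "finite (gen {f 0, f 1, f 2}) \<and> card (gen {f 0, f 1, f 2}) \<le> card (carrier (sym_group 5))"
      if "\<forall>w\<in>set words_5. ev f w = 1" for f :: "nat \<Rightarrow> nat letter list set bij"
      using that order_bound_5[of "f 1" "f 0"] unfolding sym_group_card_carrier by (simp add: words_5_def)
  qed (auto simp: words_5_def)
qed

lemma presentation_6: "is_presentation_of {0, 1, 2} (set words_6) (alt_group 6)"
proof -
  interpret signed_cycle_model 4 by unfold_locales simp
  have app: "app t 1 = 2" "app t 2 = 3" "app t 3 = 4" "app t 4 = 1" "app t 5 = 6" "app t 6 = 5" "i \<notin> {1, 2, 3, 4, 5, 6} \<Longrightarrow> app t i = i" for i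
    by (auto simp: app_t)
  have "app (t ^ 4) i = i" for i
  proof -
    consider "i = 1" | "i = 2" | "i = 3" | "i = 4" | "i = 5" | "i = 6" | "i \<notin> {1, 2, 3, 4, 5, 6}" by blast
    then show ?thesis by cases (simp_all add: app[unfolded One_nat_def] power4_eq_xxxx app_mult)
  qed
  then have t: "t ^ 4 = 1" by (intro bij_eqI) simp
  have model: "\<forall>w\<in>set words_6. ev f w = 1" if "f 0 = t" "f 1 = z" "f 2 = 1" for f
    using that[simplified] t z_cube involutions t_z_power by (simp add: words_6_def)
  have "2 * card (carrier (alt_group 6)) = fact 6" by (rule alt_group_card_carrier) simp
  note card = this
  show ?thesis
  proof (rule presentation_from_model[OF _ model alt_group_is_group alt_group_mult finite_carrier(2)])
    show "app ` gen {t, z, 1} = carrier (alt_group 6)" using gen_alt by simp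
    show "finite (gen {f 0, f 1, f 2}) \<and> card (gen {f 0, f 1, f 2}) \<le> card (carrier (alt_group 6))"
      if "\<forall>w\<in>set words_6. ev f w = 1" for f :: "nat \<Rightarrow> nat letter list set bij"
      using that order_bound_6[of "f 1" "f 0"] unfolding card[symmetric] by (simp add: words_6_def)
  qed (auto simp: words_6_def)
qed

lemma short_presentation_5: "has_short_presentation 710 700 5 (sym_group 5)"
proof -
  have "has_short_presentation (real (10 + 7 * 100)) (7 * 100) 5 (sym_group 5)"
    by (rule has_short_presentationI[OF presentation_5])
      (auto simp: words_5_def npow_def rel_def wconj_def winv_def)
  then show ?thesis by simp
qed

lemma short_presentation_6: "has_short_presentation 710 700 6 (alt_group 6)"
proof -
  have "has_short_presentation (real (10 + 7 * 100)) (7 * 100) 6 (alt_group 6)"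
    by (rule has_short_presentationI[OF presentation_6])
      (auto simp: words_6_def npow_def rel_def wconj_def winv_def)
  then show ?thesis by simp
qed

section \<open>Bertrand's postulate\<close>

text \<open>Erdos' proof: without primes between \<open>n\<close> and \<open>2 n - 2\<close>, the central binomial coefficient has too few prime
  factors. The sharper upper bound \<open>2 n - 2\<close> costs one factor for the possible prime \<open>2 n - 1\<close>.\<close>

lemma prime_if_no_small_divisor:
  fixes q m :: nat
  assumes "\<forall>d\<in>set [2..<m]. \<not> d dvd q" "q < m * m" "1 < q"
  shows "prime q"
proof (rule ccontr)
  assume "\<not> prime q"
  then obtain d where d: "d dvd q" "d \<noteq> 1" "d \<noteq> q" using assms(3) by (auto simp: prime_nat_iff)
  then obtain e where e: "q = d * e" by blast
  have "d < m \<or> e < m"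
    using assms(2) e mult_le_mono[of m d m e] by linarith
  moreover have "2 \<le> d" "2 \<le> e"
    using d e assms(3) by (cases "d = 0"; cases "e = 0"; cases "e = 1"; simp)+
  ultimately have "d \<in> set [2..<m] \<or> e \<in> set [2..<m]" by auto
  moreover have "d dvd q" "e dvd q" using e by auto
  ultimately show False using assms(1) by blast
qed

lemma prod_primes_dvd:
  fixes x :: nat
  assumes "finite A" "\<And>p. p \<in> A \<Longrightarrow> prime p \<and> p dvd x"
  shows "\<Prod>A dvd x"
  using assms
proof (induction A)
  case (insert p A)
  have "coprime p (\<Prod>A)"
    using insert.prems insert.hyps by (intro prod_coprime_right) (metis insertCI primes_coprime)
  then show ?case using insert by (simp add: divides_mult)
qed simp

text \<open>For \<open>n = 2 * m + 1\<close> the primes above \<open>m + 1\<close> divide the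
  binomial coefficient \<open>c\<close>, which occurs twice in a row with sum
  \<open>2 * 4 ^ m\<close>; the smaller primes are covered by induction.\<close>

lemma primorial_bound: "\<Prod>{p. prime p \<and> p \<le> n} \<le> (4::nat) ^ n"
proof (induction n rule: less_induct)
  case (less n)
  consider "n < 2" | "n = 2" | "n \<ge> 3" "even n" | m where "n \<ge> 3" "n = 2 * m + 1"
    using oddE[of n] by (metis One_nat_def Suc_1 Suc_leI linorder_neqE_nat numeral_3_eq_3)
  then show ?case
  proof cases
    case 1
    then have "{p::nat. prime p \<and> p \<le> n} = {}" by (auto dest: prime_ge_2_nat)
    then show ?thesis by (simp only: prod.empty) simp
  next
    case 2
    then have "{p::nat. prime p \<and> p \<le> n} = {2}" by (auto dest: prime_ge_2_nat)
    then show ?thesis by (simp add: 2)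
  next
    case 3
    have "\<not> prime n" using 3 prime_odd_nat[of n] by auto
    then have "p \<le> n \<longleftrightarrow> p \<le> n - 1" if "prime p" for p
      using that 3(1) by (cases "p = n") auto
    then have "{p. prime p \<and> p \<le> n} = {p. prime p \<and> p \<le> n - 1}" by blast
    then have "\<Prod>{p. prime p \<and> p \<le> n} \<le> 4 ^ (n - 1)"
      using less[of "n - 1"] 3(1) by simp
    also have "\<dots> \<le> (4::nat) ^ n" by (rule power_increasing) auto
    finally show ?thesis .
  next
    case 4
    define B where "B = {p. prime p \<and> m + 1 < p \<and> p \<le> n}"
    define c where "c = (2 * m + 1) choose m"
    have "p dvd c" if "p \<in> B" for p
    proof -
      have p: "prime p" "m + 1 < p" "p \<le> 2 * m + 1" using that 4 by (auto simp: B_def)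
      have "fact m * fact (2 * m + 1 - m) * c = fact (2 * m + 1)"
        unfolding c_def by (rule binomial_fact_lemma) simp
      moreover have "p dvd fact (2 * m + 1)" using p by (simp only: prime_dvd_fact_iff)
      moreover have "\<not> p dvd fact m" "\<not> p dvd fact (2 * m + 1 - m)" using p by (simp_all only: prime_dvd_fact_iff)
      ultimately show ?thesis using p(1) by (metis prime_dvd_mult_iff)
    qed
    then have "\<Prod>B dvd c" by (intro prod_primes_dvd) (auto simp: B_def)
    moreover have "c > 0" by (simp add: c_def)
    ultimately have "\<Prod>B \<le> c" by (rule dvd_imp_le)
    also have "c \<le> 4 ^ m"
    proof -
      have "c + (2 * m + 1 choose (m + 1)) = (\<Sum>k\<in>{m, m + 1}. 2 * m + 1 choose k)" by (simp add: c_def)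
      also have "\<dots> \<le> (\<Sum>k\<le>2 * m + 1. 2 * m + 1 choose k)" by (rule sum_mono2) auto
      also have "\<dots> = 2 * 4 ^ m" by (simp only: choose_row_sum) (simp add: power_mult)
      finally show ?thesis using binomial_symmetric[of m "2 * m + 1"] by (simp add: c_def)
    qed
    finally have B: "\<Prod>B \<le> 4 ^ m" .
    have "{p. prime p \<and> p \<le> n} = {p. prime p \<and> p \<le> m + 1} \<union> B"
      using 4 by (auto simp: B_def)
    then have "\<Prod>{p. prime p \<and> p \<le> n} = \<Prod>{p. prime p \<and> p \<le> m + 1} * \<Prod>B"
      by (simp only:) (rule prod.union_disjoint, auto simp: B_def)
    also have "\<dots> \<le> 4 ^ (m + 1) * 4 ^ m"
      using B less[of "m + 1"] 4 by (intro mult_le_mono) auto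
    also have "\<dots> = (4::nat) ^ n" unfolding 4(2) by (simp flip: power_add)
    finally show ?thesis .
  qed
qed

text \<open>Legendre's formula, cut off at an exponent \<open>K\<close> beyond which all terms
  vanish.\<close>

lemma multiplicity_fact:
  assumes p: "prime p" and n: "n < p ^ Suc K"
  shows "multiplicity p (fact n :: nat) = (\<Sum>k=1..K. n div p ^ k)"
  using n
proof (induction n)
  case (Suc n)
  define M where "M = multiplicity p (Suc n)"
  have "p ^ M \<le> Suc n" unfolding M_def by (rule dvd_imp_le[OF multiplicity_dvd]) simp
  then have "p ^ M < p ^ Suc K" using Suc.prems by linarith
  then have M: "M \<le> K" using prime_gt_1_nat[OF p] by (simp only: power_strict_increasing_iff)
  have "p ^ k dvd Suc n \<longleftrightarrow> k \<le> M" for k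
    unfolding M_def using p prime_gt_1_nat[OF p] by (intro power_dvd_iff_le_multiplicity) auto
  then have "Suc n div p ^ k = n div p ^ k + (if k \<le> M then 1 else 0)" for k
    by (auto simp: div_Suc dvd_eq_mod_eq_0)
  then have "(\<Sum>k=1..K. Suc n div p ^ k) = (\<Sum>k=1..K. n div p ^ k) + (\<Sum>k=1..K. if k \<le> M then 1 else 0)"
    by (simp add: sum.distrib)
  also have "(\<Sum>k=1..K. if k \<le> M then 1 else 0 :: nat) = card {k \<in> {1..K}. k \<le> M}"
    by (simp add: sum.If_cases Int_def)
  also have "{k \<in> {1..K}. k \<le> M} = {1..M}" using M by auto
  finally have "(\<Sum>k=1..K. Suc n div p ^ k) = (\<Sum>k=1..K. n div p ^ k) + M" by simp
  moreover have "multiplicity p (fact (Suc n) :: nat) = M + multiplicity p (fact n :: nat)"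
    using p by (simp add: M_def prime_elem_multiplicity_mult_distrib del: mult_Suc)
  ultimately show ?case using Suc by simp
qed simp

lemma multiplicity_central_binomial:
  assumes p: "prime p" and n: "2 * n < p ^ Suc K"
  shows "multiplicity p (2 * n choose n) + 2 * (\<Sum>k=1..K. n div p ^ k) = (\<Sum>k=1..K. 2 * n div p ^ k)"
proof -
  have "fact n * fact (2 * n - n) * (2 * n choose n) = fact (2 * n)"
    by (rule binomial_fact_lemma) simp
  then have "multiplicity p (fact (2 * n) :: nat) = multiplicity p (fact n * fact n * (2 * n choose n))"
    by simp
  also have "\<dots> = multiplicity p (2 * n choose n) + 2 * multiplicity p (fact n :: nat)"
    using p by (simp add: prime_elem_multiplicity_mult_distrib)
  finally show ?thesis
    using multiplicity_fact[OF p n] multiplicity_fact[OF p, of n K] n by linarith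
qed

text \<open>Each of the \<open>K\<close> terms of Legendre's formula contributes at most 1 to the
  difference.\<close>

lemma prime_power_central_binomial:
  assumes p: "prime p" and n: "p ^ K \<le> 2 * n" "2 * n < p ^ Suc K"
  shows "multiplicity p (2 * n choose n) \<le> K"
proof -
  have "2 * n div p ^ k \<le> 2 * (n div p ^ k) + 1" for k
  proof -
    have "0 < p ^ k" using p prime_gt_0_nat by simp
    then have "2 * n < (2 * (n div p ^ k) + 2) * p ^ k"
      using dividend_less_times_div[of "p ^ k" n] by (simp add: algebra_simps)
    then have "2 * n div p ^ k < 2 * (n div p ^ k) + 2" by (rule less_mult_imp_div_less)
    then show ?thesis by simp
  qed
  then have "(\<Sum>k=1..K. 2 * n div p ^ k) \<le> (\<Sum>k=1..K. 2 * (n div p ^ k) + 1)"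
    by (intro sum_mono)
  also have "\<dots> = 2 * (\<Sum>k=1..K. n div p ^ k) + K"
    by (simp add: sum_distrib_left sum_Suc)
  finally show ?thesis using multiplicity_central_binomial[OF p n(2)] by linarith
qed

lemma prime_power_le_central_binomial:
  assumes p: "prime p" and n: "0 < n"
  shows "p ^ multiplicity p (2 * n choose n) \<le> 2 * n"
    and "2 * n < p ^ 2 \<Longrightarrow> multiplicity p (2 * n choose n) \<le> 1"
proof -
  obtain K where K: "p ^ K \<le> 2 * n" "2 * n < p ^ Suc K"
    using ex_power_ivl1[of p "2 * n"] prime_ge_2_nat[OF p] n by auto
  note * = prime_power_central_binomial[OF p K]
  have "p ^ multiplicity p (2 * n choose n) \<le> p ^ K"
    using * prime_gt_0_nat[OF p] by (intro power_increasing) auto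
  then show "p ^ multiplicity p (2 * n choose n) \<le> 2 * n" using K by linarith
  assume "2 * n < p ^ 2"
  then have "p ^ K < p ^ 2" using K by linarith
  then have "K < 2" using prime_gt_1_nat[OF p] by (simp only: power_strict_increasing_iff)
  then show "multiplicity p (2 * n choose n) \<le> 1" using * by linarith
qed

text \<open>Such a prime divides the factorial of \<open>2 * n\<close> exactly twice and that of
  \<open>n\<close> once; its square exceeds \<open>2 * n\<close>, so there are no further
  terms.\<close>

lemma middle_primes_central_binomial:
  assumes p: "prime p" "3 \<le> p" and n: "2 * n < 3 * p" "p \<le> n"
  shows "multiplicity p (2 * n choose n) = 0"
proof -
  have "3 * p \<le> p * p" using p by simp
  moreover have "p ^ Suc 1 = p * p" by simp
  ultimately have "2 * n < p ^ Suc 1" using n by linarith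
  then have "multiplicity p (2 * n choose n) + 2 * (n div p) = 2 * n div p"
    using multiplicity_central_binomial[OF p(1), of n 1] by simp
  moreover have "n div p = 1" using n by (intro div_nat_eqI) auto
  moreover have "2 * n div p = 2" using n by (intro div_nat_eqI) auto
  ultimately show ?thesis by simp
qed

text \<open>At most \<open>s - 1\<close> primes have square at most \<open>2 * n\<close>, and their
  powers contribute at most \<open>2 * n\<close> each. All others occur once and are at most
  \<open>2 * n div 3\<close>, except possibly \<open>2 * n - 1\<close>, which accounts for the last
  factor \<open>2 * n\<close>.\<close>

lemma central_binomial_bound_if_no_primes:
  assumes n: "n \<ge> 5" and s: "2 * n < (s + 1) ^ 2" "s \<ge> 1" and none: "\<And>p. prime p \<Longrightarrow> n < p \<Longrightarrow> p \<le> 2 * n - 2 \<Longrightarrow> False"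
  shows "2 * n choose n \<le> (2 * n) ^ s * 4 ^ (2 * n div 3)"
proof -
  define N where "N = 2 * n choose n"
  define P where "P = prime_factors N"
  define A where "A = {p. prime p \<and> p ^ 2 \<le> 2 * n}"
  define B where "B = {p. prime p \<and> p \<le> 2 * n div 3}"
  have N: "N > 0" by (simp add: N_def)
  have "p \<le> s" if "p ^ 2 \<le> 2 * n" for p
    using power_less_imp_less_base[of p 2 "s + 1"] that s(1) by linarith
  then have A: "A \<subseteq> {2..s}" by (auto simp: A_def prime_ge_2_nat)
  then have finA: "finite A" and cardA: "card A \<le> s - 1"
    using finite_subset card_mono[OF _ A] by auto
  have finB: "finite B" by (simp add: B_def)
  have P: "prime p" "p dvd N" "multiplicity p N \<noteq> 0" if "p \<in> P" for p
    using that N not_dvd_imp_multiplicity_0[of p N] by (auto simp: P_def prime_factors_multiplicity)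
  have PA: "p ^ multiplicity p N \<le> 2 * n" if "p \<in> P" for p
    using prime_power_le_central_binomial(1)[of p n] P(1)[OF that] n by (simp add: N_def)
  have PB: "p \<in> insert (2 * n - 1) B \<and> multiplicity p N = 1" if "p \<in> P" "p \<notin> A" for p
  proof -
    note p = P[OF that(1)]
    have p2: "2 * n < p ^ 2" using that p(1) by (auto simp: A_def)
    have "multiplicity p N \<le> 1" using prime_power_le_central_binomial(2)[OF p(1) _ p2] n by (simp add: N_def)
    then have m: "multiplicity p N = 1" using p(3) by linarith
    have "p \<noteq> 2" using p2 n by auto
    then have p3: "p \<ge> 3" using prime_ge_2_nat[OF p(1)] by linarith
    have "p \<le> 2 * n" using PA[OF that(1)] m by simp
    moreover have "p \<noteq> 2 * n" using prime_odd_nat[OF p(1)] p3 by auto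
    moreover have "\<not> (n < p \<and> p \<le> 2 * n - 2)" using none p(1) by blast
    ultimately have "p \<le> n \<or> p = 2 * n - 1" by arith
    moreover have "p \<le> 2 * n div 3" if "p \<le> n"
      using middle_primes_central_binomial[OF p(1) p3 _ that] m N_def by fastforce
    ultimately show ?thesis using m p(1) by (auto simp: B_def)
  qed
  have "N = (\<Prod>p\<in>P. p ^ multiplicity p N)"
    unfolding P_def using N by (simp add: prime_factorization_nat)
  also have "\<dots> = (\<Prod>p\<in>P \<inter> A. p ^ multiplicity p N) * (\<Prod>p\<in>P - A. p ^ multiplicity p N)"
    by (rule prod.Int_Diff) (simp add: P_def)
  also have "\<dots> \<le> (2 * n) ^ card (P \<inter> A) * \<Prod>(insert (2 * n - 1) B)"
  proof (rule mult_le_mono)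
    show "(\<Prod>p\<in>P \<inter> A. p ^ multiplicity p N) \<le> (2 * n) ^ card (P \<inter> A)"
      using prod_mono[of "P \<inter> A" "\<lambda>p. p ^ multiplicity p N" "\<lambda>_. 2 * n"] PA by simp
    have "(\<Prod>p\<in>P - A. p ^ multiplicity p N) = \<Prod>(P - A)"
      using PB by (intro prod.cong) auto
    also have "\<dots> \<le> \<Prod>(insert (2 * n - 1) B)"
    proof (rule dvd_imp_le)
      show "\<Prod>(P - A) dvd \<Prod>(insert (2 * n - 1) B)"
        using finB PB by (intro prod_dvd_prod_subset) auto
      show "0 < \<Prod>(insert (2 * n - 1) B)"
        using n by (intro prod_pos) (auto simp: B_def prime_gt_0_nat)
    qed
    finally show "(\<Prod>p\<in>P - A. p ^ multiplicity p N) \<le> \<Prod>(insert (2 * n - 1) B)" .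
  qed
  also have "\<dots> \<le> (2 * n) ^ (s - 1) * (2 * n * 4 ^ (2 * n div 3))"
  proof (rule mult_le_mono)
    have "card (P \<inter> A) \<le> s - 1" using card_mono[OF finA, of "P \<inter> A"] cardA by auto
    then show "(2 * n) ^ card (P \<inter> A) \<le> (2 * n) ^ (s - 1)" using n by (intro power_increasing) auto
    have "2 * n - 1 \<notin> B" using n by (auto simp: B_def)
    then have "\<Prod>(insert (2 * n - 1) B) = (2 * n - 1) * \<Prod>B" using finB by simp
    also have "\<dots> \<le> 2 * n * 4 ^ (2 * n div 3)"
      using primorial_bound[of "2 * n div 3"] by (intro mult_le_mono) (auto simp: B_def)
    finally show "\<Prod>(insert (2 * n - 1) B) \<le> 2 * n * 4 ^ (2 * n div 3)" .
  qed
  also have "\<dots> = (2 * n) ^ s * 4 ^ (2 * n div 3)"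
    using s(2) by (cases s) (simp_all add: mult_ac)
  finally show ?thesis by (simp add: N_def)
qed

lemma exists_floor_sqrt: "\<exists>s. s ^ 2 \<le> m \<and> m < (s + 1) ^ 2" for m :: nat
proof (induction m)
  case (Suc m)
  then obtain s where "s ^ 2 \<le> m" "m < (s + 1) ^ 2" by blast
  then have "s ^ 2 \<le> Suc m \<and> Suc m < (s + 1) ^ 2 \<or> (s + 1) ^ 2 \<le> Suc m \<and> Suc m < (s + 1 + 1) ^ 2"
    by (auto simp: power2_eq_square)
  then show ?case by blast
qed (rule exI[of _ 0], simp)

lemma six_mult_less_power_2: "k \<ge> 6 \<Longrightarrow> 6 * (k + 1) + 2 \<le> (2::nat) ^ k"
  by (induction k rule: dec_induct) auto

text \<open>With \<open>s\<close> the integer square root of \<open>2 * n\<close>, cubing removes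
  the division by 3 and leaves \<open>2 ^ (s ^ 2) \<le> (s + 1) ^ (6 * (s + 1))\<close>. Bounding
  \<open>s + 1\<close> between powers of 2 contradicts this once \<open>s\<close> is at least 64,
  since \<open>six_mult_less_power_2\<close> starts at exponent 6; this explains 2048, half of the
  square of 64.\<close>

lemma prime_between_large:
  fixes n :: nat
  assumes n: "n \<ge> 2048" shows "\<exists>p. prime p \<and> n < p \<and> p \<le> 2 * n - 2"
proof (rule ccontr)
  assume "\<not> ?thesis"
  then have none: "\<And>p. prime p \<Longrightarrow> n < p \<Longrightarrow> p \<le> 2 * n - 2 \<Longrightarrow> False" by blast
  obtain s where s1: "s ^ 2 \<le> 2 * n" and s2: "2 * n < (s + 1) ^ 2"
    using exists_floor_sqrt by blast
  have "64 ^ 2 < (s + 1) ^ 2" using s2 n by simp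
  then have s3: "s \<ge> 64" using power_less_imp_less_base[of 64 2 "s + 1"] by linarith
  have "real (4 ^ n) \<le> real ((2 * n choose n) * (2 * n))"
    using central_binomial_lower_bound[of n] n by (simp add: divide_le_eq mult_ac)
  then have "4 ^ n \<le> (2 * n choose n) * (2 * n)"
    by (simp only: of_nat_le_iff)
  also have "\<dots> \<le> (2 * n) ^ s * 4 ^ (2 * n div 3) * (2 * n)"
    using central_binomial_bound_if_no_primes[OF _ s2 _ none] n s3 by (intro mult_le_mono1) simp
  finally have "4 ^ (2 * n div 3) * 4 ^ (n - 2 * n div 3) \<le> 4 ^ (2 * n div 3) * (2 * n) ^ (s + 1)"
    by (simp add: mult_ac flip: power_add)
  then have "(4::nat) ^ (n - 2 * n div 3) \<le> (2 * n) ^ (s + 1)" by simp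
  then have "((4::nat) ^ (n - 2 * n div 3)) ^ 3 \<le> ((2 * n) ^ (s + 1)) ^ 3" by (rule power_mono) simp
  moreover have "(4::nat) ^ n \<le> (4 ^ (n - 2 * n div 3)) ^ 3"
    unfolding power_mult[symmetric] by (rule power_increasing) auto
  moreover have "(2::nat) ^ (s ^ 2) \<le> 4 ^ n"
    using power_increasing[OF s1, of "2::nat"] by (simp add: power_mult)
  moreover have "((2 * n) ^ (s + 1)) ^ 3 \<le> (((s + 1) ^ 2) ^ (s + 1)) ^ 3"
    using s2 by (intro power_mono) auto
  ultimately have 1: "2 ^ (s ^ 2) \<le> (((s + 1) ^ 2) ^ (s + 1)) ^ 3" by linarith
  obtain k where k: "2 ^ k \<le> s + 1" "s + 1 < 2 ^ (k + 1)"
    using ex_power_ivl1[of 2 "s + 1"] by auto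
  have "2 ^ 6 < (2::nat) ^ (k + 1)" using k s3 by simp
  then have k6: "k \<ge> 6" using power_strict_increasing_iff[of "2::nat" 6 "k + 1"] by simp
  note 1
  also have "(((s + 1) ^ 2) ^ (s + 1)) ^ 3 = (s + 1) ^ (6 * (s + 1))"
    by (simp only: power_mult[symmetric]) (simp add: mult.commute)
  also have "\<dots> \<le> (2 ^ (k + 1)) ^ (6 * (s + 1))" using k(2) by (intro power_mono) auto
  finally have "(2::nat) ^ (s ^ 2) \<le> 2 ^ ((k + 1) * (6 * (s + 1)))"
    by (simp only: power_mult)
  then have "s ^ 2 \<le> (k + 1) * (6 * (s + 1))"
    by (rule power_le_imp_le_exp[rotated]) simp
  moreover have "6 * (k + 1) + 2 \<le> s + 1" using six_mult_less_power_2[OF k6] k(1) by linarith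
  then have "(6 * (k + 1)) * (s + 1) \<le> (s - 1) * (s + 1)" by (intro mult_le_mono1) simp
  moreover have "(s - 1) * (s + 1) < s ^ 2" using s3 by (cases s) (simp_all add: power2_eq_square)
  ultimately show False by (simp add: algebra_simps)
qed

lemma prime_between:
  fixes n :: nat
  assumes n: "n \<ge> 4" shows "\<exists>p. prime p \<and> n < p \<and> p \<le> 2 * n - 2"
proof (cases "n \<ge> 2048")
  case False
  have step: ?thesis if "prime q" "n < q" "q \<le> 2 * n - 2" for q using that by blast
  have primes: "prime (5::nat)" "prime (7::nat)" "prime (11::nat)" "prime (19::nat)" "prime (31::nat)" "prime (59::nat)"
    "prime (113::nat)" by simp_all
  have primes': "prime (223::nat)" "prime (443::nat)" "prime (883::nat)" "prime (1759::nat)" "prime (3511::nat)"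
    using prime_if_no_small_divisor[of 60 3511] prime_if_no_small_divisor[of 42 1759] prime_if_no_small_divisor[of 30 883]
      prime_if_no_small_divisor[of 22 443] prime_if_no_small_divisor[of 15 223] by (simp_all del: prime_nat_numeral_eq)
  \<comment> \<open>Each prime of the chain is at most twice its predecessor minus 2, and the last
    one exceeds 2048.\<close>
  consider "4 \<le> n" "n < 5" | "5 \<le> n" "n < 7" | "7 \<le> n" "n < 11" | "11 \<le> n" "n < 19"
    | "19 \<le> n" "n < 31" | "31 \<le> n" "n < 59" | "59 \<le> n" "n < 113" | "113 \<le> n" "n < 223"
    | "223 \<le> n" "n < 443" | "443 \<le> n" "n < 883" | "883 \<le> n" "n < 1759" | "1759 \<le> n" "n < 3511"
    using n False by linarith
  then show ?thesis
    by cases (rule step, rule primes primes', simp, simp)+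
qed (rule prime_between_large)

section \<open>The presentations for all degrees\<close>

text \<open>Bertrand's bound \<open>2 * x - 2\<close> is even, so an odd prime misses it by one;
  this brings \<open>p\<close> down to \<open>n - 2\<close> for odd \<open>n\<close> too.\<close>

lemma prime_choice:
  assumes "7 \<le> n"
  obtains p :: nat where "prime p" "odd p" "5 \<le> p" "p + 2 \<le> n" "n + 1 \<le> 2 * p"
proof -
  define x where "x = (n + 1) div 2"
  have x: "4 \<le> x" "n \<le> 2 * x" "2 * x \<le> n + 1" using assms by (auto simp: x_def)
  obtain p where p: "prime p" "x < p" "p \<le> 2 * x - 2" using prime_between[OF x(1)] by blast
  have "odd p" using p x prime_odd_nat[of p] by simp
  then have "p \<noteq> 2 * x - 2" using x(1) by auto
  then have "p + 2 \<le> n" using p x by linarith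
  then show thesis using that[of p] p x \<open>odd p\<close> by simp
qed

theorem theorem3p36:
  shows "\<exists>(C :: real) (k :: nat). \<forall>n :: nat. n \<ge> 5 \<longrightarrow>
    has_short_presentation C k n (sym_group n) \<and>
    has_short_presentation C k n (alt_group n)"
proof (intro exI allI impI)
  fix n :: nat assume n: "n \<ge> 5"
  consider "n = 5" | "n = 6" | "n \<ge> 7" using n by linarith
  then show "has_short_presentation 710 700 n (sym_group n) \<and> has_short_presentation 710 700 n (alt_group n)"
  proof cases
    case 1
    \<comment> \<open>With \<open>p = 3\<close> the first construction reaches only the alternating
      group of degree 5 and the symmetric group of degree 6; the second one starts at degree
      7.\<close>
    then show ?thesis using short_presentation_5 short_presentation_1(1)[of 3 1 5] by simp
  next
    case 2
    then show ?thesis using short_presentation_6 short_presentation_1(2)[of 3 2 6] by simp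
  next
    case 3
    then obtain p :: nat where p: "prime p" "odd p" "5 \<le> p" "p + 2 \<le> n" "n + 1 \<le> 2 * p"
      using prime_choice by blast
    then have k: "0 < n - p - 1" "n - p - 1 < p" "n = p + (n - p - 1) + 1" "2 \<le> n - p" "n - p < p" "n = p + (n - p)"
      by linarith+
    \<comment> \<open>As \<open>p\<close> is odd, \<open>n - p - 1\<close> has the parity of
      \<open>n\<close> and \<open>n - p\<close> the opposite one, so the two constructions yield one
      group each.\<close>
    note 1 = short_presentation_1[OF p(1,2) k(1-3)] and 2 = short_presentation_2[OF p(1,2) k(4,5) p(3) k(6)]
    show ?thesis
    proof (cases "even n")
      case True
      then show ?thesis using 1(2) 2(1) p(2,4) by simp
    next
      case False
      then show ?thesis using 1(1) 2(2) p(2,4) by simp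
    qed
  qed
qed

end
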